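(* If $X$ is an $L_1$-predual with the Daugavet property, then $X$ has the polynomial WODP.
   Context: Banach spaces are over $\mathbb{K}\in\{\mathbb{R},\mathbb{C}\}$; $\mathbb{T}$ is the set of modulus-one scalars; $B_X$, $S_X$ are the closed unit ball and unit sphere. $X$ is an $L_1$-predual if $X^*$ is isometrically isomorphic to $L_1(\mu)$ for some positive measure $\mu$. $X$ has the Daugavet property if $\|\mathrm{Id}+T\|=1+\|T\|$ for every rank-one bounded linear operator $T\colon X\to X$. $\mathcal{P}(X)$ is the space of continuous scalar polynomials on $X$ (finite sums of continuous $k$-homogeneous polynomials, $k\geq0$, constant for $k=0$) with norm $\|P\|=\sup_{x\in B_X}|P(x)|$. For $x_1,\ldots,x_n\in S_X$, $x'\in B_X$, $\varepsilon>0$, let $\mathrm{OF}(x_1,\ldots,x_n;x',\varepsilon)$ be the set of $y\in B_X$ for which there is a bounded linear operator $T\colon X\to X$ with $\|T\|\leq1+\varepsilon$, $\|T(y)-x'\|<\varepsilon$ and $\|T(x_i)-x_i\|<\varepsilon$ for all $i$. $X$ has the polynomial weak operator Daugavet property (polynomial WODP) if for every $P\in\mathcal{P}(X)$ with $\|P\|=1$, every $x_1,\ldots,x_n\in S_X$, $x'\in B_X$, $\alpha>0$ and $\varepsilon>0$, there exist $y\in\mathrm{OF}(x_1,\ldots,x_n;x',\varepsilon)$ and $\omega\in\mathbb{T}$ with $\mathrm{Re}\,\omega P(y)>1-\alpha$. *)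

theory Defs
  imports "HOL-Analysis.Analysis"
begin

text \<open>
  The scalar field \<open>\<real>\<close> or \<open>\<complex>\<close>: a type that \<open>to_complex\<close> identifies, as a normed real algebra,
  either with the reals inside the complex numbers or with all of the complex numbers.
\<close>

class rc_field = real_normed_field + banach + second_countable_topology +
  fixes to_complex :: "'a \<Rightarrow> complex"
  assumes to_complex_add: "to_complex (x + y) = to_complex x + to_complex y"
    and to_complex_mult: "to_complex (x * y) = to_complex x * to_complex y"
    and to_complex_one: "to_complex 1 = 1"
    and to_complex_scaleR: "to_complex (r *\<^sub>R x) = r *\<^sub>R to_complex x"
    and norm_to_complex: "norm (to_complex x) = norm x"
    and range_to_complex: "range to_complex = \<real> \<or> range to_complex = UNIV"

instantiation real :: rc_field
begin
definition to_complex_real :: "real \<Rightarrow> complex" where "to_complex_real = complex_of_real"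
instance by standard (simp_all add: to_complex_real_def Reals_def scaleR_conv_of_real)
end

instantiation complex :: rc_field
begin
definition to_complex_complex :: "complex \<Rightarrow> complex" where "to_complex_complex = id"
instance by standard (simp_all add: to_complex_complex_def)
end

definition Re_K :: "'k::rc_field \<Rightarrow> real"
  where "Re_K c = Re (to_complex c)"

text \<open>
  A Banach space over \<open>'k\<close> is a real Banach space carrying a compatible scalar multiplication
  by \<open>'k\<close>; for \<open>'k = real\<close> the last axiom forces \<open>smul = scaleR\<close>.
\<close>

locale banach_space_over = vector_space smul
  for smul :: "'k::rc_field \<Rightarrow> 'a::banach \<Rightarrow> 'a" +
  assumes norm_smul: "norm (smul c x) = norm c * norm x"
    and smul_of_real: "smul (of_real r) x = r *\<^sub>R x"

definition bounded_linear_over ::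
    "('k::rc_field \<Rightarrow> 'a::real_normed_vector \<Rightarrow> 'a) \<Rightarrow> ('k \<Rightarrow> 'b::real_normed_vector \<Rightarrow> 'b) \<Rightarrow>
     ('a \<Rightarrow> 'b) \<Rightarrow> bool"
  where "bounded_linear_over smul1 smul2 T \<longleftrightarrow>
    bounded_linear T \<and> Vector_Spaces.linear smul1 smul2 T"

definition dual :: "('k::rc_field \<Rightarrow> 'a::banach \<Rightarrow> 'a) \<Rightarrow> ('a \<Rightarrow> 'k) set"
  where "dual smul = {f. bounded_linear_over smul (*) f}"

definition ae_eq_rel :: "'m measure \<Rightarrow> (('m \<Rightarrow> 'k::rc_field) \<times> ('m \<Rightarrow> 'k)) set"
  where "ae_eq_rel M = {(u, v). integrable M u \<and> integrable M v \<and> (AE t in M. u t = v t)}"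

definition L1 :: "'m measure \<Rightarrow> ('m \<Rightarrow> 'k::rc_field) set set"
  where "L1 M = {u. integrable M u} // ae_eq_rel M"

text \<open>
  The vector space operations and the norm of \<open>L1 M\<close> are expressed through representatives of
  the equivalence classes.
\<close>

definition isometric_iso_dual_L1 ::
    "('k::rc_field \<Rightarrow> 'a::banach \<Rightarrow> 'a) \<Rightarrow> 'm measure \<Rightarrow> (('a \<Rightarrow> 'k) \<Rightarrow> ('m \<Rightarrow> 'k) set) \<Rightarrow> bool"
  where "isometric_iso_dual_L1 smul M \<Phi> \<longleftrightarrow>
    bij_betw \<Phi> (dual smul) (L1 M) \<and>
    (\<forall>f\<in>dual smul. \<forall>g\<in>dual smul. \<forall>u\<in>\<Phi> f. \<forall>v\<in>\<Phi> g.
       (\<lambda>t. u t + v t) \<in> \<Phi> (\<lambda>x. f x + g x)) \<and>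
    (\<forall>c. \<forall>f\<in>dual smul. \<forall>u\<in>\<Phi> f. (\<lambda>t. c * u t) \<in> \<Phi> (\<lambda>x. c * f x)) \<and>
    (\<forall>f\<in>dual smul. \<forall>u\<in>\<Phi> f. (LINT t|M. norm (u t)) = onorm f)"

text \<open>
  HOL cannot quantify existentially over the type of points of the measure space, so that type is
  a parameter. As a hypothesis of a theorem, \<open>L1_predual TYPE('m) smul\<close> with \<open>'m\<close> a type variable
  covers measures on arbitrary sets.
\<close>

definition L1_predual :: "'m itself \<Rightarrow> ('k::rc_field \<Rightarrow> 'a::banach \<Rightarrow> 'a) \<Rightarrow> bool"
  where "L1_predual (_ :: 'm itself) smul \<longleftrightarrow>
    (\<exists>(M :: 'm measure) \<Phi>. isometric_iso_dual_L1 smul M \<Phi>)"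

definition daugavet_property :: "('k::rc_field \<Rightarrow> 'a::banach \<Rightarrow> 'a) \<Rightarrow> bool"
  where "daugavet_property smul \<longleftrightarrow>
    (\<forall>T. bounded_linear_over smul smul T \<and> vector_space.dim smul (range T) = 1 \<longrightarrow>
         onorm (\<lambda>x. x + T x) = 1 + onorm T)"

text \<open>
  A form in \<open>k\<close> vector variables is encoded as a function of sequences that reads only the entries
  with index below \<open>k\<close>. Sequences carry the product topology, so for such a function continuity
  is continuity on the \<open>k\<close>-fold product. For \<open>k = 0\<close> the form is a constant.
\<close>

definition continuous_multilinear_form ::
    "('k::rc_field \<Rightarrow> 'a::banach \<Rightarrow> 'a) \<Rightarrow> nat \<Rightarrow> ((nat \<Rightarrow> 'a) \<Rightarrow> 'k) \<Rightarrow> bool"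
  where "continuous_multilinear_form smul k A \<longleftrightarrow>
    (\<forall>v w. (\<forall>i<k. v i = w i) \<longrightarrow> A v = A w) \<and>
    (\<forall>v. \<forall>i<k. Vector_Spaces.linear smul (*) (\<lambda>x. A (v(i := x)))) \<and>
    continuous_on UNIV A"

definition homogeneous_polynomials ::
    "('k::rc_field \<Rightarrow> 'a::banach \<Rightarrow> 'a) \<Rightarrow> nat \<Rightarrow> ('a \<Rightarrow> 'k) set"
  where "homogeneous_polynomials smul k =
    {P. \<exists>A. continuous_multilinear_form smul k A \<and> (\<forall>x. P x = A (\<lambda>_. x))}"

definition polynomials :: "('k::rc_field \<Rightarrow> 'a::banach \<Rightarrow> 'a) \<Rightarrow> ('a \<Rightarrow> 'k) set"
  where "polynomials smul =
    {P. \<exists>n Q. (\<forall>k\<le>n. Q k \<in> homogeneous_polynomials smul k) \<and> (\<forall>x. P x = (\<Sum>k\<le>n. Q k x))}"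

definition poly_norm :: "('a::banach \<Rightarrow> 'k::rc_field) \<Rightarrow> real"
  where "poly_norm P = (SUP x\<in>cball 0 1. norm (P x))"

definition OF_set ::
    "('k::rc_field \<Rightarrow> 'a::banach \<Rightarrow> 'a) \<Rightarrow> 'a list \<Rightarrow> 'a \<Rightarrow> real \<Rightarrow> 'a set"
  where "OF_set smul xs x' \<epsilon> =
    {y \<in> cball 0 1. \<exists>T. bounded_linear_over smul smul T \<and> onorm T \<le> 1 + \<epsilon> \<and>
       norm (T y - x') < \<epsilon> \<and> (\<forall>x\<in>set xs. norm (T x - x) < \<epsilon>)}"

definition polynomial_WODP :: "('k::rc_field \<Rightarrow> 'a::banach \<Rightarrow> 'a) \<Rightarrow> bool"
  where "polynomial_WODP smul \<longleftrightarrow>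
    (\<forall>P xs x' \<alpha> \<epsilon>. P \<in> polynomials smul \<and> poly_norm P = 1 \<and> set xs \<subseteq> sphere 0 1 \<and>
       x' \<in> cball 0 1 \<and> 0 < \<alpha> \<and> 0 < \<epsilon> \<longrightarrow>
       (\<exists>y\<in>OF_set smul xs x' \<epsilon>. \<exists>\<omega>. norm \<omega> = 1 \<and> Re_K (\<omega> * P y) > 1 - \<alpha>))"

end

theory Submission imports Defs "HOL-Library.Function_Algebras" begin

text \<open>
  An \<open>L\<^sub>1\<close>-predual behaves like a space of continuous functions: a finite system of norm
  inequalities for unknown vectors can be solved, up to a small error, as soon as it can be solved
  after evaluation at each functional of norm at most one, with scalars of modulus at most one
  that may depend on the functional. This is \<open>pointwise_system_solvable\<close>. By Hahn--Banach
  (\<open>seminorm_system_solvable\<close>) an obstruction to solvability consists of finitely many functionals.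
  These lie, up to a small error, in an isometric copy of a finite-dimensional \<open>\<ell>\<^sub>1\<close> inside the
  dual (\<open>dual_l1_approximation\<close>), and there the obstruction is refuted one basis functional at a
  time. One can also prescribe unimodular values of the unknowns at finitely many functionals,
  provided that these are almost disjoint, that is, almost carried by disjoint sets of basis
  functionals. The Daugavet property provides such functionals: every slice of the dual ball
  contains one that is almost disjoint from any finite set of given ones
  (\<open>almost_disjoint_functionals\<close>).

  Now let \<open>y\<^sub>0\<close> in the unit ball almost attain the norm of the polynomial \<open>P\<close>, and let \<open>d\<close> range
  over a finite net of coefficient vectors with \<open>n + 1\<close> entries. Choose almost disjoint functionals
  \<open>g d k\<close> (\<open>k < N\<close>), where \<open>g d k\<close> almost norms the combination of \<open>x\<^sub>1, \<dots>, x\<^sub>n\<close> whose coefficients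
  are the first \<open>n\<close> entries of \<open>d\<close>. The first use of \<open>pointwise_system_solvable\<close> gives vectors
  \<open>y k\<close> in the unit ball such that \<open>g d k (y k)\<close> is almost a prescribed unimodular scalar, the one
  that rotates the last entry of \<open>d\<close> to a nonnegative number. Pointwise, each \<open>y k\<close> differs from
  \<open>y\<^sub>0\<close> only on a set of its own, so all signed sums of the differences \<open>y k - y\<^sub>0\<close> have norm at most
  5, whatever \<open>N\<close> is (\<open>spread_out_perturbations\<close>). Along such a sequence the sum of the numbers
  \<open>\<bar>P (y k) - P y\<^sub>0\<bar>\<close> is bounded independently of \<open>N\<close> (\<open>polynomial_fluctuation\<close>). Hence for large \<open>N\<close>
  some \<open>y = y k\<close> satisfies \<open>P y \<approx> P y\<^sub>0\<close>.

  It remains to see that this \<open>y\<close> belongs to the operator set of the definition. By the choice of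
  the functionals, the finitely many points \<open>(g d k x\<^sub>1, \<dots>, g d k x\<^sub>n, g d k y)\<close> have, up to a small
  error, at least as large a support function as the set of all \<open>(b x\<^sub>1, \<dots>, b x\<^sub>n, b x')\<close> with
  \<open>b\<close> in the dual ball (\<open>almost_orthogonal_functionals_support\<close>). The second use of
  \<open>pointwise_system_solvable\<close>, in \<open>approximate_barycentric_vectors\<close>, turns this into vectors \<open>e d\<close>
  that behave like a partition of unity, with \<open>x\<^sub>i \<approx> (\<Sum>d. g d k x\<^sub>i \<cdot> e d)\<close> and
  \<open>x' \<approx> (\<Sum>d. g d k y \<cdot> e d)\<close>. The operator \<open>T v = (\<Sum>d. g d k v \<cdot> e d)\<close> then has norm at most
  \<open>1 + \<epsilon>\<close>, almost fixes the \<open>x\<^sub>i\<close> and sends \<open>y\<close> close to \<open>x'\<close>.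
\<close>

section \<open>A Hahn--Banach theorem for sublinear functionals\<close>

text \<open>
  Families of vectors form a real vector space; Hahn--Banach is applied to such families below.
\<close>

instantiation "fun" :: (type, real_vector) real_vector
begin
definition scaleR_fun :: "real \<Rightarrow> ('a \<Rightarrow> 'b) \<Rightarrow> 'a \<Rightarrow> 'b"
  where "scaleR_fun c f = (\<lambda>x. c *\<^sub>R f x)"
instance
  by standard (simp_all add: scaleR_fun_def fun_eq_iff scaleR_add_right scaleR_add_left)
end

text \<open>
  Homogeneity is required as an inequality for positive factors only, which is what infima of
  sublinear functionals inherit directly; equality and the value at zero follow.
\<close>

definition sublinear :: "('v::real_vector \<Rightarrow> real) \<Rightarrow> bool"
  where "sublinear p \<longleftrightarrow>
    (\<forall>u v. p (u + v) \<le> p u + p v) \<and> (\<forall>c>0. \<forall>v. p (c *\<^sub>R v) \<le> c * p v)"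

lemma sublinear_scale:
  assumes "sublinear p" "c \<ge> 0"
  shows "p (c *\<^sub>R v) = c * p v"
proof (cases "c = 0")
  case True
  have "p 0 \<le> (1/2) * p 0" "p 0 \<le> 2 * p 0"
    using assms(1) unfolding sublinear_def
    by (metis scaleR_zero_right zero_less_divide_1_iff zero_less_numeral)
       (metis assms(1) sublinear_def scaleR_zero_right zero_less_numeral)
  then show ?thesis using True by simp
next
  case False
  then have "c > 0" using assms by simp
  have "p ((1/c) *\<^sub>R (c *\<^sub>R v)) \<le> (1/c) * p (c *\<^sub>R v)"
    using assms(1) \<open>c > 0\<close> unfolding sublinear_def by (metis zero_less_divide_1_iff)
  then have "c * p v \<le> p (c *\<^sub>R v)"
    using \<open>c > 0\<close> by (simp add: field_simps)
  moreover have "p (c *\<^sub>R v) \<le> c * p v"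
    using assms(1) \<open>c > 0\<close> unfolding sublinear_def by metis
  ultimately show ?thesis by simp
qed

lemma sublinear_zero: "sublinear p \<Longrightarrow> p 0 = 0"
  using sublinear_scale[of p 0 0] by simp

lemma sublinear_minus: "sublinear p \<Longrightarrow> - p (- v) \<le> p v"
  using sublinear_zero[of p] unfolding sublinear_def
  by (metis add.right_inverse minus_le_iff neg_le_iff_le diff_le_eq diff_0 add.commute)

text \<open>
  The functional \<open>v \<mapsto> inf (p (v + t a) - t p a)\<close>, with the infimum over \<open>t \<ge> 0\<close>, is the usual
  way to push a sublinear functional down until it is linear in the direction \<open>a\<close>. It serves twice
  below: a minimal sublinear functional cannot be pushed down, hence is odd, and starting from it
  one retains the value at \<open>a\<close>.
\<close>

lemma sublinear_directional:
  assumes p: "sublinear p"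
  obtains q where "sublinear q" "\<And>v. q v \<le> p v" "q (- a) \<le> - p a"
proof -
  define X where "X v t = p (v + t *\<^sub>R a) - t * p a" for v t
  define q where "q v = (INF t\<in>{0..}. X v t)" for v
  have padd: "p (u + v) \<le> p u + p v" for u v
    using p unfolding sublinear_def by blast
  have low: "- p (- v) \<le> X v t" if "t \<ge> 0" for v t
  proof -
    have "t * p a = p (t *\<^sub>R a)" using sublinear_scale[OF p that] by simp
    also have "\<dots> \<le> p (v + t *\<^sub>R a) + p (- v)" using padd[of "v + t *\<^sub>R a" "- v"] by simp
    finally show ?thesis by (simp add: X_def)
  qed
  have bdd: "bdd_below (X v ` {0..})" for v
    using low by (intro bdd_belowI2[of _ "- p (- v)"]) auto
  have qle: "q v \<le> X v t" if "t \<ge> 0" for v t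
    unfolding q_def using bdd that by (intro cINF_lower) auto
  have qgr: "c \<le> q v" if "\<And>t. t \<ge> 0 \<Longrightarrow> c \<le> X v t" for c v
    unfolding q_def using that by (intro cINF_greatest) auto
  have "sublinear q"
    unfolding sublinear_def
  proof (intro conjI allI impI)
    fix u v
    have "q (u + v) - X v t \<le> X u s" if "s \<ge> 0" "t \<ge> 0" for s t
    proof -
      have "q (u + v) \<le> X (u + v) (s + t)" using that by (intro qle) simp
      also have "p (u + v + (s + t) *\<^sub>R a) \<le> p (u + s *\<^sub>R a) + p (v + t *\<^sub>R a)"
        using padd[of "u + s *\<^sub>R a" "v + t *\<^sub>R a"] by (simp add: algebra_simps)
      then have "X (u + v) (s + t) \<le> X u s + X v t"
        by (simp add: X_def algebra_simps)
      finally show ?thesis by simp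
    qed
    then have "q (u + v) - X v t \<le> q u" if "t \<ge> 0" for t
      using that by (intro qgr) auto
    then have "q (u + v) - q u \<le> q v"
      by (intro qgr) (smt (verit))
    then show "q (u + v) \<le> q u + q v" by simp
  next
    fix c :: real and v assume c: "c > 0"
    have "q (c *\<^sub>R v) / c \<le> X v t" if "t \<ge> 0" for t
    proof -
      have "q (c *\<^sub>R v) \<le> X (c *\<^sub>R v) (c * t)" using that c by (intro qle) simp
      also have "p (c *\<^sub>R (v + t *\<^sub>R a)) = c * p (v + t *\<^sub>R a)"
        using sublinear_scale[OF p] c by simp
      then have "X (c *\<^sub>R v) (c * t) = c * X v t"
        by (simp add: X_def algebra_simps)
      finally show ?thesis using c by (simp add: field_simps)
    qed
    then have "q (c *\<^sub>R v) / c \<le> q v" by (intro qgr)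
    then show "q (c *\<^sub>R v) \<le> c * q v" using c by (simp add: field_simps)
  qed
  moreover have "q v \<le> p v" for v using qle[of 0 v] by (simp add: X_def)
  moreover have "q (- a) \<le> - p a" using qle[of 1 "- a"] sublinear_zero[OF p] by (simp add: X_def)
  ultimately show ?thesis using that by blast
qed

text \<open>
  Zorn's lemma applies because the pointwise infimum of a chain of sublinear functionals below
  \<open>p\<close> is finite, being bounded below by \<open>- p (- v)\<close>, and again sublinear.
\<close>

lemma minimal_sublinear_exists:
  assumes p: "sublinear p"
  obtains q where "sublinear q" "\<And>v. q v \<le> p v"
    "\<And>q'. sublinear q' \<Longrightarrow> (\<And>v. q' v \<le> q v) \<Longrightarrow> q' = q"
proof -
  define A where "A = {q. sublinear q \<and> (\<forall>v. q v \<le> p v)}"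
  define P :: "('a \<Rightarrow> real) \<Rightarrow> ('a \<Rightarrow> real) \<Rightarrow> bool" where "P q q' \<longleftrightarrow> (\<forall>v. q' v \<le> q v)" for q q'
  have "\<exists>m\<in>A. \<forall>a\<in>A. P m a \<longrightarrow> a = m"
  proof (rule predicate_Zorn)
    show "partial_order_on A (relation_of P A)"
      by (rule partial_order_on_relation_ofI) (auto simp: P_def fun_eq_iff intro: order.trans order.antisym)
  next
    fix C assume "C \<in> Chains (relation_of P A)"
    then have CA: "C \<subseteq> A" and tot: "\<And>q q'. q \<in> C \<Longrightarrow> q' \<in> C \<Longrightarrow> P q q' \<or> P q' q"
      by (auto simp: Chains_def relation_of_def)
    show "\<exists>u\<in>A. \<forall>a\<in>C. P a u"
    proof (cases "C = {}")
      case True then show ?thesis using p by (auto simp: A_def intro!: bexI[of _ p])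
    next
      case False
      define u where "u v = (INF q\<in>C. q v)" for v
      have low: "- p (- v) \<le> q v" if "q \<in> C" for q v
      proof -
        have "sublinear q" "q (- v) \<le> p (- v)" using that CA by (auto simp: A_def)
        then show ?thesis using sublinear_minus[of q v] by simp
      qed
      have bdd: "bdd_below ((\<lambda>q. q v) ` C)" for v
        using low by (intro bdd_belowI2) auto
      have ule: "u v \<le> q v" if "q \<in> C" for q v
        unfolding u_def using that bdd by (intro cINF_lower) auto
      have ugr: "c \<le> u v" if "\<And>q. q \<in> C \<Longrightarrow> c \<le> q v" for c v
        unfolding u_def using that False by (intro cINF_greatest) auto
      have Csub: "q (x + y) \<le> q x + q y" "c > 0 \<Longrightarrow> q (c *\<^sub>R x) \<le> c * q x" if "q \<in> C" for q x y c
        using that CA unfolding A_def sublinear_def by blast+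
      have "sublinear u"
        unfolding sublinear_def
      proof (intro conjI allI impI)
        fix x y
        have "u (x + y) - q' y \<le> q x" if qC: "q \<in> C" "q' \<in> C" for q q'
        proof -
          consider "P q q'" | "P q' q" using tot[OF qC] by blast
          then show ?thesis
          proof cases
            case 1
            then have "u (x + y) \<le> q' x + q' y" "q' x \<le> q x"
              using ule[OF that(2), of "x + y"] Csub(1)[OF that(2), of x y] by (auto simp: P_def)
            then show ?thesis by simp
          next
            case 2
            then have "u (x + y) \<le> q x + q y" "q y \<le> q' y"
              using ule[OF that(1), of "x + y"] Csub(1)[OF that(1), of x y] by (auto simp: P_def)
            then show ?thesis by simp
          qed
        qed
        then have "u (x + y) - q' y \<le> u x" if "q' \<in> C" for q'
          using that by (intro ugr) auto
        then have "u (x + y) - u x \<le> u y"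
          by (intro ugr) (smt (verit))
        then show "u (x + y) \<le> u x + u y" by simp
      next
        fix c :: real and x assume c: "c > 0"
        have "u (c *\<^sub>R x) / c \<le> q x" if "q \<in> C" for q
          using ule[OF that, of "c *\<^sub>R x"] Csub(2)[OF that c, of x] c by (simp add: field_simps)
        then have "u (c *\<^sub>R x) / c \<le> u x" by (intro ugr)
        then show "u (c *\<^sub>R x) \<le> c * u x" using c by (simp add: field_simps)
      qed
      moreover have "u v \<le> p v" for v
      proof -
        obtain q where "q \<in> C" using False by blast
        moreover from this have "q v \<le> p v" using CA by (auto simp: A_def)
        ultimately show ?thesis using ule[of q v] by simp
      qed
      ultimately show ?thesis using ule by (auto simp: A_def P_def intro!: bexI[of _ u])
    qed
  qed
  then obtain m where m: "m \<in> A" "\<And>a. a \<in> A \<Longrightarrow> P m a \<Longrightarrow> a = m" by blast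
  show ?thesis
  proof (rule that[of m])
    show "sublinear m" "\<And>v. m v \<le> p v" using m(1) by (auto simp: A_def)
    fix q' assume "sublinear q'" "\<And>v. q' v \<le> m v"
    moreover from this have "q' \<in> A" using m(1) by (auto simp: A_def intro: order.trans)
    ultimately show "q' = m" using m(2) by (auto simp: P_def)
  qed
qed

text \<open>
  The linear functional is a minimal sublinear functional: minimality makes it odd, and an odd
  sublinear functional is linear. Starting below \<open>p\<close> in the direction \<open>a\<close> secures the value at \<open>a\<close>.
\<close>

lemma hahn_banach_sublinear:
  assumes p: "sublinear p"
  obtains F where "linear F" "\<And>v. F v \<le> p v" "F a = p a"
proof -
  obtain p' where p': "sublinear p'" "\<And>v. p' v \<le> p v" "p' (- a) \<le> - p a"
    using sublinear_directional[OF p] by metis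
  obtain F where F: "sublinear F" "\<And>v. F v \<le> p' v"
    and min: "\<And>q'. sublinear q' \<Longrightarrow> (\<And>v. q' v \<le> F v) \<Longrightarrow> q' = F"
    using minimal_sublinear_exists[OF p'(1)] by metis
  have neg: "F (- v) = - F v" for v
  proof -
    obtain q where "sublinear q" "\<And>u. q u \<le> F u" "q (- v) \<le> - F v"
      using sublinear_directional[OF F(1)] by metis
    then have "F (- v) \<le> - F v" using min by metis
    then show ?thesis using sublinear_minus[OF F(1), of v] by simp
  qed
  have "linear F"
  proof (rule linearI)
    fix u v :: 'a and c :: real
    have "F (u + v) \<le> F u + F v" "F (- u + - v) \<le> F (- u) + F (- v)"
      using F(1) unfolding sublinear_def by blast+
    moreover have "F (- u + - v) = - F (u + v)" using neg[of "u + v"] by simp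
    ultimately show "F (u + v) = F u + F v" using neg by simp
    show "F (c *\<^sub>R u) = c *\<^sub>R F u"
    proof (cases "c \<ge> 0")
      case True then show ?thesis using sublinear_scale[OF F(1)] by simp
    next
      case False
      then show ?thesis using sublinear_scale[OF F(1), of "- c" u] neg[of "c *\<^sub>R u"] by simp
    qed
  qed
  moreover have "F v \<le> p v" for v using F(2) p'(2) order.trans by blast
  moreover have "F a = p a"
    using F(2)[of "- a"] p'(3) neg[of a] \<open>F a \<le> p a\<close> by simp
  ultimately show ?thesis using that by blast
qed

section \<open>The scalar field\<close>

lemma Re_K_simps:
  fixes x y :: "'k::rc_field"
  shows "Re_K (x + y) = Re_K x + Re_K y" "Re_K (x - y) = Re_K x - Re_K y" "Re_K (- x) = - Re_K x"
    "Re_K (of_real r :: 'k) = r" "Re_K (of_real r * x) = r * Re_K x" "Re_K (r *\<^sub>R x) = r * Re_K x"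
    "Re_K (0 :: 'k) = 0"
proof -
  show scale: "Re_K (r *\<^sub>R x) = r * Re_K x" for x :: 'k and r by (simp add: Re_K_def to_complex_scaleR)
  show add: "Re_K (x + y) = Re_K x + Re_K y" for x y :: 'k by (simp add: Re_K_def to_complex_add)
  show neg: "Re_K (- x) = - Re_K x" for x :: 'k using scale[of "-1" x] by simp
  show "Re_K (x - y) = Re_K x - Re_K y" using add[of x "- y"] neg by simp
  show "Re_K (of_real r :: 'k) = r" by (simp add: of_real_def scale Re_K_def to_complex_one to_complex_scaleR)
  show "Re_K (of_real r * x) = r * Re_K x" using scale by (simp add: scaleR_conv_of_real)
  show "Re_K (0 :: 'k) = 0" using scale[of 0 0] by simp
qed

lemma Re_K_sum: "Re_K (sum f A) = (\<Sum>a\<in>A. Re_K (f a))"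
  by (induction A rule: infinite_finite_induct) (simp_all add: Re_K_simps)

lemma Re_K_le_norm: "Re_K x \<le> norm x"
  unfolding Re_K_def using complex_Re_le_cmod norm_to_complex by metis

lemma abs_Re_K_le_norm: "\<bar>Re_K x\<bar> \<le> norm x"
  unfolding Re_K_def using abs_Re_le_cmod norm_to_complex by metis

lemma to_complex_inj: "to_complex (x::'k::rc_field) = to_complex y \<Longrightarrow> x = y"
proof -
  assume "to_complex x = to_complex y"
  then have "to_complex (x - y) = 0"
    using to_complex_add[of x "- y"] to_complex_scaleR[of "-1" y] by simp
  then show "x = y" using norm_to_complex[of "x - y"] by simp
qed

lemma unimodular_to_norm:
  fixes z :: "'k::rc_field"
  obtains \<omega> where "norm \<omega> = 1" "\<omega> * z = of_real (norm z)"
proof (cases "z = 0")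
  case True then show ?thesis using that[of 1] by simp
next
  case False
  show ?thesis using False by (intro that[of "of_real (norm z) / z"]) (simp_all add: norm_divide)
qed

text \<open>
  The scalars form a closed subset of the complex plane, so their unit ball is compact.
\<close>

lemma finite_net_unit_ball:
  assumes "\<eta> > 0"
  obtains Z :: "'k::rc_field set" where "finite Z" "\<And>z. z \<in> Z \<Longrightarrow> norm z \<le> 1" "0 \<in> Z" "1 \<in> Z"
    "\<And>x. norm x \<le> 1 \<Longrightarrow> \<exists>z\<in>Z. norm (x - z) \<le> \<eta>"
proof -
  have eq: "to_complex ` cball (0::'k) 1 = cball 0 1 \<inter> range (to_complex :: 'k \<Rightarrow> complex)"
    by (auto simp: norm_to_complex)
  have "closed (range (to_complex :: 'k \<Rightarrow> complex))"
    using range_to_complex[where 'a = 'k] closed_complex_Reals by auto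
  then have "compact (to_complex ` cball (0::'k) 1)"
    unfolding eq by (intro compact_Int_closed compact_cball)
  then obtain W where W: "finite W" "W \<subseteq> to_complex ` cball (0::'k) 1"
    "to_complex ` cball (0::'k) 1 \<subseteq> (\<Union>x\<in>W. ball x \<eta>)"
    using compact_imp_seq_compact seq_compact_imp_totally_bounded assms by metis
  obtain Z0 where Z0: "Z0 \<subseteq> cball (0::'k) 1" "finite Z0" "W = to_complex ` Z0"
    using finite_subset_image[OF W(1,2)] by metis
  show ?thesis
  proof (rule that[of "insert 0 (insert 1 Z0)"])
    fix x :: 'k assume "norm x \<le> 1"
    then obtain z where z: "z \<in> Z0" "dist (to_complex z) (to_complex x) < \<eta>"
      using W(3) Z0(3) by force
    have "norm (x - z) = norm (to_complex (x - z))" by (simp add: norm_to_complex)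
    also have "to_complex (x - z) = to_complex x - to_complex z"
      using to_complex_add[of x "- z"] to_complex_scaleR[of "-1" z] by simp
    also have "norm \<dots> \<le> \<eta>" using z(2) by (simp add: dist_norm norm_minus_commute)
    finally show "\<exists>z\<in>insert 0 (insert 1 Z0). norm (x - z) \<le> \<eta>" using z(1) by blast
  qed (use Z0 in auto)
qed

section \<open>Functionals and duality for finite systems of seminorm inequalities\<close>

context banach_space_over
begin

lemma vector_space_scalars: "vector_space ((*) :: 'k \<Rightarrow> 'k \<Rightarrow> 'k)"
  by standard (simp_all add: algebra_simps)

lemma dualI:
  assumes "\<And>x y. f (x + y) = f x + f y" "\<And>c x. f (smul c x) = c * f x"
    "\<And>x. norm (f x) \<le> K * norm x"
  shows "f \<in> dual smul"
proof -
  have "bounded_linear f"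
  proof (rule bounded_linear_intro[where K = K])
    show "f (r *\<^sub>R x) = r *\<^sub>R f x" for r x
      using assms(2)[of "of_real r" x] by (simp add: smul_of_real scaleR_conv_of_real)
  qed (use assms in \<open>simp_all add: mult.commute\<close>)
  moreover have "Vector_Spaces.linear smul (*) f"
    unfolding Vector_Spaces.linear_iff
    using vector_space_scalars vector_space_axioms assms by auto
  ultimately show ?thesis by (simp add: dual_def bounded_linear_over_def)
qed

lemma dualD:
  assumes "f \<in> dual smul"
  shows "bounded_linear f" "f (x + y) = f x + f y" "f (smul c x) = c * f x" "f 0 = 0"
    "f (x - y) = f x - f y" "f (r *\<^sub>R x) = r *\<^sub>R f x"
    "norm (f x) \<le> onorm f * norm x" "f (sum h A) = (\<Sum>a\<in>A. f (h a))"
proof -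
  show b: "bounded_linear f" using assms by (simp add: dual_def bounded_linear_over_def)
  interpret bounded_linear f by fact
  show "f (x + y) = f x + f y" "f 0 = 0" "f (x - y) = f x - f y" "f (r *\<^sub>R x) = r *\<^sub>R f x"
    "f (sum h A) = (\<Sum>a\<in>A. f (h a))"
    by (simp_all add: add diff scaleR sum)
  show "f (smul c x) = c * f x"
    using assms unfolding dual_def bounded_linear_over_def Vector_Spaces.linear_iff by blast
  show "norm (f x) \<le> onorm f * norm x" using onorm[OF b] by simp
qed

lemma dual_onorm_nonneg: "f \<in> dual smul \<Longrightarrow> 0 \<le> onorm f"
  using onorm_pos_le dualD(1) by blast

lemma dual_norm_le:
  assumes "f \<in> dual smul" "onorm f \<le> c"
  shows "norm (f x) \<le> c * norm x"
  using dualD(7)[OF assms(1), of x] mult_right_mono[OF assms(2), of "norm x"] by simp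

lemma dual_norm_le_unit:
  assumes "f \<in> dual smul" "onorm f \<le> 1" "norm x \<le> 1"
  shows "norm (f x) \<le> 1"
  using dual_norm_le[OF assms(1,2), of x] assms(3) by simp

lemma dual_zero: "(\<lambda>x. 0) \<in> dual smul"
  by (rule dualI[where K = 0]) simp_all

lemma dual_add:
  assumes "f \<in> dual smul" "g \<in> dual smul"
  shows "(\<lambda>x. f x + g x) \<in> dual smul"
proof (rule dualI[where K = "onorm f + onorm g"])
  show "norm (f x + g x) \<le> (onorm f + onorm g) * norm x" for x
    using dualD(7)[OF assms(1), of x] dualD(7)[OF assms(2), of x] norm_triangle_ineq[of "f x" "g x"]
    by (simp add: algebra_simps)
qed (simp_all add: dualD[OF assms(1)] dualD[OF assms(2)] algebra_simps)

lemma dual_scale: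
  assumes "f \<in> dual smul"
  shows "(\<lambda>x. c * f x) \<in> dual smul"
proof (rule dualI[where K = "norm c * onorm f"])
  show "norm (c * f x) \<le> norm c * onorm f * norm x" for x
    using mult_left_mono[OF dualD(7)[OF assms(1), of x], of "norm c"]
    by (simp add: norm_mult mult.assoc)
qed (simp_all add: dualD[OF assms(1)] algebra_simps)

lemma dual_sum:
  assumes "\<And>i. i \<in> I \<Longrightarrow> f i \<in> dual smul"
  shows "(\<lambda>x. \<Sum>i\<in>I. c i * f i x) \<in> dual smul"
  using assms
proof (induction I rule: infinite_finite_induct)
  case (insert i I)
  then show ?case using dual_add[OF dual_scale[of "f i" "c i"]] by simp
qed (simp_all add: dual_zero)

lemma dual_diff:
  assumes "f \<in> dual smul" "g \<in> dual smul"
  shows "(\<lambda>x. f x - g x) \<in> dual smul"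
  using dual_add[OF assms(1) dual_scale[OF assms(2), of "-1"]] by simp

lemma onorm_dual_add_le:
  assumes "f \<in> dual smul" "g \<in> dual smul"
  shows "onorm (\<lambda>x. f x + g x) \<le> onorm f + onorm g"
  using onorm_triangle dualD(1) assms by blast

lemma onorm_dual_scale:
  assumes "f \<in> dual smul"
  shows "onorm (\<lambda>x. c * f x) = norm c * onorm f"
proof -
  have le: "onorm (\<lambda>x. c * f x) \<le> norm c * onorm f" if "f \<in> dual smul" for c f
    using mult_left_mono[OF dualD(7)[OF that], of "norm c"] dual_onorm_nonneg[OF that]
    by (intro onorm_bound) (simp_all add: norm_mult mult.assoc)
  show ?thesis
  proof (cases "c = 0")
    case True then show ?thesis by (simp add: onorm_zero)
  next
    case False
    have "onorm (\<lambda>x. (1/c) * (c * f x)) \<le> norm (1/c) * onorm (\<lambda>x. c * f x)"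
      using le[OF dual_scale[OF assms]] .
    then have "onorm f \<le> norm (1/c) * onorm (\<lambda>x. c * f x)" using False by simp
    then have "norm c * onorm f \<le> onorm (\<lambda>x. c * f x)"
      using False by (simp add: norm_divide field_simps)
    then show ?thesis using le[OF assms, of c] by simp
  qed
qed

lemma onorm_dual_sum_le:
  assumes "\<And>i. i \<in> I \<Longrightarrow> f i \<in> dual smul"
  shows "onorm (\<lambda>x. \<Sum>i\<in>I. c i * f i x) \<le> (\<Sum>i\<in>I. norm (c i) * onorm (f i))"
  using assms
proof (induction I rule: infinite_finite_induct)
  case (insert i I)
  then have "onorm (\<lambda>x. c i * f i x + (\<Sum>i\<in>I. c i * f i x)) \<le>
      onorm (\<lambda>x. c i * f i x) + onorm (\<lambda>x. \<Sum>i\<in>I. c i * f i x)"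
    by (intro onorm_dual_add_le dual_scale dual_sum) auto
  with insert show ?case by (simp add: onorm_dual_scale)
qed (simp_all add: onorm_zero)

lemma smul_minus_one: "smul (-1) x = - x"
  using smul_of_real[of "-1" x] by simp

text \<open>
  Over the complex scalars the extension is \<open>x \<mapsto> F x - i F (i x)\<close>.
\<close>

lemma real_functional_is_real_part:
  fixes F :: "'a \<Rightarrow> real"
  assumes F: "linear F"
  obtains \<phi> :: "'a \<Rightarrow> 'k" where "\<And>x y. \<phi> (x + y) = \<phi> x + \<phi> y" "\<And>c x. \<phi> (smul c x) = c * \<phi> x"
    "\<And>x. Re_K (\<phi> x) = F x"
proof -
  have tc_of_real: "to_complex (of_real r :: 'k) = of_real r" for r
    by (simp add: of_real_def to_complex_one to_complex_scaleR)
  have Fadd: "F (x + y) = F x + F y" and Fsc: "F (r *\<^sub>R x) = r * F x" for x y r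
    using F by (simp_all add: linear_add linear_scale)
  consider "range (to_complex :: 'k \<Rightarrow> complex) = \<real>" | "range (to_complex :: 'k \<Rightarrow> complex) = UNIV"
    using range_to_complex by blast
  then show ?thesis
  proof cases
    case 1
    have sc: "\<exists>r. c = of_real r" for c :: 'k
    proof -
      have "to_complex c \<in> \<real>" using 1 by blast
      then obtain r where "to_complex c = of_real r" by (auto elim: Reals_cases)
      then have "c = of_real r" using tc_of_real[of r] to_complex_inj[of c "of_real r"] by simp
      then show ?thesis ..
    qed
    show ?thesis
    proof (rule that[of "\<lambda>x. of_real (F x)"])
      show "of_real (F (smul c x)) = c * (of_real (F x) :: 'k)" for c x
      proof -
        obtain r where "c = of_real r" using sc by blast
        then show ?thesis by (simp add: smul_of_real Fsc)
      qed
    qed (simp_all add: Fadd Re_K_simps)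
  next
    case 2
    then obtain j :: 'k where j: "to_complex j = \<i>" by (metis UNIV_I rangeE)
    have jj: "j * j = - 1"
    proof (rule to_complex_inj)
      show "to_complex (j * j) = to_complex (- 1 :: 'k)"
        using to_complex_scaleR[of "-1" "1 :: 'k"] by (simp add: to_complex_mult to_complex_one j)
    qed
    have dec: "\<exists>r s. c = of_real r + j * of_real s" for c :: 'k
    proof (intro exI)
      show "c = of_real (Re (to_complex c)) + j * of_real (Im (to_complex c))"
        by (rule to_complex_inj) (simp add: to_complex_add to_complex_mult tc_of_real j complex_eq[symmetric])
    qed
    define \<phi> :: "'a \<Rightarrow> 'k" where "\<phi> x = of_real (F x) - j * of_real (F (smul j x))" for x
    have add: "\<phi> (x + y) = \<phi> x + \<phi> y" for x y
      by (simp add: \<phi>_def Fadd scale_right_distrib algebra_simps)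
    have real: "\<phi> (smul (of_real r) x) = of_real r * \<phi> x" for r x
    proof -
      have "smul j (r *\<^sub>R x) = r *\<^sub>R smul j x"
        using scale_left_commute[of j "of_real r" x] by (simp only: smul_of_real)
      then show ?thesis by (simp add: \<phi>_def smul_of_real Fsc algebra_simps)
    qed
    have im: "\<phi> (smul j x) = j * \<phi> x" for x
    proof -
      have "smul j (smul j x) = - x" by (simp add: jj smul_minus_one)
      then have "F (smul j (smul j x)) = - F x" using Fsc[of "-1" x] by simp
      then show ?thesis using jj by (simp add: \<phi>_def algebra_simps flip: mult.assoc)
    qed
    show ?thesis
    proof (rule that[of \<phi>])
      fix c x
      obtain r s where c: "c = of_real r + j * of_real s" using dec by blast
      have "\<phi> (smul c x) = \<phi> (smul (of_real r) x + smul j (smul (of_real s) x))"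
        by (simp add: c scale_left_distrib)
      also have "\<dots> = c * \<phi> x"
        by (simp only: add real im c) (simp add: algebra_simps)
      finally show "\<phi> (smul c x) = c * \<phi> x" .
    next
      fix x
      have "Re_K (j * of_real s) = 0" for s
        by (simp add: Re_K_def to_complex_mult j tc_of_real)
      then show "Re_K (\<phi> x) = F x" by (simp add: \<phi>_def Re_K_simps)
    qed (rule add)
  qed
qed

lemma Re_K_functional_bound:
  fixes \<phi> :: "'a \<Rightarrow> 'k"
  assumes "\<And>c x. \<phi> (smul c x) = c * \<phi> x" "\<And>x. Re_K (\<phi> x) \<le> t * \<rho> x"
    "\<And>c x. norm c = 1 \<Longrightarrow> \<rho> (smul c x) = \<rho> x"
  shows "norm (\<phi> x) \<le> t * \<rho> x"
proof -
  obtain \<omega> where w: "norm \<omega> = 1" "\<omega> * \<phi> x = of_real (norm (\<phi> x))" using unimodular_to_norm by blast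
  have "norm (\<phi> x) = Re_K (\<phi> (smul \<omega> x))" by (simp add: assms(1) w Re_K_simps)
  also have "\<dots> \<le> t * \<rho> x" using assms(2)[of "smul \<omega> x"] assms(3)[OF w(1)] by simp
  finally show ?thesis .
qed

lemma norming_functional:
  obtains h where "h \<in> dual smul" "onorm h \<le> 1" "h x = of_real (norm x)"
proof -
  have "sublinear (norm :: 'a \<Rightarrow> real)" by (simp add: sublinear_def norm_triangle_ineq)
  then obtain F :: "'a \<Rightarrow> real" where F: "linear F" "\<And>v. F v \<le> norm v" "F x = norm x"
    using hahn_banach_sublinear[of norm x] by metis
  obtain \<phi> :: "'a \<Rightarrow> 'k" where p: "\<And>x y. \<phi> (x + y) = \<phi> x + \<phi> y" "\<And>c x. \<phi> (smul c x) = c * \<phi> x"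
    "\<And>x. Re_K (\<phi> x) = F x"
    using real_functional_is_real_part[OF F(1)] by metis
  have b: "norm (\<phi> v) \<le> 1 * norm v" for v
    by (rule Re_K_functional_bound) (use p F(2) in \<open>simp_all add: norm_smul\<close>)
  have d: "\<phi> \<in> dual smul" by (rule dualI[where K = 1]) (use p b in simp_all)
  obtain \<omega> where w: "norm \<omega> = 1" "\<omega> * \<phi> x = of_real (norm (\<phi> x))" using unimodular_to_norm by blast
  have "norm (\<phi> x) = norm x"
    using b[of x] p(3)[of x] F(3) Re_K_le_norm[of "\<phi> x"] by simp
  then show ?thesis
    using that[of "\<lambda>v. \<omega> * \<phi> v"] dual_scale[OF d] w onorm_dual_scale[OF d] onorm_bound[of 1 \<phi>] b
    by simp
qed

text \<open>
  Duality for a finite system of constraints: the unknowns are the vectors \<open>e j\<close>, and the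
  constraint \<open>\<kappa>\<close> bounds the seminorm \<open>\<rho> \<kappa>\<close> of \<open>a \<kappa> - (\<Sum>j\<in>J. smul (m \<kappa> j) (e j))\<close>. On families
  of vectors indexed by the constraints, let \<open>G\<close> be the largest relative size of an entry and \<open>L\<close>
  the linear map that sends \<open>e\<close> to the left-hand sides. Solvability says that the distance, in the
  sense of \<open>G\<close>, from \<open>a\<close> to the range of \<open>L\<close> is at most one. This distance is sublinear in \<open>a\<close>, so
  it is attained by a functional that vanishes on the range of \<open>L\<close> and is dominated by \<open>G\<close>. Its
  components are the \<open>\<phi> \<kappa>\<close> of the dual condition, and \<open>t \<kappa>\<close> are their norms.
\<close>

lemma seminorm_system_solvable:
  fixes \<rho> :: "'c \<Rightarrow> 'a \<Rightarrow> real" and a :: "'c \<Rightarrow> 'a" and m :: "'c \<Rightarrow> 'j \<Rightarrow> 'k" and r :: "'c \<Rightarrow> real"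
  assumes K: "finite K" and J: "finite J" and r: "\<And>\<kappa>. \<kappa> \<in> K \<Longrightarrow> r \<kappa> > 0"
    and tri: "\<And>\<kappa> x y. \<kappa> \<in> K \<Longrightarrow> \<rho> \<kappa> (x + y) \<le> \<rho> \<kappa> x + \<rho> \<kappa> y"
    and hom: "\<And>\<kappa> c x. \<kappa> \<in> K \<Longrightarrow> \<rho> \<kappa> (smul c x) = norm c * \<rho> \<kappa> x"
    and dual_cond: "\<And>\<phi> t. (\<And>\<kappa> x y. \<kappa> \<in> K \<Longrightarrow> \<phi> \<kappa> (x + y) = \<phi> \<kappa> x + \<phi> \<kappa> y) \<Longrightarrow>
      (\<And>\<kappa> c x. \<kappa> \<in> K \<Longrightarrow> \<phi> \<kappa> (smul c x) = c * \<phi> \<kappa> x) \<Longrightarrow>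
      (\<And>\<kappa> x. \<kappa> \<in> K \<Longrightarrow> norm (\<phi> \<kappa> x) \<le> t \<kappa> * \<rho> \<kappa> x) \<Longrightarrow> (\<And>\<kappa>. \<kappa> \<in> K \<Longrightarrow> 0 \<le> t \<kappa>) \<Longrightarrow>
      (\<And>j x. j \<in> J \<Longrightarrow> (\<Sum>\<kappa>\<in>K. m \<kappa> j * \<phi> \<kappa> x) = 0) \<Longrightarrow>
      Re_K (\<Sum>\<kappa>\<in>K. \<phi> \<kappa> (a \<kappa>)) \<le> (\<Sum>\<kappa>\<in>K. r \<kappa> * t \<kappa>)"
    and \<eta>: "\<eta> > 0"
  obtains e where "\<And>\<kappa>. \<kappa> \<in> K \<Longrightarrow> \<rho> \<kappa> (a \<kappa> - (\<Sum>j\<in>J. smul (m \<kappa> j) (e j))) \<le> (1 + \<eta>) * r \<kappa>"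
proof -
  define G where "G v = Max (insert 0 ((\<lambda>\<kappa>. \<rho> \<kappa> (v \<kappa>) / r \<kappa>) ` K))" for v :: "'c \<Rightarrow> 'a"
  have G_le: "G v \<le> c \<longleftrightarrow> 0 \<le> c \<and> (\<forall>\<kappa>\<in>K. \<rho> \<kappa> (v \<kappa>) \<le> c * r \<kappa>)" for v c
    unfolding G_def using K r by (subst Max_le_iff) (auto simp: field_simps)
  have G_ge: "0 \<le> G v" "\<kappa> \<in> K \<Longrightarrow> \<rho> \<kappa> (v \<kappa>) \<le> G v * r \<kappa>" for v \<kappa>
    using G_le[of v "G v"] by auto
  have hom_real: "\<rho> \<kappa> (c *\<^sub>R x) = \<bar>c\<bar> * \<rho> \<kappa> x" if "\<kappa> \<in> K" for \<kappa> c x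
    using hom[OF that, of "of_real c" x] by (simp add: smul_of_real)
  have \<rho>0: "\<rho> \<kappa> 0 = 0" if "\<kappa> \<in> K" for \<kappa> using hom_real[OF that, of 0 0] by simp
  have G_add: "G (u + v) \<le> G u + G v" for u v
  proof -
    have "\<rho> \<kappa> (u \<kappa> + v \<kappa>) \<le> (G u + G v) * r \<kappa>" if "\<kappa> \<in> K" for \<kappa>
      using tri[OF that, of "u \<kappa>" "v \<kappa>"] G_ge(2)[OF that, of u] G_ge(2)[OF that, of v]
      by (simp add: algebra_simps)
    then show ?thesis using G_ge(1) by (subst G_le) auto
  qed
  have G_scale: "G (c *\<^sub>R v) \<le> c * G v" if "c > 0" for c v
    using that G_ge hom_real by (subst G_le) (auto simp: scaleR_fun_def mult_left_mono mult.assoc)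
  define L where "L e = (\<lambda>\<kappa>. if \<kappa> \<in> K then \<Sum>j\<in>J. smul (m \<kappa> j) (e j) else 0)" for e :: "'j \<Rightarrow> 'a"
  have L_add: "L (e + e') = L e + L e'" for e e'
    by (auto simp: L_def fun_eq_iff scale_right_distrib sum.distrib)
  have L_scale: "L (c *\<^sub>R e) = c *\<^sub>R L e" for c e
    by (auto simp: L_def fun_eq_iff scaleR_fun_def scale_sum_right mult.commute smul_of_real[symmetric])
  define p where "p v = (INF e. G (v - L e))" for v
  have p_le: "p v \<le> G (v - L e)" for v e
    unfolding p_def using G_ge(1) by (intro cINF_lower bdd_belowI2[of _ 0]) auto
  have p_ge: "c \<le> p v" if "\<And>e. c \<le> G (v - L e)" for c v
    unfolding p_def using that by (intro cINF_greatest) auto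
  have "sublinear p"
    unfolding sublinear_def
  proof (intro conjI allI impI)
    fix u v
    have "p (u + v) - G (v - L e') \<le> G (u - L e)" for e e'
    proof -
      have "p (u + v) \<le> G (u + v - L (e + e'))" by (rule p_le)
      also have "u + v - L (e + e') = (u - L e) + (v - L e')" by (simp add: L_add)
      also have "G \<dots> \<le> G (u - L e) + G (v - L e')" by (rule G_add)
      finally show ?thesis by linarith
    qed
    then have "p (u + v) - G (v - L e') \<le> p u" for e' by (rule p_ge)
    then have "p (u + v) - p u \<le> p v"
      by (intro p_ge) (smt (verit))
    then show "p (u + v) \<le> p u + p v" by linarith
  next
    fix c :: real and v assume c: "c > 0"
    have "p (c *\<^sub>R v) / c \<le> G (v - L e)" for e
    proof -
      have "p (c *\<^sub>R v) \<le> G (c *\<^sub>R v - L (c *\<^sub>R e))" by (rule p_le)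
      also have "c *\<^sub>R v - L (c *\<^sub>R e) = c *\<^sub>R (v - L e)" by (simp add: L_scale scaleR_diff_right)
      also have "G \<dots> \<le> c * G (v - L e)" by (rule G_scale[OF c])
      finally show ?thesis using c by (simp add: field_simps)
    qed
    then have "p (c *\<^sub>R v) / c \<le> p v" by (rule p_ge)
    then show "p (c *\<^sub>R v) \<le> c * p v" using c by (simp add: field_simps)
  qed
  define single where "single \<kappa> x = (\<lambda>\<kappa>'. if \<kappa>' = \<kappa> then x else 0)" for \<kappa> :: 'c and x :: 'a
  define a' where "a' = (\<lambda>\<kappa>. if \<kappa> \<in> K then a \<kappa> else 0)"
  obtain F where F: "linear F" "\<And>v. F v \<le> p v" "F a' = p a'"
    using hahn_banach_sublinear[OF \<open>sublinear p\<close>] by metis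
  have L0: "L 0 = 0" by (auto simp: L_def fun_eq_iff)
  have F_le_G: "F v \<le> G v" for v
    using F(2)[of v] p_le[of v 0] by (simp add: L0)
  have F_L: "F (L e) = 0" for e
  proof -
    have le: "F (L e) \<le> 0" for e
      using F(2)[of "L e"] p_le[of "L e" e] G_le[of 0 0] \<rho>0 by simp
    have "L (- e) = - L e" using L_scale[of "-1" e] by simp
    then have "F (L (- e)) = - F (L e)" using F(1) by (simp add: linear_neg)
    then show ?thesis using le[of e] le[of "- e"] by simp
  qed
  have sum_single: "(\<Sum>\<kappa>\<in>K. single \<kappa> (v \<kappa>)) = (\<lambda>\<kappa>. if \<kappa> \<in> K then v \<kappa> else 0)" for v
  proof
    fix \<kappa>
    have "(\<Sum>\<kappa>\<in>K. single \<kappa> (v \<kappa>)) \<kappa> = (\<Sum>\<kappa>'\<in>K. single \<kappa>' (v \<kappa>') \<kappa>)"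
      by (induction K rule: infinite_finite_induct) auto
    then show "(\<Sum>\<kappa>\<in>K. single \<kappa> (v \<kappa>)) \<kappa> = (if \<kappa> \<in> K then v \<kappa> else 0)"
      using K by (simp add: single_def)
  qed
  have F_sum: "F (\<lambda>\<kappa>. if \<kappa> \<in> K then v \<kappa> else 0) = (\<Sum>\<kappa>\<in>K. F (single \<kappa> (v \<kappa>)))" for v
    using sum_single[of v] F(1) by (metis linear_sum)
  have "linear (\<lambda>x. F (single \<kappa> x))" for \<kappa>
  proof (rule linearI)
    fix x y :: 'a and c :: real
    have "single \<kappa> (x + y) = single \<kappa> x + single \<kappa> y" "single \<kappa> (c *\<^sub>R x) = c *\<^sub>R single \<kappa> x"
      by (auto simp: single_def fun_eq_iff scaleR_fun_def)
    then show "F (single \<kappa> (x + y)) = F (single \<kappa> x) + F (single \<kappa> y)"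
      "F (single \<kappa> (c *\<^sub>R x)) = c *\<^sub>R F (single \<kappa> x)"
      using F(1) by (simp_all add: linear_add linear_scale)
  qed
  note Fk_lin = this
  have "\<forall>\<kappa>. \<exists>\<phi> :: 'a \<Rightarrow> 'k. (\<forall>x y. \<phi> (x + y) = \<phi> x + \<phi> y) \<and> (\<forall>c x. \<phi> (smul c x) = c * \<phi> x) \<and>
      (\<forall>x. Re_K (\<phi> x) = F (single \<kappa> x))"
    using real_functional_is_real_part[OF Fk_lin] by metis
  then obtain \<phi> :: "'c \<Rightarrow> 'a \<Rightarrow> 'k" where \<phi>: "\<And>\<kappa> x y. \<phi> \<kappa> (x + y) = \<phi> \<kappa> x + \<phi> \<kappa> y"
    "\<And>\<kappa> c x. \<phi> \<kappa> (smul c x) = c * \<phi> \<kappa> x" "\<And>\<kappa> x. Re_K (\<phi> \<kappa> x) = F (single \<kappa> x)"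
    by metis
  define B where "B \<kappa> = {x. \<rho> \<kappa> x \<le> 1}" for \<kappa>
  define t where "t \<kappa> = (SUP x\<in>B \<kappa>. F (single \<kappa> x))" for \<kappa>
  have G_single: "G (single \<kappa> x) \<le> c" if "\<kappa> \<in> K" "\<rho> \<kappa> x \<le> c * r \<kappa>" "0 \<le> c" for \<kappa> x c
    using that r \<rho>0 by (subst G_le) (auto simp: single_def less_imp_le)
  have Fs_le: "F (single \<kappa> x) \<le> 1 / r \<kappa>" if "\<kappa> \<in> K" "x \<in> B \<kappa>" for \<kappa> x
    using that F_le_G[of "single \<kappa> x"] G_single[of \<kappa> x "1 / r \<kappa>"] r[of \<kappa>] by (simp add: B_def)
  have B0: "0 \<in> B \<kappa>" if "\<kappa> \<in> K" for \<kappa> using \<rho>0[OF that] by (simp add: B_def)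
  have Fs_t: "F (single \<kappa> x) \<le> t \<kappa>" if "\<kappa> \<in> K" "x \<in> B \<kappa>" for \<kappa> x
    unfolding t_def using that Fs_le by (intro cSUP_upper bdd_aboveI2[of _ _ "1 / r \<kappa>"]) auto
  have t0: "0 \<le> t \<kappa>" if "\<kappa> \<in> K" for \<kappa>
    using Fs_t[OF that B0[OF that]] linear_0[OF Fk_lin] by simp
  \<comment> \<open>Where \<open>\<rho> \<kappa> x = 0\<close> scaling is impossible; there \<open>F \<le> G\<close> gives the bound.\<close>
  have Fs_rho: "F (single \<kappa> x) \<le> t \<kappa> * \<rho> \<kappa> x" if k: "\<kappa> \<in> K" for \<kappa> x
  proof (cases "\<rho> \<kappa> x > 0")
    case True
    have "(1 / \<rho> \<kappa> x) *\<^sub>R x \<in> B \<kappa>" using True hom_real[OF k] by (simp add: B_def)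
    then have "F (single \<kappa> ((1 / \<rho> \<kappa> x) *\<^sub>R x)) \<le> t \<kappa>" using Fs_t[OF k] by blast
    then have "(1 / \<rho> \<kappa> x) * F (single \<kappa> x) \<le> t \<kappa>"
      using linear_scale[OF Fk_lin, of \<kappa> "1 / \<rho> \<kappa> x" x] by simp
    then show ?thesis using True by (simp add: field_simps)
  next
    case False
    have "0 \<le> \<rho> \<kappa> x + \<rho> \<kappa> (- x)" using tri[OF k, of x "- x"] \<rho>0[OF k] by simp
    then have "\<rho> \<kappa> x = 0" using False hom_real[OF k, of "-1" x] by simp
    then show ?thesis using F_le_G[of "single \<kappa> x"] G_single[OF k, of x 0] by simp
  qed
  have "norm (\<phi> \<kappa> x) \<le> t \<kappa> * \<rho> \<kappa> x" if "\<kappa> \<in> K" for \<kappa> x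
    by (rule Re_K_functional_bound) (use \<phi> Fs_rho[OF that] hom[OF that] in simp_all)
  note bound = this
  have rel: "(\<Sum>\<kappa>\<in>K. m \<kappa> j * \<phi> \<kappa> x) = 0" if j: "j \<in> J" for j x
  proof -
    define \<psi> where "\<psi> x = (\<Sum>\<kappa>\<in>K. m \<kappa> j * \<phi> \<kappa> x)" for x
    have "\<psi> (smul c x) = c * \<psi> x" for c x
      by (simp add: \<psi>_def \<phi> sum_distrib_left mult.left_commute)
    moreover have "Re_K (\<psi> x) \<le> 0 * norm x" for x
    proof -
      have "Re_K (\<psi> x) = (\<Sum>\<kappa>\<in>K. F (single \<kappa> (smul (m \<kappa> j) x)))"
        by (simp add: \<psi>_def Re_K_sum \<phi>(2,3)[symmetric])
      also have "\<dots> = F (\<lambda>\<kappa>. if \<kappa> \<in> K then smul (m \<kappa> j) x else 0)" by (rule F_sum[symmetric])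
      also have "(\<lambda>\<kappa>. if \<kappa> \<in> K then smul (m \<kappa> j) x else 0) = L (\<lambda>i. if i = j then x else 0)"
        using j J by (auto simp: L_def fun_eq_iff if_distrib[of "smul _"] cong: if_cong)
      finally show ?thesis by (simp add: F_L)
    qed
    ultimately have "norm (\<psi> x) \<le> 0 * norm x"
      by (rule Re_K_functional_bound) (simp_all add: norm_smul)
    then show ?thesis by (simp add: \<psi>_def)
  qed
  have "Re_K (\<Sum>\<kappa>\<in>K. \<phi> \<kappa> (a \<kappa>)) \<le> (\<Sum>\<kappa>\<in>K. r \<kappa> * t \<kappa>)"
    by (rule dual_cond) (use \<phi> bound t0 rel in simp_all)
  moreover have "Re_K (\<Sum>\<kappa>\<in>K. \<phi> \<kappa> (a \<kappa>)) = p a'"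
    using F(3) F_sum[of a] by (simp add: Re_K_sum \<phi>(3) a'_def)
  moreover have "(\<Sum>\<kappa>\<in>K. r \<kappa> * t \<kappa>) \<le> 1 + d" if d: "d > 0" for d
  proof -
    define \<tau> where "\<tau> = d / (1 + sum r K)"
    have sr: "sum r K \<ge> 0" using r by (intro sum_nonneg) (simp add: less_imp_le)
    then have \<tau>: "\<tau> > 0" using d by (simp add: \<tau>_def)
    have "\<exists>x. x \<in> B \<kappa> \<and> t \<kappa> - \<tau> < F (single \<kappa> x)" if "\<kappa> \<in> K" for \<kappa>
    proof -
      have "t \<kappa> - \<tau> < (SUP x\<in>B \<kappa>. F (single \<kappa> x))" using \<tau> by (simp add: t_def)
      moreover have "bdd_above ((\<lambda>x. F (single \<kappa> x)) ` B \<kappa>)"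
        using Fs_le[OF that] by (intro bdd_aboveI2[of _ _ "1 / r \<kappa>"]) auto
      ultimately show ?thesis using B0[OF that] less_cSUP_iff[of "B \<kappa>"] by blast
    qed
    then obtain x where x: "\<And>\<kappa>. \<kappa> \<in> K \<Longrightarrow> x \<kappa> \<in> B \<kappa>" "\<And>\<kappa>. \<kappa> \<in> K \<Longrightarrow> t \<kappa> - \<tau> < F (single \<kappa> (x \<kappa>))"
      by metis
    have "(\<Sum>\<kappa>\<in>K. r \<kappa> * (t \<kappa> - \<tau>)) \<le> (\<Sum>\<kappa>\<in>K. r \<kappa> * F (single \<kappa> (x \<kappa>)))"
      using x(2) r by (intro sum_mono mult_left_mono) (auto simp: less_imp_le)
    also have "\<dots> = (\<Sum>\<kappa>\<in>K. F (single \<kappa> (r \<kappa> *\<^sub>R x \<kappa>)))"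
      using linear_scale[OF Fk_lin] by simp
    also have "\<dots> = F (\<lambda>\<kappa>. if \<kappa> \<in> K then r \<kappa> *\<^sub>R x \<kappa> else 0)" by (rule F_sum[symmetric])
    also have "\<dots> \<le> G (\<lambda>\<kappa>. if \<kappa> \<in> K then r \<kappa> *\<^sub>R x \<kappa> else 0)" by (rule F_le_G)
    also have "\<dots> \<le> 1"
      using x(1) r hom_real by (subst G_le) (auto simp: B_def abs_of_pos intro!: mult_left_le less_imp_le)
    finally have "(\<Sum>\<kappa>\<in>K. r \<kappa> * t \<kappa>) \<le> 1 + sum r K * \<tau>"
      by (simp add: algebra_simps sum_subtractf sum_distrib_left)
    also have "sum r K * \<tau> \<le> d"
      using sr d by (simp add: \<tau>_def field_simps)
    finally show ?thesis by simp
  qed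
  then have "(\<Sum>\<kappa>\<in>K. r \<kappa> * t \<kappa>) \<le> 1" by (rule field_le_epsilon)
  ultimately have "p a' < 1 + \<eta>" using \<eta> by simp
  then obtain e where e: "G (a' - L e) < 1 + \<eta>"
    unfolding p_def using G_ge(1) by (subst (asm) cINF_less_iff) (auto intro!: bdd_belowI2[of _ 0])
  show ?thesis
  proof (rule that[of e])
    fix \<kappa> assume k: "\<kappa> \<in> K"
    have "\<rho> \<kappa> ((a' - L e) \<kappa>) \<le> G (a' - L e) * r \<kappa>" by (rule G_ge(2)[OF k])
    also have "\<dots> \<le> (1 + \<eta>) * r \<kappa>" using e r[OF k] by (intro mult_right_mono) auto
    finally show "\<rho> \<kappa> (a \<kappa> - (\<Sum>j\<in>J. smul (m \<kappa> j) (e j))) \<le> (1 + \<eta>) * r \<kappa>"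
      using k by (simp add: a'_def L_def)
  qed
qed

end

section \<open>Finite families of functionals on an L1-predual\<close>

text \<open>
  The Bochner integral is defined through exactly such approximations.
\<close>

lemma integrable_simple_approximation:
  fixes u :: "'m \<Rightarrow> 'b::{banach, second_countable_topology}"
  assumes u: "integrable M u" and \<tau>: "\<tau> > 0"
  obtains s where "Bochner_Integration.simple_bochner_integrable M s" "integrable M s" "(LINT t|M. norm (u t - s t)) \<le> \<tau>"
proof -
  have "has_bochner_integral M u (integral\<^sup>L M u)" using u by (rule has_bochner_integral_integrable)
  then obtain s where s: "\<And>i. Bochner_Integration.simple_bochner_integrable M (s i)"
    and lim: "(\<lambda>i. \<integral>\<^sup>+x. norm (u x - s i x) \<partial>M) \<longlonglongrightarrow> 0"
    unfolding has_bochner_integral.simps by blast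
  have "\<forall>\<^sub>F i in sequentially. (\<integral>\<^sup>+x. norm (u x - s i x) \<partial>M) < ennreal \<tau>"
    using order_tendstoD(2)[OF lim, of "ennreal \<tau>"] \<tau> by simp
  then obtain i where i: "(\<integral>\<^sup>+x. norm (u x - s i x) \<partial>M) < ennreal \<tau>"
    by (auto simp: eventually_sequentially)
  have int: "integrable M (s i)"
    using has_bochner_integral_simple_bochner_integrable[OF s[of i]] by (auto simp: integrable.simps)
  have "ennreal (LINT t|M. norm (u t - s i t)) = (\<integral>\<^sup>+x. norm (u x - s i x) \<partial>M)"
    using u int by (subst nn_integral_eq_integral) auto
  then have "(LINT t|M. norm (u t - s i t)) \<le> \<tau>" 
    using i by (metis ennreal_leI leD linear order_less_imp_le)
  then show ?thesis using that[of "s i"] s int by blast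
qed

context banach_space_over
begin

text \<open>
  Finitely many functionals on an \<open>L\<^sub>1\<close>-predual are, up to a small error, combinations of
  finitely many functionals \<open>b c\<close> that span \<open>\<ell>\<^sub>1\<close> isometrically. In the space of integrable functions
  one approximates by simple functions and takes as \<open>b c\<close> the normalized indicators of their common
  level sets; the index \<open>c\<close> is the tuple of values taken there. This is the only place where the
  representation of the dual enters. The scalars \<open>b c x\<close>, averages of \<open>x\<close> over
  level sets, take the place of a representation of \<open>x\<close> by a bounded function, which need not
  exist for arbitrary measures.
\<close>

lemma dual_l1_approximation:
  fixes f :: "'i \<Rightarrow> 'a \<Rightarrow> 'k"
  assumes pre: "L1_predual TYPE('m) smul" and I: "finite I"
    and f: "\<And>i. i \<in> I \<Longrightarrow> f i \<in> dual smul" and \<tau>: "\<tau> > 0"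
  obtains C :: "('i \<Rightarrow> 'k) set" and b z where "finite C" "\<And>c. c \<in> C \<Longrightarrow> b c \<in> dual smul"
    "\<And>w. onorm (\<lambda>x. \<Sum>c\<in>C. w c * b c x) = (\<Sum>c\<in>C. norm (w c))"
    "\<And>i. i \<in> I \<Longrightarrow> onorm (\<lambda>x. f i x - (\<Sum>c\<in>C. z i c * b c x)) \<le> \<tau>"
proof -
  obtain M :: "'m measure" and \<Phi> where iso: "isometric_iso_dual_L1 smul M \<Phi>"
    using pre by (auto simp: L1_predual_def)
  have bij: "bij_betw \<Phi> (dual smul) (L1 M)"
    and add: "\<And>f g u v. f \<in> dual smul \<Longrightarrow> g \<in> dual smul \<Longrightarrow> u \<in> \<Phi> f \<Longrightarrow> v \<in> \<Phi> g \<Longrightarrow>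
      (\<lambda>t. u t + v t) \<in> \<Phi> (\<lambda>x. f x + g x)"
    and scale: "\<And>c f u. f \<in> dual smul \<Longrightarrow> u \<in> \<Phi> f \<Longrightarrow> (\<lambda>t. c * u t) \<in> \<Phi> (\<lambda>x. c * f x)"
    and norm: "\<And>f u. f \<in> dual smul \<Longrightarrow> u \<in> \<Phi> f \<Longrightarrow> (LINT t|M. norm (u t)) = onorm f"
    using iso unfolding isometric_iso_dual_L1_def by blast+
  have repr: "\<exists>u. u \<in> \<Phi> g \<and> integrable M u" if "g \<in> dual smul" for g
  proof -
    have "\<Phi> g \<in> L1 M" using bij that by (auto simp: bij_betw_def)
    then obtain u where "integrable M u" "\<Phi> g = ae_eq_rel M `` {u}"
      by (auto simp: L1_def elim: quotientE)
    then show ?thesis by (intro exI[of _ u]) (auto simp: ae_eq_rel_def)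
  qed
  have lift: "\<exists>g. g \<in> dual smul \<and> u \<in> \<Phi> g" if "integrable M u" for u
  proof -
    have "ae_eq_rel M `` {u} \<in> L1 M" using that by (auto simp: L1_def intro: quotientI)
    then obtain g where "g \<in> dual smul" "\<Phi> g = ae_eq_rel M `` {u}"
      using bij unfolding bij_betw_def by (metis imageE)
    then show ?thesis using that by (intro exI[of _ g]) (auto simp: ae_eq_rel_def)
  qed
  have sum: "(\<lambda>t. \<Sum>c\<in>A. w c * v c t) \<in> \<Phi> (\<lambda>x. \<Sum>c\<in>A. w c * b c x)"
    if "finite A" "\<And>c. c \<in> A \<Longrightarrow> b c \<in> dual smul" "\<And>c. c \<in> A \<Longrightarrow> v c \<in> \<Phi> (b c)"
    for A :: "('i \<Rightarrow> 'k) set" and w v b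
    using that
  proof (induction A rule: finite_induct)
    case empty
    obtain u where "u \<in> \<Phi> (\<lambda>x. 0)" using repr[OF dual_zero] by blast
    then show ?case using scale[OF dual_zero, of u 0] by simp
  next
    case (insert c A)
    then show ?case
      using add[OF dual_scale[of "b c" "w c"] dual_sum[of A b w] scale[of "b c" "v c" "w c"]] by simp
  qed
  obtain u where u: "\<And>i. i \<in> I \<Longrightarrow> u i \<in> \<Phi> (f i)" "\<And>i. i \<in> I \<Longrightarrow> integrable M (u i)"
    using repr[OF f] by metis
  have "\<exists>s. Bochner_Integration.simple_bochner_integrable M s \<and> integrable M s \<and> (LINT t|M. norm (u i t - s t)) \<le> \<tau>"
    if "i \<in> I" for i
    using integrable_simple_approximation[OF u(2)[OF that] \<tau>] by metis
  then obtain s where s: "\<And>i. i \<in> I \<Longrightarrow> Bochner_Integration.simple_bochner_integrable M (s i)"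
    "\<And>i. i \<in> I \<Longrightarrow> integrable M (s i)"
    "\<And>i. i \<in> I \<Longrightarrow> (LINT t|M. norm (u i t - s i t)) \<le> \<tau>"
    by metis
  define T where "T t = (\<lambda>i. if i \<in> I then s i t else 0)" for t
  define B where "B c = {t \<in> space M. T t = c}" for c
  \<comment> \<open>Null level sets cannot be normalized, and the common zero set may have infinite measure.\<close>
  define C where "C = {c \<in> T ` space M. (\<exists>i\<in>I. c i \<noteq> 0) \<and> emeasure M (B c) \<noteq> 0}"
  have sf: "simple_function M (s i)" if "i \<in> I" for i
    using s(1)[OF that] by (auto elim: Bochner_Integration.simple_bochner_integrable.cases)
  have finT: "finite (T ` space M)"
  proof (rule finite_subset)
    show "T ` space M \<subseteq> {h. \<forall>i. (i \<in> I \<longrightarrow> h i \<in> (\<Union>i\<in>I. s i ` space M)) \<and> (i \<notin> I \<longrightarrow> h i = 0)}"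
      unfolding T_def by fastforce
    show "finite {h. \<forall>i. (i \<in> I \<longrightarrow> h i \<in> (\<Union>i\<in>I. s i ` space M)) \<and> (i \<notin> I \<longrightarrow> h i = 0)}"
      using I simple_functionD(1)[OF sf] by (intro finite_set_of_finite_funs) auto
  qed
  then have finC: "finite C" by (simp add: C_def)
  have Bsets: "B c \<in> sets M" if "c \<in> T ` space M" for c
  proof -
    have "B c = {t \<in> space M. \<forall>i\<in>I. t \<in> s i -` {c i} \<inter> space M}"
      using that by (auto simp: B_def T_def fun_eq_iff split: if_splits)
    also have "\<dots> \<in> sets M"
    proof (rule sets.sets_Collect_finite_All)
      fix i assume "i \<in> I"
      moreover have "{t \<in> space M. t \<in> s i -` {c i} \<inter> space M} = s i -` {c i} \<inter> space M" by auto
      ultimately show "{t \<in> space M. t \<in> s i -` {c i} \<inter> space M} \<in> sets M"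
        using simple_functionD(2)[OF sf] by simp
    qed (rule I)
    finally show ?thesis .
  qed
  have Bfin: "emeasure M (B c) < \<infinity>" if c: "c \<in> C" for c
  proof -
    obtain i where i: "i \<in> I" "c i \<noteq> 0" using c by (auto simp: C_def)
    have "B c \<subseteq> {t \<in> space M. s i t \<noteq> 0}" using i by (auto simp: B_def T_def)
    then have "emeasure M (B c) \<le> emeasure M {t \<in> space M. s i t \<noteq> 0}"
      using simple_functionD(2)[OF sf[OF i(1)], of "- {0}"]
      by (intro emeasure_mono) (auto simp: Int_def vimage_def conj_commute)
    also have "\<dots> < \<infinity>" using s(1)[OF i(1)] by (auto elim!: Bochner_Integration.simple_bochner_integrable.cases simp: less_top)
    finally show ?thesis .
  qed
  define \<mu> where "\<mu> c = measure M (B c)" for c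
  have \<mu>: "\<mu> c > 0" if c: "c \<in> C" for c
    using Bfin[OF c] c unfolding \<mu>_def C_def by (simp add: measure_def enn2real_positive_iff zero_less_iff_neq_zero)
  define v where "v c t = indicat_real (B c) t *\<^sub>R (of_real (1 / \<mu> c) :: 'k)" for c t
  have ind: "integrable M (indicat_real (B c))" if "c \<in> C" for c
    using Bsets Bfin[OF that] that by (auto simp: C_def)
  have vint: "integrable M (v c)" if "c \<in> C" for c
    unfolding v_def using ind[OF that] by (intro integrable_scaleR_left) auto
  obtain b where b: "\<And>c. c \<in> C \<Longrightarrow> b c \<in> dual smul" "\<And>c. c \<in> C \<Longrightarrow> v c \<in> \<Phi> (b c)"
    using lift[OF vint] by metis
  have v_eq: "v c t = (if c = T t then of_real (1 / \<mu> c) else 0)" if "t \<in> space M" for c t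
    using that by (auto simp: v_def B_def)
  have v_sum: "(\<Sum>c\<in>C. w c * v c t) = (if T t \<in> C then w (T t) * of_real (1 / \<mu> (T t)) else 0)"
    if "t \<in> space M" for w t
  proof -
    have "(\<Sum>c\<in>C. w c * v c t) = (\<Sum>c\<in>C. if c = T t then w c * of_real (1 / \<mu> c) else 0)"
      by (intro sum.cong) (simp_all add: v_eq[OF that])
    then show ?thesis using finC by simp
  qed
  have "onorm (\<lambda>x. \<Sum>c\<in>C. w c * b c x) = (\<Sum>c\<in>C. norm (w c))" for w
  proof -
    have "onorm (\<lambda>x. \<Sum>c\<in>C. w c * b c x) = (LINT t|M. norm (\<Sum>c\<in>C. w c * v c t))"
      using norm[OF dual_sum[of C b w] sum[of C b v w]] b finC by simp
    also have "\<dots> = (LINT t|M. (\<Sum>c\<in>C. (norm (w c) / \<mu> c) * indicat_real (B c) t))"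
    proof (intro Bochner_Integration.integral_cong refl)
      fix t assume t: "t \<in> space M"
      have "(\<Sum>c\<in>C. (norm (w c) / \<mu> c) * indicat_real (B c) t) =
          (\<Sum>c\<in>C. if c = T t then norm (w c) / \<mu> c else 0)"
        using t by (intro sum.cong) (auto simp: B_def)
      then show "norm (\<Sum>c\<in>C. w c * v c t) = (\<Sum>c\<in>C. (norm (w c) / \<mu> c) * indicat_real (B c) t)"
        using finC \<mu> by (auto simp: v_sum[OF t] norm_mult norm_divide less_imp_le)
    qed
    also have "\<dots> = (\<Sum>c\<in>C. norm (w c))"
    proof -
      have "(LINT t|M. (\<Sum>c\<in>C. (norm (w c) / \<mu> c) * indicat_real (B c) t)) =
          (\<Sum>c\<in>C. (norm (w c) / \<mu> c) * measure M (B c))"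
        using ind by (subst Bochner_Integration.integral_sum) (auto simp: C_def Bsets)
      also have "\<dots> = (\<Sum>c\<in>C. norm (w c))"
        using \<mu> by (intro sum.cong) (force simp: \<mu>_def[symmetric])+
      finally show ?thesis .
    qed
    finally show ?thesis .
  qed
  moreover define z where "z i c = c i * of_real (\<mu> c)" for i :: 'i and c :: "'i \<Rightarrow> 'k"
  have "onorm (\<lambda>x. f i x - (\<Sum>c\<in>C. z i c * b c x)) \<le> \<tau>" if i: "i \<in> I" for i
  proof -
    have mem: "(\<lambda>t. u i t + (- 1) * (\<Sum>c\<in>C. z i c * v c t)) \<in>
        \<Phi> (\<lambda>x. f i x + (- 1) * (\<Sum>c\<in>C. z i c * b c x))"
      using b finC i by (intro add scale sum u f dual_scale dual_sum) auto
    have "onorm (\<lambda>x. f i x - (\<Sum>c\<in>C. z i c * b c x)) =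
        (LINT t|M. norm (u i t - (\<Sum>c\<in>C. z i c * v c t)))"
      using norm[OF dual_add[OF f[OF i] dual_scale[OF dual_sum[of C b "z i"], of "- 1"]] mem] b by simp
    also have "\<dots> = (LINT t|M. norm (u i t - s i t))"
    proof (rule integral_cong_AE)
      have "AE t in M. t \<notin> B c" if "c \<in> T ` space M - C" "\<exists>i\<in>I. c i \<noteq> 0" for c
        using that Bsets by (intro AE_not_in) (auto simp: C_def null_sets_def)
      then have "AE t in M. \<forall>c\<in>{c \<in> T ` space M - C. \<exists>i\<in>I. c i \<noteq> 0}. t \<notin> B c"
        using finT by (intro AE_finite_allI) auto
      then show "AE t in M. norm (u i t - (\<Sum>c\<in>C. z i c * v c t)) = norm (u i t - s i t)"
      proof (rule AE_mp, intro AE_I2 impI)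
        fix t assume t: "t \<in> space M"
          and notB: "\<forall>c\<in>{c \<in> T ` space M - C. \<exists>i\<in>I. c i \<noteq> 0}. t \<notin> B c"
        have "(\<Sum>c\<in>C. z i c * v c t) = s i t"
        proof (cases "T t \<in> C")
          case True
          then show ?thesis using \<mu>[OF True] i by (simp add: v_sum[OF t] z_def T_def)
        next
          case False
          have "t \<in> B (T t)" using t by (simp add: B_def)
          then have "\<forall>j\<in>I. T t j = 0" using notB False t by blast
          then show ?thesis using False i by (simp add: v_sum[OF t] T_def)
        qed
        then show "norm (u i t - (\<Sum>c\<in>C. z i c * v c t)) = norm (u i t - s i t)" by simp
      qed
      show "(\<lambda>t. norm (u i t - s i t)) \<in> borel_measurable M" using u(2)[OF i] s(2)[OF i] by simp
      have "integrable M (\<lambda>t. \<Sum>c\<in>C. z i c * v c t)"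
        using vint by (intro Bochner_Integration.integrable_sum integrable_mult_right) auto
      then show "(\<lambda>t. norm (u i t - (\<Sum>c\<in>C. z i c * v c t))) \<in> borel_measurable M"
        using u(2)[OF i] by simp
    qed
    also have "\<dots> \<le> \<tau>" by (rule s(3)[OF i])
    finally show ?thesis .
  qed
  ultimately show ?thesis using that[of C b z] finC b(1) by blast
qed

end

section \<open>Slices and almost disjoint functionals in a Daugavet space\<close>

context banach_space_over
begin

lemma smul_scaleR: "smul (r *\<^sub>R c) x = r *\<^sub>R smul c x"
  by (simp add: scaleR_conv_of_real flip: smul_of_real)

lemma rank_one_operator:
  assumes f: "f \<in> dual smul"
  shows "bounded_linear_over smul smul (\<lambda>x. smul (f x) u)"
proof -
  have "bounded_linear (\<lambda>x. smul (f x) u)"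
  proof (rule bounded_linear_intro[where K = "onorm f * norm u"])
    show "smul (f (r *\<^sub>R x)) u = r *\<^sub>R smul (f x) u" for r x
      by (simp add: dualD(6)[OF f] smul_scaleR)
    show "norm (smul (f x) u) \<le> norm x * (onorm f * norm u)" for x
      using mult_right_mono[OF dualD(7)[OF f, of x], of "norm u"] by (simp add: norm_smul mult_ac)
  qed (simp add: dualD(2)[OF f] scale_left_distrib)
  moreover have "Vector_Spaces.linear smul smul (\<lambda>x. smul (f x) u)"
    unfolding Vector_Spaces.linear_iff using vector_space_axioms
    by (simp add: dualD[OF f] scale_left_distrib)
  ultimately show ?thesis by (simp add: bounded_linear_over_def)
qed

lemma dim_range_rank_one:
  assumes f: "f \<in> dual smul" and "onorm f \<noteq> 0" "u \<noteq> 0"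
  shows "vector_space.dim smul (range (\<lambda>x. smul (f x) u)) = 1"
proof -
  have "\<exists>x. f x \<noteq> 0"
  proof (rule ccontr)
    assume "\<not> ?thesis"
    then have "f = (\<lambda>x. 0)" by auto
    then show False using assms(2) by (simp add: onorm_zero)
  qed
  then obtain x where x: "f x \<noteq> 0" ..
  have "c \<in> range f" for c
    using x dualD(3)[OF f, of "c / f x" x] by (intro image_eqI[of _ _ "smul (c / f x) x"]) auto
  then have "range f = UNIV" by blast
  then have "range (\<lambda>x. smul (f x) u) = span {u}"
    by (simp add: span_singleton flip: image_image[of "\<lambda>k. smul k u" f UNIV])
  then have "dim (range (\<lambda>x. smul (f x) u)) = card {u}"
    using assms(3) by (intro dim_eq_card) (auto simp: span_span)
  then show ?thesis by simp
qed

text \<open>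
  Every slice of the dual ball contains a smaller slice whose elements \<open>h\<close> are almost orthogonal to
  \<open>f\<close> in the sense of \<open>\<ell>\<^sub>1\<close>. The Daugavet equation for \<open>x \<mapsto> f x \<cdot> u\<close> gives a unit vector \<open>x\<close> and a
  functional \<open>h\<^sub>0\<close> of norm at most one for which both \<open>h\<^sub>0 x\<close> and \<open>f x \<cdot> h\<^sub>0 u\<close> are almost \<open>1\<close>. After
  rotating \<open>x\<close> to \<open>x'\<close> so that \<open>f x'\<close> is almost \<open>1\<close>, some functional is almost \<open>1\<close> at both \<open>u\<close>
  and \<open>x'\<close>; hence the slice given by the direction \<open>u + x'\<close> consists of functionals that are almost
  \<open>1\<close> at both, and these satisfy the two conclusions.
\<close>

lemma daugavet_slice:
  assumes dp: "daugavet_property smul" and f: "f \<in> dual smul" "onorm f = 1"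
    and u: "norm u = 1" and \<delta>: "\<delta> > 0"
  obtains u' \<delta>' where "norm u' = 1" "\<delta>' > 0"
    "\<And>h. h \<in> dual smul \<Longrightarrow> onorm h \<le> 1 \<Longrightarrow> Re_K (h u') > 1 - \<delta>' \<Longrightarrow>
      Re_K (h u) > 1 - \<delta> \<and> onorm (\<lambda>x. f x + h x) \<ge> 2 - \<delta>"
proof -
  define d where "d = min (\<delta> / 5) (1 / 10)"
  have d: "0 < d" "d \<le> 1 / 10" "5 * d \<le> \<delta>" using \<delta> by (auto simp: d_def)
  have "onorm (\<lambda>x. smul (f x) u) = onorm f" by (simp add: onorm_def norm_smul u)
  then have "onorm (\<lambda>x. x + smul (f x) u) = 2"
    using dp rank_one_operator[OF f(1), of u] dim_range_rank_one[OF f(1), of u] f(2) u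
    unfolding daugavet_property_def by force
  then have "\<not> (\<forall>x. norm (x + smul (f x) u) \<le> (2 - d) * norm x)"
    using d onorm_bound[of "2 - d" "\<lambda>x. x + smul (f x) u"] by auto
  then obtain x0 where x0: "norm (x0 + smul (f x0) u) > (2 - d) * norm x0" by (auto simp: not_le)
  then have x0nz: "x0 \<noteq> 0" using dualD(4)[OF f(1)] by auto
  define x where "x = (1 / norm x0) *\<^sub>R x0"
  have x: "norm x = 1" using x0nz by (simp add: x_def)
  have "x + smul (f x) u = (1 / norm x0) *\<^sub>R (x0 + smul (f x0) u)"
    by (simp add: x_def dualD(6)[OF f(1)] scaleR_add_right smul_scaleR)
  then have "norm (x + smul (f x) u) = norm (x0 + smul (f x0) u) / norm x0" by (simp only: norm_scaleR) simp
  then have xbig: "norm (x + smul (f x) u) > 2 - d"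
    using x0 x0nz by (simp add: pos_less_divide_eq)
  obtain h0 where h0: "h0 \<in> dual smul" "onorm h0 \<le> 1"
    "h0 (x + smul (f x) u) = of_real (norm (x + smul (f x) u))"
    using norming_functional by blast
  have sum: "Re_K (h0 x) + Re_K (f x * h0 u) > 2 - d"
    using xbig arg_cong[OF h0(3), of Re_K] by (simp add: dualD[OF h0(1)] Re_K_simps)
  have le1: "Re_K (h0 x) \<le> 1" "norm (f x) \<le> 1" "norm (h0 u) \<le> 1"
    using dual_norm_le_unit[OF h0(1,2), of x] dual_norm_le_unit[OF f(1), of x]
      dual_norm_le_unit[OF h0(1,2), of u] x u f(2) Re_K_le_norm[of "h0 x"] by auto
  have fh_le: "norm (f x * h0 u) \<le> norm (h0 u)"
    using le1 by (simp add: norm_mult mult_left_le_one_le)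
  have h0x: "Re_K (h0 x) > 1 - d"
    using sum Re_K_le_norm[of "f x * h0 u"] fh_le le1 by simp
  have fh: "Re_K (f x * h0 u) > 1 - d" using sum le1 by simp
  obtain \<omega> where w: "norm \<omega> = 1" "\<omega> * h0 u = of_real (norm (h0 u))" using unimodular_to_norm by blast
  have wnz: "\<omega> \<noteq> 0" using w(1) by auto
  define x' where "x' = smul (inverse \<omega>) x"
  have x': "norm x' = 1" using w(1) x by (simp add: x'_def norm_smul norm_inverse)
  have "f x * h0 u = of_real (norm (h0 u)) * f x'"
    using wnz w(2)[symmetric] by (simp add: x'_def dualD(3)[OF f(1)])
  then have prod: "norm (h0 u) * Re_K (f x') > 1 - d" using fh by (simp add: Re_K_simps)
  have "Re_K (f x') > 0"
  proof (rule ccontr)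
    assume "\<not> ?thesis"
    then have "norm (h0 u) * Re_K (f x') \<le> 0" by (simp add: mult_nonneg_nonpos)
    then show False using prod d by simp
  qed
  then have "norm (h0 u) * Re_K (f x') \<le> 1 * Re_K (f x')"
    using le1(3) by (intro mult_right_mono) auto
  then have fx': "Re_K (f x') > 1 - d" using prod by linarith
  define g where "g = (\<lambda>v. \<omega> * h0 v)"
  have g: "g \<in> dual smul" "onorm g \<le> 1"
    using dual_scale[OF h0(1)] onorm_dual_scale[OF h0(1)] h0(2) w(1) by (simp_all add: g_def)
  have gu: "Re_K (g u) > 1 - d"
    using w(2) fh fh_le Re_K_le_norm[of "f x * h0 u"] by (simp add: g_def Re_K_simps)
  have gx': "Re_K (g x') > 1 - d" using wnz h0x by (simp add: g_def x'_def dualD(3)[OF h0(1)] flip: mult.assoc)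
  define \<nu> where "\<nu> = norm (u + x')"
  have "2 - 2 * d < Re_K (g (u + x'))" using gu gx' by (simp add: dualD[OF g(1)] Re_K_simps)
  also have "\<dots> \<le> \<nu>" using Re_K_le_norm[of "g (u + x')"] dual_norm_le[OF g, of "u + x'"] by (simp add: \<nu>_def)
  finally have \<nu>: "\<nu> > 2 - 2 * d" .
  then have \<nu>0: "\<nu> > 0" using d by simp
  define u' where "u' = (1 / \<nu>) *\<^sub>R (u + x')"
  have u': "norm u' = 1" using \<nu>0 by (simp add: u'_def) (simp add: \<nu>_def)
  show ?thesis
  proof (rule that[of u' d])
    fix h assume h: "h \<in> dual smul" "onorm h \<le> 1" "Re_K (h u') > 1 - d"
    have "Re_K (h u') = (1 / \<nu>) * (Re_K (h u) + Re_K (h x'))"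
      by (simp add: u'_def dualD[OF h(1)] Re_K_simps algebra_simps)
    then have "Re_K (h u) + Re_K (h x') = \<nu> * Re_K (h u')" using \<nu>0 by simp
    then have "Re_K (h u) + Re_K (h x') > \<nu> * (1 - d)"
      using mult_strict_left_mono[OF h(3) \<nu>0] by simp
    moreover have "\<nu> * (1 - d) \<ge> (2 - 2 * d) * (1 - d)" using \<nu> d by (intro mult_right_mono) auto
    moreover have "(2 - 2 * d) * (1 - d) \<ge> 2 - 4 * d" by (simp add: algebra_simps)
    moreover have "Re_K (h u) \<le> 1" "Re_K (h x') \<le> 1"
      using dual_norm_le_unit[OF h(1,2), of u] dual_norm_le_unit[OF h(1,2), of x'] u x'
        Re_K_le_norm[of "h u"] Re_K_le_norm[of "h x'"] by auto
    ultimately have hu: "Re_K (h u) > 1 - 4 * d" and hx': "Re_K (h x') > 1 - 4 * d" by auto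
    have "Re_K (f x' + h x') \<le> onorm (\<lambda>x. f x + h x)"
      using Re_K_le_norm[of "f x' + h x'"] dualD(7)[OF dual_add[OF f(1) h(1)], of x'] x' by simp
    then have "onorm (\<lambda>x. f x + h x) \<ge> 2 - 5 * d" using fx' hx' by (simp add: Re_K_simps)
    then show "Re_K (h u) > 1 - \<delta> \<and> onorm (\<lambda>x. f x + h x) \<ge> 2 - \<delta>"
      using hu d by auto
  qed (use u' d in auto)
qed

lemma daugavet_slice_finite:
  assumes dp: "daugavet_property smul" and "finite E"
    and "\<And>f. f \<in> E \<Longrightarrow> f \<in> dual smul \<and> onorm f = 1" and "norm u = 1" "\<delta> > 0"
  shows "\<exists>u' \<delta>'. norm u' = 1 \<and> \<delta>' > 0 \<and>
    (\<forall>h\<in>dual smul. onorm h \<le> 1 \<longrightarrow> Re_K (h u') > 1 - \<delta>' \<longrightarrow>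
      Re_K (h u) > 1 - \<delta> \<and> (\<forall>f\<in>E. onorm (\<lambda>x. f x + h x) \<ge> 2 - \<delta>))"
  using assms(2-)
proof (induction E rule: finite_induct)
  case empty
  then show ?case by (intro exI[of _ u] exI[of _ \<delta>]) auto
next
  case (insert f E)
  have "\<And>f'. f' \<in> E \<Longrightarrow> f' \<in> dual smul \<and> onorm f' = 1" using insert.prems(1) by simp
  from insert.IH[OF this insert.prems(2,3)] obtain u1 \<delta>1 where u1: "norm u1 = 1" "\<delta>1 > 0"
    "\<And>h. h \<in> dual smul \<Longrightarrow> onorm h \<le> 1 \<Longrightarrow> Re_K (h u1) > 1 - \<delta>1 \<Longrightarrow>
      Re_K (h u) > 1 - \<delta> \<and> (\<forall>f\<in>E. onorm (\<lambda>x. f x + h x) \<ge> 2 - \<delta>)"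
    by blast
  obtain u2 \<delta>2 where u2: "norm u2 = 1" "\<delta>2 > 0"
    "\<And>h. h \<in> dual smul \<Longrightarrow> onorm h \<le> 1 \<Longrightarrow> Re_K (h u2) > 1 - \<delta>2 \<Longrightarrow>
      Re_K (h u1) > 1 - min \<delta> \<delta>1 \<and> onorm (\<lambda>x. f x + h x) \<ge> 2 - min \<delta> \<delta>1"
    using daugavet_slice[OF dp _ _ u1(1), of f "min \<delta> \<delta>1"] insert.prems u1(2) by auto
  have "Re_K (h u) > 1 - \<delta> \<and> (\<forall>f\<in>insert f E. onorm (\<lambda>x. f x + h x) \<ge> 2 - \<delta>)"
    if "h \<in> dual smul" "onorm h \<le> 1" "Re_K (h u2) > 1 - \<delta>2" for h
    using u1(3)[OF that(1,2)] u2(3)[OF that] by auto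
  then show ?case using u2(1,2) by blast
qed

text \<open>
  Shrinking the slice successively for the functionals found so far and their negatives, one
  finds the next functional in the slice that remains. Both signs are needed, since \<open>f\<close> and
  \<open>f\<close> itself satisfy the condition for the sum.
\<close>

lemma almost_disjoint_functionals:
  assumes dp: "daugavet_property smul" and "finite Q"
    and "\<And>q. q \<in> Q \<Longrightarrow> norm (u q) = 1" and \<eta>: "\<eta> > 0"
  shows "\<exists>g. \<forall>q\<in>Q. g q \<in> dual smul \<and> onorm (g q) = 1 \<and> Re_K (g q (u q)) > 1 - \<eta> \<and>
    (\<forall>p\<in>Q. p \<noteq> q \<longrightarrow> onorm (\<lambda>x. g p x + g q x) \<ge> 2 - \<eta> \<and> onorm (\<lambda>x. g p x - g q x) \<ge> 2 - \<eta>)"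
  using assms(2-3)
proof (induction Q rule: finite_induct)
  case empty
  then show ?case by simp
next
  case (insert q Q)
  from insert.IH[OF insert.prems[OF insertI2]] obtain g where g: "\<And>p. p \<in> Q \<Longrightarrow> g p \<in> dual smul" "\<And>p. p \<in> Q \<Longrightarrow> onorm (g p) = 1"
    "\<And>p. p \<in> Q \<Longrightarrow> Re_K (g p (u p)) > 1 - \<eta>"
    "\<And>p p'. p \<in> Q \<Longrightarrow> p' \<in> Q \<Longrightarrow> p' \<noteq> p \<Longrightarrow>
      onorm (\<lambda>x. g p' x + g p x) \<ge> 2 - \<eta> \<and> onorm (\<lambda>x. g p' x - g p x) \<ge> 2 - \<eta>"
    by blast
  define E where "E = g ` Q \<union> (\<lambda>p x. - g p x) ` Q"
  have neg: "(\<lambda>x. - g p x) \<in> dual smul" "onorm (\<lambda>x. - g p x) = 1" if "p \<in> Q" for p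
    using dual_scale[OF g(1)[OF that], of "-1"] onorm_dual_scale[OF g(1)[OF that], of "-1"] g(2)[OF that]
    by simp_all
  have "finite E" "\<And>f. f \<in> E \<Longrightarrow> f \<in> dual smul \<and> onorm f = 1"
    using insert.hyps g neg by (auto simp: E_def)
  then obtain u' \<delta>' where u': "norm u' = 1" "\<delta>' > 0"
    "\<And>h. h \<in> dual smul \<Longrightarrow> onorm h \<le> 1 \<Longrightarrow> Re_K (h u') > 1 - \<delta>' \<Longrightarrow>
      Re_K (h (u q)) > 1 - \<eta> \<and> (\<forall>f\<in>E. onorm (\<lambda>x. f x + h x) \<ge> 2 - \<eta>)"
    using daugavet_slice_finite[OF dp, of E "u q" \<eta>] insert.prems[of q] \<eta> by auto
  obtain h where h: "h \<in> dual smul" "onorm h \<le> 1" "h u' = of_real (norm u')"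
    using norming_functional by blast
  have h1: "onorm h = 1" using dualD(7)[OF h(1), of u'] h u'(1) by simp
  have hh: "Re_K (h (u q)) > 1 - \<eta>" "\<And>f. f \<in> E \<Longrightarrow> onorm (\<lambda>x. f x + h x) \<ge> 2 - \<eta>"
    using u'(3)[OF h(1,2)] h(3) u'(1,2) Re_K_simps(4)[where 'k = 'k, of 1] by auto
  have pm: "onorm (\<lambda>x. g p x + h x) \<ge> 2 - \<eta>" "onorm (\<lambda>x. h x + g p x) \<ge> 2 - \<eta>"
    "onorm (\<lambda>x. g p x - h x) \<ge> 2 - \<eta>" "onorm (\<lambda>x. h x - g p x) \<ge> 2 - \<eta>" if "p \<in> Q" for p
  proof -
    have "g p \<in> E" "(\<lambda>x. - g p x) \<in> E" using that by (auto simp: E_def)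
    note E = hh(2)[OF this(1)] hh(2)[OF this(2)]
    show "onorm (\<lambda>x. g p x + h x) \<ge> 2 - \<eta>" "onorm (\<lambda>x. h x + g p x) \<ge> 2 - \<eta>"
      using E(1) by (simp_all add: add.commute)
    show "onorm (\<lambda>x. h x - g p x) \<ge> 2 - \<eta>" using E(2) by simp
    moreover have "onorm (\<lambda>x. - (h x - g p x)) = onorm (\<lambda>x. h x - g p x)" by (rule onorm_neg)
    ultimately show "onorm (\<lambda>x. g p x - h x) \<ge> 2 - \<eta>" by simp
  qed
  show ?case
    using g pm h(1) h1 hh(1) insert.hyps(2) by (intro exI[of _ "g(q := h)"]) auto
qed

end

section \<open>Systems of inequalities that are solvable pointwise\<close>

text \<open>
  A quantitative form of the fact that \<open>\<bar>a + b\<bar> = \<bar>a - b\<bar> = \<bar>a\<bar> + \<bar>b\<bar>\<close> forces one of the two scalars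
  to vanish; it follows from the parallelogram law. Summed over the coordinates of two vectors in
  \<open>\<ell>\<^sub>1\<close> it bounds the overlap of their supports.
\<close>

lemma min_norm_le_overlap:
  fixes a b :: "'k::rc_field"
  shows "min (norm a) (norm b) \<le> 2 * norm a + 2 * norm b - norm (a + b) - norm (a - b)"
proof -
  define A B S D where "A = norm a" and "B = norm b" and "S = norm (a + b)" and "D = norm (a - b)"
  note defs = A_def B_def S_def D_def
  have nonneg: "0 \<le> A" "0 \<le> B" "0 \<le> S" "0 \<le> D" by (simp_all add: defs)
  have diff: "to_complex (a - b) = to_complex a - to_complex b"
    using to_complex_add[of a "- b"] to_complex_scaleR[of "-1" b] by simp
  have "S\<^sup>2 + D\<^sup>2 = 2 * A\<^sup>2 + 2 * B\<^sup>2"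
    unfolding defs norm_to_complex[of a, symmetric] norm_to_complex[of b, symmetric]
      norm_to_complex[of "a + b", symmetric] norm_to_complex[of "a - b", symmetric] to_complex_add diff cmod_power2
    by (simp add: power2_eq_square algebra_simps)
  moreover have "(S + D)\<^sup>2 \<le> 2 * (S\<^sup>2 + D\<^sup>2)"
    using zero_le_power2[of "S - D"] by (simp add: power2_eq_square algebra_simps)
  ultimately have SD: "(S + D)\<^sup>2 \<le> 4 * (A\<^sup>2 + B\<^sup>2)" by simp
  have "S + D \<le> 2 * A + 2 * B - min A B"
  proof (rule power2_le_imp_le)
    have "4 * (A\<^sup>2 + B\<^sup>2) \<le> (2 * A + 2 * B - min A B)\<^sup>2"
    proof -
      have aux: "4 * (x\<^sup>2 + y\<^sup>2) \<le> (2 * x + 2 * y - x)\<^sup>2" if "0 \<le> x" "x \<le> y" for x y :: real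
      proof -
        have "x * x \<le> x * y" "0 \<le> x * y" using that by (auto intro: mult_left_mono)
        moreover have "(2 * x + 2 * y - x)\<^sup>2 = x * x + 4 * (x * y) + 4 * (y * y)"
          by (simp add: power2_eq_square algebra_simps)
        moreover have "4 * (x\<^sup>2 + y\<^sup>2) = 4 * (x * x) + 4 * (y * y)"
          by (simp add: power2_eq_square)
        ultimately show ?thesis by linarith
      qed
      show ?thesis
        using aux[of A B] aux[of B A] nonneg by (auto simp: min_def add.commute)
    qed
    then show "(S + D)\<^sup>2 \<le> (2 * A + 2 * B - min A B)\<^sup>2" using SD by linarith
    show "0 \<le> 2 * A + 2 * B - min A B" using nonneg by simp
  qed
  then show ?thesis by (simp add: defs)
qed

text \<open>
  If \<open>G q\<close> are vectors in \<open>\<ell>\<^sub>1\<close> with pairwise small overlap, then assigning each coordinate \<open>c\<close> to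
  the index \<open>q\<close> with the largest entry \<open>G q c\<close> splits the coordinates into cells such that every
  vector has little mass outside its own cell. The set \<open>cell c\<close> contains this index and is empty
  only when there are no vectors at all, and \<open>\<omega> c\<close> rotates the largest entry to its modulus.
\<close>

lemma cells_of_almost_disjoint:
  fixes G :: "'q \<Rightarrow> 'c \<Rightarrow> 'k::rc_field"
  assumes Q: "finite Q" and C: "finite C" and M: "0 \<le> M"
    and disj: "\<And>p q. p \<in> Q \<Longrightarrow> q \<in> Q \<Longrightarrow> p \<noteq> q \<Longrightarrow> (\<Sum>c\<in>C. min (norm (G p c)) (norm (G q c))) \<le> M"
  obtains cell :: "'c \<Rightarrow> 'q set" and \<omega> :: "'c \<Rightarrow> 'k" where
    "\<And>c. cell c \<subseteq> Q" "\<And>c. card (cell c) \<le> 1" "\<And>c. norm (\<omega> c) = 1"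
    "\<And>c q. q \<in> cell c \<Longrightarrow> \<omega> c * G q c = of_real (norm (G q c))"
    "\<And>p. p \<in> Q \<Longrightarrow> (\<Sum>c\<in>C. if p \<in> cell c then 0 else norm (G p c)) \<le> real (card Q) * M"
proof -
  have "\<exists>A w. A \<subseteq> Q \<and> card A \<le> 1 \<and> norm (w :: 'k) = 1 \<and> (\<forall>q\<in>A. w * G q c = of_real (norm (G q c))) \<and>
      (\<forall>p\<in>Q. p \<notin> A \<longrightarrow> (\<exists>q\<in>Q - {p}. norm (G p c) \<le> norm (G q c)))" for c
  proof (cases "Q = {}")
    case True then show ?thesis by (intro exI[of _ "{}"] exI[of _ 1]) auto
  next
    case False
    have "Max ((\<lambda>q. norm (G q c)) ` Q) \<in> (\<lambda>q. norm (G q c)) ` Q" using Q False by (intro Max_in) auto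
    then obtain q where q: "q \<in> Q" "norm (G q c) = Max ((\<lambda>q. norm (G q c)) ` Q)" by force
    have "norm (G p c) \<le> norm (G q c)" if "p \<in> Q" for p using Q that q(2) by (simp add: Max_ge)
    moreover obtain w where "norm w = 1" "w * G q c = of_real (norm (G q c))"
      using unimodular_to_norm by blast
    ultimately show ?thesis using q(1) by (intro exI[of _ "{q}"] exI[of _ w]) auto
  qed
  then obtain cell and \<omega> :: "'c \<Rightarrow> 'k" where cell: "\<And>c. cell c \<subseteq> Q" "\<And>c. card (cell c) \<le> 1" "\<And>c. norm (\<omega> c) = 1"
    "\<And>c q. q \<in> cell c \<Longrightarrow> \<omega> c * G q c = of_real (norm (G q c))"
    "\<And>c p. p \<in> Q \<Longrightarrow> p \<notin> cell c \<Longrightarrow> \<exists>q\<in>Q - {p}. norm (G p c) \<le> norm (G q c)"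
    by metis
  have "(\<Sum>c\<in>C. if p \<in> cell c then 0 else norm (G p c)) \<le> real (card Q) * M" if p: "p \<in> Q" for p
  proof -
    have "(\<Sum>c\<in>C. if p \<in> cell c then 0 else norm (G p c)) \<le>
        (\<Sum>c\<in>C. \<Sum>q\<in>Q - {p}. min (norm (G p c)) (norm (G q c)))"
    proof (rule sum_mono)
      fix c
      show "(if p \<in> cell c then 0 else norm (G p c)) \<le> (\<Sum>q\<in>Q - {p}. min (norm (G p c)) (norm (G q c)))"
      proof (cases "p \<in> cell c")
        case True then show ?thesis by (simp add: sum_nonneg)
      next
        case False
        then obtain q where q: "q \<in> Q - {p}" "norm (G p c) \<le> norm (G q c)" using cell(5) p by blast
        have "min (norm (G p c)) (norm (G q c)) \<le> (\<Sum>q\<in>Q - {p}. min (norm (G p c)) (norm (G q c)))"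
          using Q q(1) by (intro member_le_sum) auto
        then show ?thesis using q(2) False by simp
      qed
    qed
    also have "\<dots> = (\<Sum>q\<in>Q - {p}. \<Sum>c\<in>C. min (norm (G p c)) (norm (G q c)))" by (rule sum.swap)
    also have "\<dots> \<le> (\<Sum>q\<in>Q - {p}. M)" using disj p by (intro sum_mono) auto
    also have "\<dots> \<le> real (card Q) * M" using M Q by (simp add: mult_right_mono card_mono)
    finally show ?thesis .
  qed
  then show ?thesis using that[of cell \<omega>] cell by blast
qed

context banach_space_over
begin

text \<open>
  In the dual of a system of constraints, a constraint that involves a single functional \<open>g\<close>
  contributes functionals dominated by \<open>\<bar>g\<bar>\<close>; these vanish on the kernel of \<open>g\<close>.
\<close>

lemma multiple_of_dominating_functional:
  assumes g: "g \<in> dual smul" and "g x0 \<noteq> 0"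
    and add: "\<And>x y. \<phi> (x + y) = \<phi> x + \<phi> y" and sc: "\<And>c x. \<phi> (smul c x) = c * \<phi> x"
    and bd: "\<And>x. norm (\<phi> x) \<le> t * norm (g x)"
  obtains \<beta> where "norm \<beta> \<le> t" "\<And>x. \<phi> x = \<beta> * g x"
proof -
  have neg: "\<phi> (- x) = - \<phi> x" for x using sc[of "-1" x] by (simp add: smul_minus_one)
  define y where "y = smul (1 / g x0) x0"
  have gy: "g y = 1" using assms(2) by (simp add: y_def dualD(3)[OF g])
  show ?thesis
  proof (rule that[of "\<phi> y"])
    show "norm (\<phi> y) \<le> t" using bd[of y] gy by simp
    fix x
    have "g (x - smul (g x) y) = 0" by (simp add: dualD(3,5)[OF g] gy)
    then have "\<phi> (x - smul (g x) y) = 0" using bd[of "x - smul (g x) y"] by simp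
    then show "\<phi> x = \<phi> y * g x"
      using add[of x "- smul (g x) y"] neg by (simp add: sc)
  qed
qed

text \<open>
  The unknown vectors \<open>e j\<close> satisfy norm constraints, indexed by \<open>K\<close>, and have prescribed
  values \<open>\<theta> q\<close> at almost disjoint functionals \<open>g q\<close>. The hypothesis asks for scalars \<open>s j\<close> that solve the
  problem at one functional \<open>b\<close>; at most one of the \<open>g q\<close> matters there, which is why \<open>Q'\<close> has
  at most one element, and \<open>\<omega>\<close> is the phase of its entry. The scalars may even depend on the
  multipliers \<open>z\<close>: only the inequality tested by the multipliers has to hold.

  By \<open>seminorm_system_solvable\<close> one has to estimate the value of a family of functionals
  \<open>\<phi> \<kappa>\<close> and multiples \<open>\<beta> q \<cdot> g q\<close> subject to one linear relation for each unknown. All of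
  them are replaced by elements of an isometric copy of \<open>\<ell>\<^sub>1\<close> up to an error \<open>\<tau>\<close>. At each basis
  functional, the inequality of the hypothesis together with the linear relations, applied to the
  scalars \<open>s\<close>, gives the estimate for that coordinate. The sum over the coordinates is the claim
  up to a multiple of \<open>\<tau>\<close>, which is arbitrary.
\<close>

lemma pointwise_system_solvable:
  fixes a :: "'c \<Rightarrow> 'a" and m :: "'c \<Rightarrow> 'j \<Rightarrow> 'k" and r :: "'c \<Rightarrow> real"
    and g :: "'q \<Rightarrow> 'a \<Rightarrow> 'k" and v :: "'q \<Rightarrow> 'j" and \<theta> :: "'q \<Rightarrow> 'k"
  assumes pre: "L1_predual TYPE('m) smul"
    and K: "finite K" and J: "finite J" and Q: "finite Q"
    and r: "\<And>\<kappa>. \<kappa> \<in> K \<Longrightarrow> r \<kappa> > 0"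
    and g: "\<And>q. q \<in> Q \<Longrightarrow> g q \<in> dual smul" "\<And>q. q \<in> Q \<Longrightarrow> onorm (g q) = 1"
    and v: "\<And>q. q \<in> Q \<Longrightarrow> v q \<in> J" and \<theta>: "\<And>q. q \<in> Q \<Longrightarrow> norm (\<theta> q) = 1"
    and disj: "\<And>p q. p \<in> Q \<Longrightarrow> q \<in> Q \<Longrightarrow> p \<noteq> q \<Longrightarrow>
      onorm (\<lambda>x. g p x + g q x) \<ge> 2 - \<delta> \<and> onorm (\<lambda>x. g p x - g q x) \<ge> 2 - \<delta>"
    and \<delta>: "\<delta> \<ge> 0" "4 * real (card Q) * \<delta> \<le> \<epsilon>" and \<epsilon>: "\<epsilon> > 0"
    and pointwise: "\<And>b \<omega> z Q'. b \<in> dual smul \<Longrightarrow> onorm b \<le> 1 \<Longrightarrow> norm \<omega> = 1 \<Longrightarrow> Q' \<subseteq> Q \<Longrightarrow> card Q' \<le> 1 \<Longrightarrow>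
      \<exists>s. (\<forall>j\<in>J. norm (s j) \<le> 1) \<and> (\<forall>q\<in>Q'. s (v q) = \<theta> q * \<omega>) \<and>
        Re_K (\<Sum>\<kappa>\<in>K. z \<kappa> * b (a \<kappa>)) \<le>
          Re_K (\<Sum>\<kappa>\<in>K. z \<kappa> * (\<Sum>j\<in>J. m \<kappa> j * s j)) + (\<Sum>\<kappa>\<in>K. r \<kappa> * norm (z \<kappa>))"
    and \<eta>: "\<eta> > 0"
  obtains e where "\<And>\<kappa>. \<kappa> \<in> K \<Longrightarrow> norm (a \<kappa> - (\<Sum>j\<in>J. smul (m \<kappa> j) (e j))) \<le> (1 + \<eta>) * r \<kappa>"
    "\<And>q. q \<in> Q \<Longrightarrow> norm (g q (e (v q)) - \<theta> q) \<le> (1 + \<eta>) * \<epsilon>"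
proof -
  have "\<exists>x. g q x \<noteq> 0" if "q \<in> Q" for q
  proof (rule ccontr)
    assume "\<not> ?thesis"
    then have "g q = (\<lambda>x. 0)" by auto
    then show False using g(2)[OF that] by (simp add: onorm_zero)
  qed
  then obtain x0 where x0: "\<And>q. q \<in> Q \<Longrightarrow> g q (x0 q) \<noteq> 0" by metis
  define xq where "xq q = smul (\<theta> q / g q (x0 q)) (x0 q)" for q
  have xq: "g q (xq q) = \<theta> q" if "q \<in> Q" for q
    using x0[OF that] by (simp add: xq_def dualD(3)[OF g(1)[OF that]])
  define \<rho> :: "'c + 'q \<Rightarrow> 'a \<Rightarrow> real" where "\<rho> i x = (case i of Inl \<kappa> \<Rightarrow> norm x | Inr q \<Rightarrow> norm (g q x))" for i x
  define a' where "a' i = (case i of Inl \<kappa> \<Rightarrow> a \<kappa> | Inr q \<Rightarrow> xq q)" for i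
  define m' where "m' i j = (case i of Inl \<kappa> \<Rightarrow> m \<kappa> j | Inr q \<Rightarrow> if j = v q then 1 else 0)" for i j
  define r' where "r' i = (case i of Inl \<kappa> \<Rightarrow> r \<kappa> | Inr q \<Rightarrow> \<epsilon>)" for i :: "'c + 'q"
  note defs' = \<rho>_def a'_def m'_def r'_def
  have "\<exists>e. \<forall>i\<in>K <+> Q. \<rho> i (a' i - (\<Sum>j\<in>J. smul (m' i j) (e j))) \<le> (1 + \<eta>) * r' i"
  proof (rule seminorm_system_solvable[where K = "K <+> Q" and J = J and r = r' and \<rho> = \<rho> and a = a' and m = m' and \<eta> = \<eta>])
    show "finite (K <+> Q)" "finite J" using K Q J by auto
    show "r' i > 0" if "i \<in> K <+> Q" for i using that r \<epsilon> by (auto simp: r'_def)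
    show "\<rho> i (x + y) \<le> \<rho> i x + \<rho> i y" if "i \<in> K <+> Q" for i x y
      using that by (auto simp: \<rho>_def dualD(2)[OF g(1)] norm_triangle_ineq)
    show "\<rho> i (smul c x) = norm c * \<rho> i x" if "i \<in> K <+> Q" for i c x
      using that by (auto simp: \<rho>_def dualD(3)[OF g(1)] norm_smul norm_mult)
    show "\<eta> > 0" by (rule \<eta>)
    fix e assume "\<And>i. i \<in> K <+> Q \<Longrightarrow> \<rho> i (a' i - (\<Sum>j\<in>J. smul (m' i j) (e j))) \<le> (1 + \<eta>) * r' i"
    then show "\<exists>e. \<forall>i\<in>K <+> Q. \<rho> i (a' i - (\<Sum>j\<in>J. smul (m' i j) (e j))) \<le> (1 + \<eta>) * r' i" by blast
  next
    fix \<phi>' :: "'c + 'q \<Rightarrow> 'a \<Rightarrow> 'k" and t' :: "'c + 'q \<Rightarrow> real"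
    assume add: "\<And>i x y. i \<in> K <+> Q \<Longrightarrow> \<phi>' i (x + y) = \<phi>' i x + \<phi>' i y"
      and sc: "\<And>i c x. i \<in> K <+> Q \<Longrightarrow> \<phi>' i (smul c x) = c * \<phi>' i x"
      and bd: "\<And>i x. i \<in> K <+> Q \<Longrightarrow> norm (\<phi>' i x) \<le> t' i * \<rho> i x"
      and t': "\<And>i. i \<in> K <+> Q \<Longrightarrow> 0 \<le> t' i"
      and rel: "\<And>j x. j \<in> J \<Longrightarrow> (\<Sum>i\<in>K <+> Q. m' i j * \<phi>' i x) = 0"
    have "\<exists>\<beta>. norm \<beta> \<le> t' (Inr q) \<and> (\<forall>x. \<phi>' (Inr q) x = \<beta> * g q x)" if q: "q \<in> Q" for q
    proof -
      have i: "Inr q \<in> K <+> Q" using q by auto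
      have "norm (\<phi>' (Inr q) x) \<le> t' (Inr q) * norm (g q x)" for x
        using bd[OF i, of x] by (simp add: \<rho>_def)
      from multiple_of_dominating_functional[OF g(1)[OF q] x0[OF q] add[OF i] sc[OF i] this]
      show ?thesis by metis
    qed
    then obtain \<beta> where \<beta>: "\<And>q. q \<in> Q \<Longrightarrow> norm (\<beta> q) \<le> t' (Inr q)"
      "\<And>q x. q \<in> Q \<Longrightarrow> \<phi>' (Inr q) x = \<beta> q * g q x" by metis
    define \<phi> where "\<phi> \<kappa> = \<phi>' (Inl \<kappa>)" for \<kappa>
    define t where "t \<kappa> = t' (Inl \<kappa>)" for \<kappa>
    have \<phi>: "\<phi> \<kappa> \<in> dual smul" "onorm (\<phi> \<kappa>) \<le> t \<kappa>" if "\<kappa> \<in> K" for \<kappa>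
    proof -
      have i: "Inl \<kappa> \<in> K <+> Q" using that by auto
      have bd: "norm (\<phi> \<kappa> x) \<le> t \<kappa> * norm x" for x using bd[OF i, of x] by (simp add: \<phi>_def t_def \<rho>_def)
      show "\<phi> \<kappa> \<in> dual smul" by (rule dualI[OF _ _ bd]) (simp_all add: \<phi>_def add[OF i] sc[OF i])
      show "onorm (\<phi> \<kappa>) \<le> t \<kappa>" using bd t'[OF i] by (intro onorm_bound) (auto simp: t_def)
    qed
    define f where "f i = (case i of Inl \<kappa> \<Rightarrow> \<phi> \<kappa> | Inr q \<Rightarrow> g q)" for i
    define coef where "coef j i = (case i of Inl \<kappa> \<Rightarrow> m \<kappa> j | Inr q \<Rightarrow> if j = v q then \<beta> q else 0)" for j and i :: "'c + 'q"
    have fdual: "f i \<in> dual smul" if "i \<in> K <+> Q" for i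
      using that \<phi>(1) g(1) by (auto simp: f_def)
    have rel': "(\<Sum>i\<in>K <+> Q. coef j i * f i x) = 0" if "j \<in> J" for j x
    proof -
      have "(\<Sum>i\<in>K <+> Q. coef j i * f i x) = (\<Sum>i\<in>K <+> Q. m' i j * \<phi>' i x)"
        by (intro sum.cong) (auto simp: coef_def f_def m'_def \<phi>_def \<beta>(2))
      then show ?thesis using rel[OF that] by simp
    qed
    \<comment> \<open>All errors of an approximation of accuracy \<open>\<tau>\<close> add up to at most \<open>\<tau> * err\<close>.\<close>
    define err where "err = (\<Sum>\<kappa>\<in>K. r \<kappa>) + (\<Sum>\<kappa>\<in>K. norm (a \<kappa>)) + (\<Sum>j\<in>J. \<Sum>i\<in>K <+> Q. norm (coef j i)) +
      (\<Sum>q\<in>Q. norm (\<beta> q) * (16 * real (card Q) + 1))"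
    have main: "Re_K (\<Sum>\<kappa>\<in>K. \<phi> \<kappa> (a \<kappa>)) + Re_K (\<Sum>q\<in>Q. \<beta> q * \<theta> q) \<le>
        (\<Sum>\<kappa>\<in>K. r \<kappa> * t \<kappa>) + (\<Sum>q\<in>Q. \<epsilon> * norm (\<beta> q)) + \<tau> * err" if \<tau>: "\<tau> > 0" for \<tau>
    proof -
      have "\<exists>C b z. finite C \<and> (\<forall>c\<in>C. b c \<in> dual smul) \<and>
          (\<forall>w. onorm (\<lambda>x. \<Sum>c\<in>C. w c * b c x) = (\<Sum>c\<in>C. norm (w c))) \<and>
          (\<forall>i\<in>K <+> Q. onorm (\<lambda>x. f i x - (\<Sum>c\<in>(C :: ('c + 'q \<Rightarrow> 'k) set). z i c * b c x)) \<le> \<tau>)"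
        by (rule dual_l1_approximation[where I = "K <+> Q" and f = f, OF pre finite_Plus[OF K Q] fdual \<tau>])
          (assumption, blast)
      then obtain C b z where C: "finite (C :: ('c + 'q \<Rightarrow> 'k) set)" and b: "\<And>c. c \<in> C \<Longrightarrow> b c \<in> dual smul"
        and iso: "\<And>w. onorm (\<lambda>x. \<Sum>c\<in>C. w c * b c x) = (\<Sum>c\<in>C. norm (w c))"
        and approx: "\<And>i. i \<in> K <+> Q \<Longrightarrow> onorm (\<lambda>x. f i x - (\<Sum>c\<in>C. z i c * b c x)) \<le> \<tau>"
        by blast
      have bnorm: "onorm (b c) \<le> 1" if "c \<in> C" for c
      proof -
        have "(\<Sum>c'\<in>C. (if c' = c then 1 else 0) * b c' x) = b c x" for x
          using C that by (simp add: if_distrib[of "\<lambda>y. y * _"] cong: if_cong)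
        then show ?thesis using iso[of "\<lambda>c'. if c' = c then 1 else 0"] C that
          by (simp add: if_distrib[of norm] cong: if_cong)
      qed
      define f' where "f' i = (\<lambda>x. \<Sum>c\<in>C. z i c * b c x)" for i
      have f': "f' i \<in> dual smul" for i unfolding f'_def by (rule dual_sum[OF b])
      have diff: "(\<lambda>x. f i x - f' i x) \<in> dual smul" "onorm (\<lambda>x. f i x - f' i x) \<le> \<tau>" if "i \<in> K <+> Q" for i
        using dual_diff[OF fdual[OF that] f'] approx[OF that] by (auto simp: f'_def)
      have f'_le: "onorm (f' i) \<le> onorm (f i) + \<tau>" if "i \<in> K <+> Q" for i
      proof -
        have "onorm (\<lambda>x. f i x + (-1) * (f i x - f' i x)) \<le> onorm (f i) + onorm (\<lambda>x. (-1) * (f i x - f' i x))"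
          by (intro onorm_dual_add_le dual_scale fdual diff that)
        also have "onorm (\<lambda>x. (-1) * (f i x - f' i x)) = onorm (\<lambda>x. f i x - f' i x)"
          using onorm_dual_scale[OF diff(1)[OF that], of "-1"] by simp
        finally show ?thesis using diff(2)[OF that] by simp
      qed
      have f'_ge: "onorm (f i) - \<tau> \<le> onorm (f' i)" if "i \<in> K <+> Q" for i
      proof -
        have "onorm (\<lambda>x. f' i x + (f i x - f' i x)) \<le> onorm (f' i) + onorm (\<lambda>x. f i x - f' i x)"
          by (intro onorm_dual_add_le f' diff that)
        then show ?thesis using diff(2)[OF that] by simp
      qed
      have f'_norm: "onorm (f' i) = (\<Sum>c\<in>C. norm (z i c))" for i unfolding f'_def by (rule iso)
      define Z where "Z \<kappa> c = z (Inl \<kappa>) c" for \<kappa> c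
      define G where "G q c = z (Inr q) c" for q c
      have Zsum: "(\<Sum>c\<in>C. norm (Z \<kappa> c)) \<le> t \<kappa> + \<tau>" if "\<kappa> \<in> K" for \<kappa>
        using f'_le[OF InlI[OF that]] f'_norm[of "Inl \<kappa>"] \<phi>(2)[OF that] that by (auto simp: f_def Z_def)
      have Gsum: "(\<Sum>c\<in>C. norm (G q c)) \<le> 1 + \<tau>" "(\<Sum>c\<in>C. norm (G q c)) \<ge> 1 - \<tau>" if "q \<in> Q" for q
        using f'_le[OF InrI[OF that]] f'_ge[OF InrI[OF that]] f'_norm[of "Inr q"] g(2)[OF that] that
        by (auto simp: f_def G_def)
      have overlap: "(\<Sum>c\<in>C. min (norm (G p c)) (norm (G q c))) \<le> 2 * \<delta> + 8 * \<tau>"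
        if pq: "p \<in> Q" "q \<in> Q" "p \<noteq> q" for p q
      proof -
        have ip: "Inr p \<in> K <+> Q" and iq: "Inr q \<in> K <+> Q" using pq by auto
        have shift: "2 - \<delta> - 2 * \<tau> \<le> (\<Sum>c\<in>C. norm (G p c + s * G q c))"
          if s: "norm s = 1" "2 - \<delta> \<le> onorm (\<lambda>x. g p x + s * g q x)" for s
        proof -
          have comb: "(\<lambda>x. f' (Inr p) x + s * f' (Inr q) x) = (\<lambda>x. \<Sum>c\<in>C. (G p c + s * G q c) * b c x)"
            by (simp add: f'_def G_def algebra_simps sum.distrib sum_distrib_left)
          have eq: "g p x + s * g q x = (f' (Inr p) x + s * f' (Inr q) x) +
              ((f (Inr p) x - f' (Inr p) x) + s * (f (Inr q) x - f' (Inr q) x))" for x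
            by (simp add: f_def algebra_simps)
          have "onorm (\<lambda>x. g p x + s * g q x) \<le> onorm (\<lambda>x. f' (Inr p) x + s * f' (Inr q) x) +
              onorm (\<lambda>x. (f (Inr p) x - f' (Inr p) x) + s * (f (Inr q) x - f' (Inr q) x))"
            unfolding eq by (intro onorm_dual_add_le dual_add dual_scale f' diff ip iq)
          also have "onorm (\<lambda>x. (f (Inr p) x - f' (Inr p) x) + s * (f (Inr q) x - f' (Inr q) x)) \<le>
              onorm (\<lambda>x. f (Inr p) x - f' (Inr p) x) + onorm (\<lambda>x. s * (f (Inr q) x - f' (Inr q) x))"
            by (intro onorm_dual_add_le dual_scale diff ip iq)
          also have "onorm (\<lambda>x. s * (f (Inr q) x - f' (Inr q) x)) = onorm (\<lambda>x. f (Inr q) x - f' (Inr q) x)"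
            using onorm_dual_scale[OF diff(1)[OF iq], of s] s(1) by simp
          finally show ?thesis
            using s(2) diff(2)[OF ip] diff(2)[OF iq] by (simp add: comb iso)
        qed
        have "2 - \<delta> - 2 * \<tau> \<le> (\<Sum>c\<in>C. norm (G p c + G q c))" using shift[of 1] disj[OF pq] by simp
        moreover have "2 - \<delta> - 2 * \<tau> \<le> (\<Sum>c\<in>C. norm (G p c - G q c))" using shift[of "-1"] disj[OF pq] by simp
        moreover have "(\<Sum>c\<in>C. min (norm (G p c)) (norm (G q c))) \<le>
            (\<Sum>c\<in>C. 2 * norm (G p c) + 2 * norm (G q c) - norm (G p c + G q c) - norm (G p c - G q c))"
          by (intro sum_mono min_norm_le_overlap)
        ultimately show ?thesis
          using Gsum(1)[OF pq(1)] Gsum(1)[OF pq(2)]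
          by (simp add: sum.distrib sum_subtractf flip: sum_distrib_left)
      qed
      have M0: "0 \<le> 2 * \<delta> + 8 * \<tau>" using \<delta> \<tau> by simp
      have "\<exists>cell (\<omega> :: _ \<Rightarrow> 'k). (\<forall>c. cell c \<subseteq> Q \<and> card (cell c) \<le> 1 \<and> norm (\<omega> c) = 1) \<and>
          (\<forall>c. \<forall>q\<in>cell c. \<omega> c * G q c = of_real (norm (G q c))) \<and>
          (\<forall>p\<in>Q. (\<Sum>c\<in>C. if p \<in> cell c then 0 else norm (G p c)) \<le> real (card Q) * (2 * \<delta> + 8 * \<tau>))"
        by (rule cells_of_almost_disjoint[where G = G, OF Q C M0]) (erule (2) overlap, blast)
      then obtain cell and \<omega> :: "_ \<Rightarrow> 'k" where cell: "\<And>c. cell c \<subseteq> Q" "\<And>c. card (cell c) \<le> 1" "\<And>c. norm (\<omega> c) = 1"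
        "\<And>c q. q \<in> cell c \<Longrightarrow> \<omega> c * G q c = of_real (norm (G q c))"
        "\<And>p. p \<in> Q \<Longrightarrow> (\<Sum>c\<in>C. if p \<in> cell c then 0 else norm (G p c)) \<le> real (card Q) * (2 * \<delta> + 8 * \<tau>)"
        by blast
      have "\<forall>c\<in>C. \<exists>s. (\<forall>j\<in>J. norm (s j) \<le> 1) \<and> (\<forall>q\<in>cell c. s (v q) = \<theta> q * \<omega> c) \<and>
        Re_K (\<Sum>\<kappa>\<in>K. Z \<kappa> c * b c (a \<kappa>)) \<le>
          Re_K (\<Sum>\<kappa>\<in>K. Z \<kappa> c * (\<Sum>j\<in>J. m \<kappa> j * s j)) + (\<Sum>\<kappa>\<in>K. r \<kappa> * norm (Z \<kappa> c))"
        by (intro ballI pointwise) (use b bnorm cell in auto)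
      from bchoice[OF this] obtain s where s: "\<And>c j. c \<in> C \<Longrightarrow> j \<in> J \<Longrightarrow> norm (s c j) \<le> 1"
        "\<And>c q. c \<in> C \<Longrightarrow> q \<in> cell c \<Longrightarrow> s c (v q) = \<theta> q * \<omega> c"
        "\<And>c. c \<in> C \<Longrightarrow> Re_K (\<Sum>\<kappa>\<in>K. Z \<kappa> c * b c (a \<kappa>)) \<le>
          Re_K (\<Sum>\<kappa>\<in>K. Z \<kappa> c * (\<Sum>j\<in>J. m \<kappa> j * s c j)) + (\<Sum>\<kappa>\<in>K. r \<kappa> * norm (Z \<kappa> c))"
        by blast
      \<comment> \<open>On the cell of \<open>q\<close> the scalars \<open>s\<close> turn the entries of \<open>G q\<close> to the phase \<open>\<theta> q\<close>; little mass lies elsewhere.\<close>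
      have val_near: "norm ((\<Sum>c\<in>C. s c (v q) * G q c) - \<theta> q) \<le> \<epsilon> + (16 * real (card Q) + 1) * \<tau>" if q: "q \<in> Q" for q
      proof -
        have "norm (s c (v q) * G q c - \<theta> q * of_real (norm (G q c))) \<le> 2 * (if q \<in> cell c then 0 else norm (G q c))"
          if c: "c \<in> C" for c
        proof (cases "q \<in> cell c")
          case True
          then show ?thesis using s(2)[OF c True] cell(4)[OF True] by (simp add: mult.assoc)
        next
          case False
          have "norm (s c (v q) * G q c - \<theta> q * of_real (norm (G q c))) \<le> norm (s c (v q)) * norm (G q c) + norm (G q c)"
            using norm_triangle_ineq4[of "s c (v q) * G q c" "\<theta> q * of_real (norm (G q c))"] \<theta>[OF q]
            by (simp add: norm_mult)
          also have "norm (s c (v q)) * norm (G q c) \<le> norm (G q c)"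
            using s(1)[OF c v[OF q]] by (simp add: mult_left_le_one_le)
          finally show ?thesis using False by simp
        qed
        then have "norm (\<Sum>c\<in>C. s c (v q) * G q c - \<theta> q * of_real (norm (G q c))) \<le>
            (\<Sum>c\<in>C. 2 * (if q \<in> cell c then 0 else norm (G q c)))"
          by (intro sum_norm_le)
        also have "\<dots> \<le> 2 * (real (card Q) * (2 * \<delta> + 8 * \<tau>))"
          using cell(5)[OF q] by (simp flip: sum_distrib_left)
        finally have 1: "norm ((\<Sum>c\<in>C. s c (v q) * G q c) - \<theta> q * of_real (\<Sum>c\<in>C. norm (G q c))) \<le>
            2 * (real (card Q) * (2 * \<delta> + 8 * \<tau>))"
          by (simp add: sum_subtractf sum_distrib_left)
        have "\<theta> q * of_real (\<Sum>c\<in>C. norm (G q c)) - \<theta> q = \<theta> q * of_real ((\<Sum>c\<in>C. norm (G q c)) - 1)"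
          by (simp add: algebra_simps)
        then have 2: "norm (\<theta> q * of_real (\<Sum>c\<in>C. norm (G q c)) - \<theta> q) \<le> \<tau>"
          using Gsum[OF q] \<theta>[OF q] by (simp only: norm_mult norm_of_real) auto
        have "norm ((\<Sum>c\<in>C. s c (v q) * G q c) - \<theta> q) \<le> 2 * (real (card Q) * (2 * \<delta> + 8 * \<tau>)) + \<tau>"
          using norm_triangle_mono[OF 1 2] by simp
        then show ?thesis using \<delta>(2) by (simp add: algebra_simps)
      qed
      \<comment> \<open>The approximation satisfies the linear relations only up to the defect \<open>R\<close>.\<close>
      define R where "R j c = (\<Sum>i\<in>K <+> Q. coef j i * z i c)" for j c
      have Rsum: "(\<Sum>c\<in>C. norm (R j c)) \<le> \<tau> * (\<Sum>i\<in>K <+> Q. norm (coef j i))" if j: "j \<in> J" for j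
      proof -
        have "(\<Sum>c\<in>C. R j c * b c x) = (\<Sum>i\<in>K <+> Q. (- coef j i) * (f i x - f' i x))" for x
        proof -
          have "(\<Sum>c\<in>C. R j c * b c x) = (\<Sum>i\<in>K <+> Q. coef j i * f' i x)"
            unfolding R_def f'_def sum_distrib_right sum_distrib_left
            by (subst sum.swap) (simp add: mult.assoc)
          then show ?thesis using rel'[OF j, of x] by (simp add: algebra_simps sum_subtractf)
        qed
        then have "(\<Sum>c\<in>C. norm (R j c)) = onorm (\<lambda>x. \<Sum>i\<in>K <+> Q. (- coef j i) * (f i x - f' i x))"
          using iso[of "R j"] by simp
        also have "\<dots> \<le> (\<Sum>i\<in>K <+> Q. norm (- coef j i) * onorm (\<lambda>x. f i x - f' i x))"
          by (rule onorm_dual_sum_le[OF diff(1)])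
        also have "\<dots> \<le> (\<Sum>i\<in>K <+> Q. norm (coef j i) * \<tau>)"
          by (intro sum_mono) (simp add: mult_left_mono diff(2))
        finally show ?thesis by (simp add: sum_distrib_left mult.commute)
      qed
      have R_eq: "(\<Sum>\<kappa>\<in>K. Z \<kappa> c * (\<Sum>j\<in>J. m \<kappa> j * s c j)) =
          (\<Sum>j\<in>J. s c j * R j c) - (\<Sum>q\<in>Q. \<beta> q * (s c (v q) * G q c))" for c
      proof -
        have "(\<Sum>j\<in>J. s c j * R j c) = (\<Sum>j\<in>J. s c j * (\<Sum>\<kappa>\<in>K. m \<kappa> j * Z \<kappa> c)) +
            (\<Sum>j\<in>J. s c j * (\<Sum>q\<in>Q. (if j = v q then \<beta> q else 0) * G q c))"
          using K Q by (simp add: R_def sum.Plus coef_def Z_def G_def distrib_left sum.distrib)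
        also have "(\<Sum>j\<in>J. s c j * (\<Sum>\<kappa>\<in>K. m \<kappa> j * Z \<kappa> c)) = (\<Sum>\<kappa>\<in>K. Z \<kappa> c * (\<Sum>j\<in>J. m \<kappa> j * s c j))"
          unfolding sum_distrib_left by (subst sum.swap) (simp add: mult_ac)
        also have "(\<Sum>j\<in>J. s c j * (\<Sum>q\<in>Q. (if j = v q then \<beta> q else 0) * G q c)) =
            (\<Sum>q\<in>Q. \<Sum>j\<in>J. if j = v q then \<beta> q * (s c j * G q c) else 0)"
          unfolding sum_distrib_left
          by (subst sum.swap) (auto intro!: sum.cong simp: mult_ac)
        also have "\<dots> = (\<Sum>q\<in>Q. \<beta> q * (s c (v q) * G q c))"
          using J v by (intro sum.cong) auto
        finally show ?thesis by simp
      qed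
      have "Re_K (\<Sum>\<kappa>\<in>K. \<phi> \<kappa> (a \<kappa>)) = Re_K (\<Sum>\<kappa>\<in>K. f' (Inl \<kappa>) (a \<kappa>)) +
          Re_K (\<Sum>\<kappa>\<in>K. f (Inl \<kappa>) (a \<kappa>) - f' (Inl \<kappa>) (a \<kappa>))"
        by (simp add: f_def sum_subtractf Re_K_simps)
      also have "Re_K (\<Sum>\<kappa>\<in>K. f (Inl \<kappa>) (a \<kappa>) - f' (Inl \<kappa>) (a \<kappa>)) \<le> (\<Sum>\<kappa>\<in>K. \<tau> * norm (a \<kappa>))"
        unfolding Re_K_sum
        by (intro sum_mono order.trans[OF Re_K_le_norm] dual_norm_le[OF diff]) auto
      also have "Re_K (\<Sum>\<kappa>\<in>K. f' (Inl \<kappa>) (a \<kappa>)) = (\<Sum>c\<in>C. Re_K (\<Sum>\<kappa>\<in>K. Z \<kappa> c * b c (a \<kappa>)))"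
        unfolding f'_def Z_def by (subst sum.swap) (simp add: Re_K_sum)
      also have "\<dots> \<le> (\<Sum>c\<in>C. Re_K (\<Sum>\<kappa>\<in>K. Z \<kappa> c * (\<Sum>j\<in>J. m \<kappa> j * s c j)) + (\<Sum>\<kappa>\<in>K. r \<kappa> * norm (Z \<kappa> c)))"
        by (intro sum_mono s(3))
      also have "\<dots> = (\<Sum>c\<in>C. Re_K (\<Sum>j\<in>J. s c j * R j c)) - Re_K (\<Sum>c\<in>C. \<Sum>q\<in>Q. \<beta> q * (s c (v q) * G q c)) +
          (\<Sum>c\<in>C. \<Sum>\<kappa>\<in>K. r \<kappa> * norm (Z \<kappa> c))"
        by (simp add: R_eq Re_K_simps Re_K_sum sum.distrib sum_subtractf)
      also have "(\<Sum>c\<in>C. Re_K (\<Sum>j\<in>J. s c j * R j c)) \<le> (\<Sum>c\<in>C. \<Sum>j\<in>J. norm (R j c))"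
        unfolding Re_K_sum
        by (intro sum_mono order.trans[OF Re_K_le_norm]) (simp add: norm_mult mult_left_le_one_le s(1))
      also have "\<dots> = (\<Sum>j\<in>J. \<Sum>c\<in>C. norm (R j c))" by (rule sum.swap)
      also have "\<dots> \<le> (\<Sum>j\<in>J. \<tau> * (\<Sum>i\<in>K <+> Q. norm (coef j i)))" by (intro sum_mono Rsum)
      also have "(\<Sum>c\<in>C. \<Sum>\<kappa>\<in>K. r \<kappa> * norm (Z \<kappa> c)) = (\<Sum>\<kappa>\<in>K. r \<kappa> * (\<Sum>c\<in>C. norm (Z \<kappa> c)))"
        by (subst sum.swap) (simp add: sum_distrib_left)
      also have "\<dots> \<le> (\<Sum>\<kappa>\<in>K. r \<kappa> * (t \<kappa> + \<tau>))"
        using r by (intro sum_mono mult_left_mono Zsum) (auto intro: less_imp_le)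
      also have "(\<Sum>c\<in>C. \<Sum>q\<in>Q. \<beta> q * (s c (v q) * G q c)) = (\<Sum>q\<in>Q. \<beta> q * (\<Sum>c\<in>C. s c (v q) * G q c))"
        by (subst sum.swap) (simp add: sum_distrib_left)
      finally have 1: "Re_K (\<Sum>\<kappa>\<in>K. \<phi> \<kappa> (a \<kappa>)) + Re_K (\<Sum>q\<in>Q. \<beta> q * (\<Sum>c\<in>C. s c (v q) * G q c)) \<le>
          (\<Sum>j\<in>J. \<tau> * (\<Sum>i\<in>K <+> Q. norm (coef j i))) + (\<Sum>\<kappa>\<in>K. r \<kappa> * (t \<kappa> + \<tau>)) + (\<Sum>\<kappa>\<in>K. \<tau> * norm (a \<kappa>))"
        by simp
      have "Re_K (\<Sum>q\<in>Q. \<beta> q * \<theta> q) - Re_K (\<Sum>q\<in>Q. \<beta> q * (\<Sum>c\<in>C. s c (v q) * G q c)) =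
          (\<Sum>q\<in>Q. Re_K (- (\<beta> q * ((\<Sum>c\<in>C. s c (v q) * G q c) - \<theta> q))))"
        by (simp add: Re_K_sum Re_K_simps algebra_simps sum_subtractf)
      also have "\<dots> \<le> (\<Sum>q\<in>Q. norm (\<beta> q) * (\<epsilon> + (16 * real (card Q) + 1) * \<tau>))"
      proof (intro sum_mono order.trans[OF Re_K_le_norm])
        fix q assume "q \<in> Q"
        then show "norm (- (\<beta> q * ((\<Sum>c\<in>C. s c (v q) * G q c) - \<theta> q))) \<le> norm (\<beta> q) * (\<epsilon> + (16 * real (card Q) + 1) * \<tau>)"
          using val_near by (simp add: norm_mult mult_left_mono)
      qed
      finally have 2: "Re_K (\<Sum>q\<in>Q. \<beta> q * \<theta> q) \<le> Re_K (\<Sum>q\<in>Q. \<beta> q * (\<Sum>c\<in>C. s c (v q) * G q c)) +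
          (\<Sum>q\<in>Q. norm (\<beta> q) * (\<epsilon> + (16 * real (card Q) + 1) * \<tau>))" by simp
      have 3: "(\<Sum>q\<in>Q. norm (\<beta> q) * (\<epsilon> + (16 * real (card Q) + 1) * \<tau>)) =
          (\<Sum>q\<in>Q. \<epsilon> * norm (\<beta> q)) + \<tau> * (\<Sum>q\<in>Q. norm (\<beta> q) * (16 * real (card Q) + 1))"
        unfolding sum_distrib_left sum.distrib[symmetric] by (intro sum.cong) (simp_all add: algebra_simps)
      have 4: "(\<Sum>\<kappa>\<in>K. r \<kappa> * (t \<kappa> + \<tau>)) = (\<Sum>\<kappa>\<in>K. r \<kappa> * t \<kappa>) + \<tau> * (\<Sum>\<kappa>\<in>K. r \<kappa>)"
        by (simp add: distrib_left sum.distrib sum_distrib_left mult.commute)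
      show ?thesis using 1 2 unfolding 3 4 err_def by (simp add: distrib_left sum_distrib_left)
    qed
    have err: "err \<ge> 0"
      unfolding err_def using r by (intro add_nonneg_nonneg sum_nonneg) (auto intro: less_imp_le)
    have "Re_K (\<Sum>\<kappa>\<in>K. \<phi> \<kappa> (a \<kappa>)) + Re_K (\<Sum>q\<in>Q. \<beta> q * \<theta> q) \<le>
        (\<Sum>\<kappa>\<in>K. r \<kappa> * t \<kappa>) + (\<Sum>q\<in>Q. \<epsilon> * norm (\<beta> q))"
    proof (rule field_le_epsilon)
      fix d :: real assume "d > 0"
      then have "d / (1 + err) > 0" "d / (1 + err) * err \<le> d"
        using err by (auto simp: field_simps)
      then show "Re_K (\<Sum>\<kappa>\<in>K. \<phi> \<kappa> (a \<kappa>)) + Re_K (\<Sum>q\<in>Q. \<beta> q * \<theta> q) \<le>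
        (\<Sum>\<kappa>\<in>K. r \<kappa> * t \<kappa>) + (\<Sum>q\<in>Q. \<epsilon> * norm (\<beta> q)) + d"
        using main[of "d / (1 + err)"] by linarith
    qed
    also have "(\<Sum>q\<in>Q. \<epsilon> * norm (\<beta> q)) \<le> (\<Sum>q\<in>Q. \<epsilon> * t' (Inr q))"
      using \<epsilon> \<beta>(1) by (intro sum_mono mult_left_mono) auto
    finally show "Re_K (\<Sum>i\<in>K <+> Q. \<phi>' i (a' i)) \<le> (\<Sum>i\<in>K <+> Q. r' i * t' i)"
      using K Q by (simp add: sum.Plus a'_def r'_def \<phi>_def t_def \<beta>(2) xq Re_K_simps)
  qed
  then obtain e where e: "\<And>i. i \<in> K <+> Q \<Longrightarrow> \<rho> i (a' i - (\<Sum>j\<in>J. smul (m' i j) (e j))) \<le> (1 + \<eta>) * r' i"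
    by blast
  show ?thesis
  proof (rule that[of e])
    show "norm (a \<kappa> - (\<Sum>j\<in>J. smul (m \<kappa> j) (e j))) \<le> (1 + \<eta>) * r \<kappa>" if "\<kappa> \<in> K" for \<kappa>
      using e[OF InlI[OF that]] by (auto simp: defs')
    show "norm (g q (e (v q)) - \<theta> q) \<le> (1 + \<eta>) * \<epsilon>" if q: "q \<in> Q" for q
    proof -
      have "(\<Sum>j\<in>J. smul (if j = v q then 1 else 0) (e j)) = (\<Sum>j\<in>J. if j = v q then e j else 0)"
        by (intro sum.cong) auto
      also have "\<dots> = e (v q)" using J v[OF q] by simp
      finally have "norm (g q (xq q - e (v q))) \<le> (1 + \<eta>) * \<epsilon>"
        using e[OF InrI[OF q]] by (auto simp: defs')
      then show ?thesis
        by (simp add: dualD(5)[OF g(1)[OF q]] xq[OF q] norm_minus_commute)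
    qed
  qed
qed

end

section \<open>Polynomials along sequences with bounded signed sums\<close>

text \<open>
  For fixed \<open>i\<close>, two sign vectors that differ only at \<open>i\<close> give sums that differ by twice the diagonal
  entry, so their norms are on average at least that of the entry. Now average over all signs.
\<close>

lemma sum_norm_diagonal_le:
  fixes a :: "nat \<Rightarrow> nat \<Rightarrow> 'b::real_normed_vector"
  assumes "\<And>s. s \<in> {..<N} \<rightarrow>\<^sub>E {1, -1 :: real} \<Longrightarrow> (\<Sum>i<N. norm (\<Sum>j<N. s j *\<^sub>R a j i)) \<le> B"
  shows "(\<Sum>i<N. norm (a i i)) \<le> B"
proof -
  define S where "S = {..<N} \<rightarrow>\<^sub>E {1, -1 :: real}"
  define f where "f s i = (\<Sum>j<N. s j *\<^sub>R a j i)" for s i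
  have finS: "finite S" unfolding S_def by (intro finite_PiE) auto
  have "(\<lambda>j\<in>{..<N}. 1) \<in> S" by (auto simp: S_def)
  then have cardS: "card S > 0" using finS by (auto simp: card_gt_0_iff)
  have diag: "real (card S) * norm (a i i) \<le> (\<Sum>s\<in>S. norm (f s i))" if i: "i < N" for i
  proof -
    define flip where "flip s = s(i := - s i)" for s :: "nat \<Rightarrow> real"
    have flipS: "flip s \<in> S" if "s \<in> S" for s
      using that i by (auto simp: S_def flip_def PiE_iff extensional_def)
    have flip_flip: "flip (flip s) = s" for s by (simp add: flip_def)
    have "bij_betw flip S S"
      by (rule bij_betwI[of flip S S flip]) (auto simp: flipS flip_flip)
    then have "(\<Sum>s\<in>S. norm (f (flip s) i)) = (\<Sum>s\<in>S. norm (f s i))"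
      by (rule sum.reindex_bij_betw[where g = "\<lambda>s. norm (f s i)"])
    moreover have "(\<Sum>s\<in>S. 2 * norm (a i i)) \<le> (\<Sum>s\<in>S. norm (f s i) + norm (f (flip s) i))"
    proof (rule sum_mono)
      fix s assume "s \<in> S"
      then have "s i \<in> {1, -1}" using i PiE_mem[of s "{..<N}" "\<lambda>_. {1, -1}" i] by (simp add: S_def)
      then have si: "\<bar>s i\<bar> = 1" by auto
      have "f s i - f (flip s) i = (\<Sum>j<N. (s j - flip s j) *\<^sub>R a j i)"
        by (simp add: f_def sum_subtractf scaleR_diff_left)
      also have "\<dots> = (\<Sum>j<N. if j = i then (2 * s i) *\<^sub>R a i i else 0)"
        by (intro sum.cong) (auto simp: flip_def)
      also have "\<dots> = (2 * s i) *\<^sub>R a i i" using i by simp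
      finally have "norm (f s i - f (flip s) i) = 2 * norm (a i i)" using si by (simp add: abs_mult)
      then show "2 * norm (a i i) \<le> norm (f s i) + norm (f (flip s) i)"
        using norm_triangle_ineq4[of "f s i" "f (flip s) i"] by simp
    qed
    ultimately show ?thesis by (simp add: sum.distrib)
  qed
  have "real (card S) * (\<Sum>i<N. norm (a i i)) \<le> (\<Sum>i<N. \<Sum>s\<in>S. norm (f s i))"
    unfolding sum_distrib_left using diag by (intro sum_mono) auto
  also have "\<dots> = (\<Sum>s\<in>S. \<Sum>i<N. norm (f s i))" by (rule sum.swap)
  also have "\<dots> \<le> (\<Sum>s\<in>S. B)" using assms unfolding S_def f_def by (intro sum_mono) auto
  finally show ?thesis using cardS by simp
qed

text \<open>
  Signs suffice for real scalars; the factor 2 accounts for real and imaginary parts.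
\<close>

lemma sum_norm_le_signed_sums:
  fixes a :: "nat \<Rightarrow> 'k::rc_field"
  assumes "\<And>s. s \<in> {..<N} \<rightarrow>\<^sub>E {1, -1 :: real} \<Longrightarrow> norm (\<Sum>j<N. s j *\<^sub>R a j) \<le> B"
  shows "(\<Sum>j<N. norm (a j)) \<le> 2 * B"
proof -
  have real: "(\<Sum>j<N. \<bar>L (a j)\<bar>) \<le> B" if "\<And>x y. L (x + y) = L x + L y" "\<And>r x. L (r *\<^sub>R x) = r * L x"
    "\<And>x. \<bar>L x\<bar> \<le> norm x" for L :: "'k \<Rightarrow> real"
  proof -
    define s where "s = (\<lambda>j\<in>{..<N}. if L (a j) \<ge> 0 then 1 else -1 :: real)"
    have s: "s \<in> {..<N} \<rightarrow>\<^sub>E {1, -1}" by (auto simp: s_def)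
    have L0: "L 0 = 0" using that(2)[of 0 0] by simp
    have Lsum: "L (sum h A) = (\<Sum>x\<in>A. L (h x))" for h and A :: "nat set"
      by (induction A rule: infinite_finite_induct) (simp_all add: L0 that(1))
    have "(\<Sum>j<N. \<bar>L (a j)\<bar>) = (\<Sum>j<N. L (s j *\<^sub>R a j))"
      by (intro sum.cong) (auto simp: s_def that(2))
    also have "\<dots> = L (\<Sum>j<N. s j *\<^sub>R a j)" by (rule Lsum[symmetric])
    also have "\<dots> \<le> B" using that(3)[of "\<Sum>j<N. s j *\<^sub>R a j"] assms[OF s] by linarith
    finally show ?thesis .
  qed
  have "(\<Sum>j<N. norm (a j)) \<le> (\<Sum>j<N. \<bar>Re (to_complex (a j))\<bar> + \<bar>Im (to_complex (a j))\<bar>)"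
  proof (intro sum_mono)
    fix j show "norm (a j) \<le> \<bar>Re (to_complex (a j))\<bar> + \<bar>Im (to_complex (a j))\<bar>"
      using cmod_le[of "to_complex (a j)"] norm_to_complex[of "a j"] by linarith
  qed
  also have "\<dots> = (\<Sum>j<N. \<bar>Re (to_complex (a j))\<bar>) + (\<Sum>j<N. \<bar>Im (to_complex (a j))\<bar>)" by (rule sum.distrib)
  also have "(\<Sum>j<N. \<bar>Re (to_complex (a j))\<bar>) \<le> B"
  proof (rule real)
    fix x :: 'k show "\<bar>Re (to_complex x)\<bar> \<le> norm x"
      using abs_Re_le_cmod[of "to_complex x"] norm_to_complex[of x] by linarith
  qed (simp_all add: to_complex_add to_complex_scaleR)
  also have "(\<Sum>j<N. \<bar>Im (to_complex (a j))\<bar>) \<le> B"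
  proof (rule real)
    fix x :: 'k show "\<bar>Im (to_complex x)\<bar> \<le> norm x"
      using abs_Im_le_cmod[of "to_complex x"] norm_to_complex[of x] by linarith
  qed (simp_all add: to_complex_add to_complex_scaleR)
  finally show ?thesis by simp
qed

context banach_space_over
begin

definition bounded_multilinear_form :: "nat \<Rightarrow> ((nat \<Rightarrow> 'a) \<Rightarrow> 'k) \<Rightarrow> real \<Rightarrow> bool"
  where "bounded_multilinear_form k A B \<longleftrightarrow> 0 \<le> B \<and>
    (\<forall>v w. (\<forall>i<k. v i = w i) \<longrightarrow> A v = A w) \<and>
    (\<forall>v. \<forall>i<k. \<forall>x y. A (v(i := x + y)) = A (v(i := x)) + A (v(i := y))) \<and>
    (\<forall>v. \<forall>i<k. \<forall>c x. A (v(i := smul c x)) = c * A (v(i := x))) \<and>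
    (\<forall>v. norm (A v) \<le> B * (\<Prod>i<k. norm (v i)))"

text \<open>
  Continuity at zero in the product topology bounds the form on families with small entries, and
  rescaling every entry separately gives the bound by the product of the norms.
\<close>

lemma continuous_multilinear_form_bounded:
  assumes "continuous_multilinear_form smul k A"
  obtains B where "bounded_multilinear_form k A B"
proof -
  have loc: "\<And>v w. (\<And>i. i < k \<Longrightarrow> v i = w i) \<Longrightarrow> A v = A w"
    and lin: "\<And>v i. i < k \<Longrightarrow> Vector_Spaces.linear smul (*) (\<lambda>x. A (v(i := x)))"
    and cont: "continuous_on UNIV A"
    using assms unfolding continuous_multilinear_form_def by blast+
  have add: "A (v(i := x + y)) = A (v(i := x)) + A (v(i := y))"
    and sc: "A (v(i := smul c x)) = c * A (v(i := x))" if "i < k" for v i x y c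
    using lin[OF that, of v] unfolding Vector_Spaces.linear_iff by blast+
  have zero: "A v = 0" if "i < k" "v i = 0" for v i
    using sc[OF that(1), of v 0 0] that(2) fun_upd_triv[of v i] by simp
  define U where "U = A -` ball (A (\<lambda>_. 0)) 1"
  have "open U" unfolding U_def using cont by (intro open_vimage) auto
  then have "openin (product_topology (\<lambda>i. euclidean) UNIV) U" by (simp add: open_fun_def)
  moreover have "(\<lambda>_. 0) \<in> U" by (simp add: U_def)
  ultimately have "\<exists>X. (\<lambda>_. 0) \<in> (\<Pi>\<^sub>E i\<in>UNIV. X i) \<and> (\<forall>i. open (X i)) \<and> (\<Pi>\<^sub>E i\<in>UNIV. X i) \<subseteq> U"
    using product_topology_open_contains_basis[of "\<lambda>i. euclidean" UNIV U "\<lambda>_. 0"] by auto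
  then obtain X where X: "\<And>i. 0 \<in> X i" "\<And>i. open (X i)" "(\<Pi>\<^sub>E i\<in>UNIV. X i) \<subseteq> U"
    by (auto simp: PiE_iff)
  have "\<forall>i. \<exists>d>0. cball 0 d \<subseteq> X i" using X(1,2) by (metis open_contains_cball)
  then obtain d where d: "\<And>i. d i > 0" "\<And>i. cball 0 (d i) \<subseteq> X i" by metis
  define e where "e = Min (insert 1 (d ` {..<k}))"
  have e: "e > 0" "\<And>i. i < k \<Longrightarrow> e \<le> d i" using d(1) by (auto simp: e_def)
  define B0 where "B0 = norm (A (\<lambda>_. 0)) + 1"
  have small: "norm (A v) \<le> B0" if "\<And>i. i < k \<Longrightarrow> norm (v i) \<le> e" for v
  proof -
    define w where "w i = (if i < k then v i else 0)" for i
    have "w i \<in> X i" for i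
      using that[of i] e(2)[of i] d(2)[of i] X(1)[of i] by (cases "i < k") (auto simp: w_def)
    then have "w \<in> U" using X(3) by auto
    then have "norm (A w) \<le> B0" using norm_triangle_sub[of "A w" "A (\<lambda>_. 0)"]
      by (simp add: U_def B0_def dist_norm norm_minus_commute)
    moreover have "A w = A v" by (rule loc) (simp add: w_def)
    ultimately show ?thesis by simp
  qed
  have scale: "A (\<lambda>i. if i < n then smul (c i) (v i) else v i) = (\<Prod>i<n. c i) * A v" if "n \<le> k" for n c v
    using that
  proof (induction n)
    case (Suc n)
    define w where "w = (\<lambda>i. if i < n then smul (c i) (v i) else v i)"
    have "(\<lambda>i. if i < Suc n then smul (c i) (v i) else v i) = w(n := smul (c n) (v n))"
      by (auto simp: w_def less_Suc_eq)
    moreover have "A (w(n := smul (c n) (v n))) = c n * A (w(n := v n))" using Suc.prems by (intro sc) simp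
    moreover have "w(n := v n) = w" by (auto simp: w_def)
    ultimately show ?case using Suc by (simp add: w_def)
  qed simp
  have bound: "norm (A v) \<le> (B0 / e ^ k) * (\<Prod>i<k. norm (v i))" for v
  proof (cases "\<exists>i<k. v i = 0")
    case True
    then have "A v = 0" using zero by blast
    then show ?thesis using e(1) by (simp add: B0_def prod_nonneg)
  next
    case False
    define c where "c i = (of_real (e / norm (v i)) :: 'k)" for i
    have "norm (A (\<lambda>i. if i < k then smul (c i) (v i) else v i)) \<le> B0"
      by (rule small) (use False e(1) in \<open>auto simp: c_def norm_smul norm_divide\<close>)
    then have "norm ((\<Prod>i<k. c i) * A v) \<le> B0" using scale[of k c v] by simp
    moreover have "norm (\<Prod>i<k. c i) = e ^ k / (\<Prod>i<k. norm (v i))"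
      using e(1) by (simp add: prod_norm[symmetric] c_def norm_divide norm_power prod_dividef)
    moreover have "(\<Prod>i<k. norm (v i)) > 0" using False by (intro prod_pos) auto
    ultimately show ?thesis using e(1) by (simp add: norm_mult field_simps)
  qed
  have "0 \<le> B0 / e ^ k" using e(1) by (simp add: B0_def)
  then have "bounded_multilinear_form k A (B0 / e ^ k)"
    unfolding bounded_multilinear_form_def using loc add sc bound by blast
  then show ?thesis by (rule that)
qed

text \<open>
  Multilinear forms are summable along the diagonal on sequences that span \<open>c\<^sub>0\<close>, that is, whose
  signed sums are bounded. In the induction the last variable of
  the form is split as \<open>y n = z n + y0\<close>. With the variable fixed at \<open>y0\<close> the induction hypothesis
  applies at once. With \<open>z n\<close> in it, the induction hypothesis is used for all signed sums of the
  \<open>z j\<close>, and averaging over the signs isolates the terms in which both indices agree.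
\<close>

lemma multilinear_form_fluctuation:
  fixes y :: "nat \<Rightarrow> 'a"
  assumes "bounded_multilinear_form k A B" and y0: "norm y0 \<le> 1" and "\<Gamma> \<ge> 0"
    and signs: "\<And>s. s \<in> {..<N} \<rightarrow>\<^sub>E {1, -1 :: real} \<Longrightarrow> norm (\<Sum>j<N. s j *\<^sub>R (y j - y0)) \<le> \<Gamma>"
  shows "(\<Sum>n<N. norm (A (\<lambda>_. y n) - A (\<lambda>_. y0))) \<le> B * (2 * ((\<Gamma> + 1) ^ k - 1))"
  using assms(1)
proof (induction k arbitrary: A B)
  case 0
  then have "A (\<lambda>_. y n) = A (\<lambda>_. y0)" for n unfolding bounded_multilinear_form_def by blast
  then show ?case by simp
next
  case (Suc k)
  have B: "0 \<le> B" and loc: "\<And>v w. (\<And>i. i < Suc k \<Longrightarrow> v i = w i) \<Longrightarrow> A v = A w"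
    and add: "\<And>v i x y. i < Suc k \<Longrightarrow> A (v(i := x + y)) = A (v(i := x)) + A (v(i := y))"
    and sc: "\<And>v i c x. i < Suc k \<Longrightarrow> A (v(i := smul c x)) = c * A (v(i := x))"
    and bd: "\<And>v. norm (A v) \<le> B * (\<Prod>i<Suc k. norm (v i))"
    using Suc.prems unfolding bounded_multilinear_form_def by blast+
  define A' where "A' x v = A (v(k := x))" for x v
  define z where "z n = y n - y0" for n
  define ck where "ck = 2 * ((\<Gamma> + 1) ^ k - 1)"
  have form: "bounded_multilinear_form k (A' x) (B * norm x)" for x
    unfolding bounded_multilinear_form_def
  proof (intro conjI allI impI)
    show "0 \<le> B * norm x" using B by simp
    show "A' x v = A' x w" if "\<forall>i<k. v i = w i" for v w
      unfolding A'_def using that by (intro loc) (auto simp: less_Suc_eq)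
    show "A' x (v(i := u + w)) = A' x (v(i := u)) + A' x (v(i := w))" if "i < k" for v i u w
      unfolding A'_def using that add[of i "v(k := x)" u w] by (simp add: fun_upd_twist)
    show "A' x (v(i := smul c u)) = c * A' x (v(i := u))" if "i < k" for v i c u
      unfolding A'_def using that sc[of i "v(k := x)" c u] by (simp add: fun_upd_twist)
    show "norm (A' x v) \<le> B * norm x * (\<Prod>i<k. norm (v i))" for v
    proof -
      have "(\<Prod>i<k. norm ((v(k := x)) i)) = (\<Prod>i<k. norm (v i))" by (intro prod.cong) auto
      then show ?thesis using bd[of "v(k := x)"] by (simp add: A'_def mult_ac)
    qed
  qed
  have form_bd: "norm (A' x v) \<le> B * norm x * (\<Prod>i<k. norm (v i))" for x v
    using form[of x] unfolding bounded_multilinear_form_def by blast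
  have A'_add: "A' (x + x') v = A' x v + A' x' v" for x x' v unfolding A'_def by (rule add) simp
  have A'_scale: "A' (r *\<^sub>R x) v = r *\<^sub>R A' x v" for r x v
    unfolding A'_def using sc[of k v "of_real r" x] by (simp add: smul_of_real scaleR_conv_of_real)
  have A'_0: "A' 0 v = 0" for v using A'_scale[of 0 0 v] by simp
  have A'_sum: "A' (\<Sum>j<N. s j *\<^sub>R z j) v = (\<Sum>j<N. s j *\<^sub>R A' (z j) v)" for s v
    by (induction N) (simp_all add: A'_0 A'_add A'_scale)
  have diag: "A (\<lambda>_. w) = A' w (\<lambda>_. w)" for w unfolding A'_def by (intro loc) auto
  have ck0: "ck \<ge> 0" using \<open>\<Gamma> \<ge> 0\<close> by (simp add: ck_def one_le_power)
  have first: "(\<Sum>n<N. norm (A' (z n) (\<lambda>_. y n) - A' (z n) (\<lambda>_. y0))) \<le> B * \<Gamma> * ck"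
  proof (rule sum_norm_diagonal_le[where a = "\<lambda>j n. A' (z j) (\<lambda>_. y n) - A' (z j) (\<lambda>_. y0)"])
    fix s assume s: "s \<in> {..<N} \<rightarrow>\<^sub>E {1, -1 :: real}"
    define x where "x = (\<Sum>j<N. s j *\<^sub>R z j)"
    have "(\<Sum>i<N. norm (\<Sum>j<N. s j *\<^sub>R (A' (z j) (\<lambda>_. y i) - A' (z j) (\<lambda>_. y0)))) =
        (\<Sum>n<N. norm (A' x (\<lambda>_. y n) - A' x (\<lambda>_. y0)))"
      unfolding x_def A'_sum by (simp add: scaleR_diff_right sum_subtractf)
    also have "\<dots> \<le> B * norm x * ck" unfolding ck_def by (rule Suc.IH[OF form])
    also have "\<dots> \<le> B * \<Gamma> * ck"
      using signs[OF s] B ck0 by (intro mult_right_mono mult_left_mono) (auto simp: x_def z_def)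
    finally show "(\<Sum>i<N. norm (\<Sum>j<N. s j *\<^sub>R (A' (z j) (\<lambda>_. y i) - A' (z j) (\<lambda>_. y0)))) \<le> B * \<Gamma> * ck" .
  qed
  have second: "(\<Sum>n<N. norm (A' (z n) (\<lambda>_. y0))) \<le> 2 * (B * \<Gamma>)"
  proof (rule sum_norm_le_signed_sums)
    fix s assume s: "s \<in> {..<N} \<rightarrow>\<^sub>E {1, -1 :: real}"
    define x where "x = (\<Sum>j<N. s j *\<^sub>R z j)"
    have "norm (A' x (\<lambda>_. y0)) \<le> B * norm x * (\<Prod>i<k. norm y0)"
      using form_bd[of x "\<lambda>_. y0"] by simp
    also have "\<dots> \<le> B * norm x * 1"
      using y0 B by (intro mult_left_mono prod_le_1) auto
    also have "\<dots> \<le> B * \<Gamma>" using signs[OF s] B by (simp add: mult_left_mono x_def z_def)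
    finally show "norm (\<Sum>j<N. s j *\<^sub>R A' (z j) (\<lambda>_. y0)) \<le> B * \<Gamma>"
      unfolding x_def A'_sum .
  qed
  have third: "(\<Sum>n<N. norm (A' y0 (\<lambda>_. y n) - A' y0 (\<lambda>_. y0))) \<le> B * ck"
  proof -
    have "(\<Sum>n<N. norm (A' y0 (\<lambda>_. y n) - A' y0 (\<lambda>_. y0))) \<le> B * norm y0 * ck"
      unfolding ck_def by (rule Suc.IH[OF form])
    also have "\<dots> \<le> B * ck" using y0 B ck0 by (intro mult_right_mono) (auto intro: mult_left_le)
    finally show ?thesis .
  qed
  have "norm (A (\<lambda>_. y n) - A (\<lambda>_. y0)) \<le> norm (A' (z n) (\<lambda>_. y n) - A' (z n) (\<lambda>_. y0)) +
      norm (A' (z n) (\<lambda>_. y0)) + norm (A' y0 (\<lambda>_. y n) - A' y0 (\<lambda>_. y0))" for n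
  proof -
    have "A (\<lambda>_. y n) = A' (z n) (\<lambda>_. y n) + A' y0 (\<lambda>_. y n)"
      using A'_add[of "z n" y0 "\<lambda>_. y n"] by (simp add: diag z_def)
    then have "A (\<lambda>_. y n) - A (\<lambda>_. y0) = (A' (z n) (\<lambda>_. y n) - A' (z n) (\<lambda>_. y0)) +
        A' (z n) (\<lambda>_. y0) + (A' y0 (\<lambda>_. y n) - A' y0 (\<lambda>_. y0))"
      by (simp add: diag)
    then show ?thesis by (simp only:) (intro norm_triangle_mono order.refl)
  qed
  then have "(\<Sum>n<N. norm (A (\<lambda>_. y n) - A (\<lambda>_. y0))) \<le> (\<Sum>n<N. norm (A' (z n) (\<lambda>_. y n) - A' (z n) (\<lambda>_. y0)) +
      norm (A' (z n) (\<lambda>_. y0)) + norm (A' y0 (\<lambda>_. y n) - A' y0 (\<lambda>_. y0)))"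
    by (intro sum_mono)
  also have "\<dots> \<le> B * \<Gamma> * ck + 2 * (B * \<Gamma>) + B * ck"
    using first second third by (simp add: sum.distrib)
  also have "\<dots> = B * (2 * ((\<Gamma> + 1) ^ Suc k - 1))" by (simp add: ck_def algebra_simps)
  finally show ?case .
qed

lemma polynomial_sum_of_bounded_forms:
  assumes "P \<in> polynomials smul"
  obtains d A B where "\<And>k. k \<le> d \<Longrightarrow> bounded_multilinear_form k (A k) (B k)"
    "\<And>x. P x = (\<Sum>k\<le>d. A k (\<lambda>_. x))"
proof -
  obtain d p where p: "\<And>k. k \<le> d \<Longrightarrow> p k \<in> homogeneous_polynomials smul k" "\<And>x. P x = (\<Sum>k\<le>d. p k x)"
    using assms unfolding polynomials_def by blast
  have "\<exists>A B. bounded_multilinear_form k A B \<and> (\<forall>x. p k x = A (\<lambda>_. x))" if k: "k \<le> d" for k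
  proof -
    obtain A where "continuous_multilinear_form smul k A" "\<forall>x. p k x = A (\<lambda>_. x)"
      using p(1)[OF k] unfolding homogeneous_polynomials_def by blast
    then show ?thesis using continuous_multilinear_form_bounded by metis
  qed
  then obtain A B where "\<And>k. k \<le> d \<Longrightarrow> bounded_multilinear_form k (A k) (B k)"
    "\<And>k x. k \<le> d \<Longrightarrow> p k x = A k (\<lambda>_. x)" by metis
  then show ?thesis using p(2) by (intro that[of d A B]) auto
qed

lemma polynomial_bdd_above_on_ball:
  assumes "P \<in> polynomials smul"
  shows "bdd_above ((\<lambda>x. norm (P x)) ` cball 0 1)"
proof -
  obtain d A B where AB: "\<And>k. k \<le> d \<Longrightarrow> bounded_multilinear_form k (A k) (B k)"
    "\<And>x. P x = (\<Sum>k\<le>d. A k (\<lambda>_. x))"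
    using polynomial_sum_of_bounded_forms[OF assms] by blast
  show ?thesis
  proof (rule bdd_aboveI2)
    fix x :: 'a assume "x \<in> cball 0 1"
    then have x: "norm x \<le> 1" by simp
    have "norm (A k (\<lambda>_. x)) \<le> B k" if k: "k \<le> d" for k
    proof -
      have B: "0 \<le> B k" and "norm (A k (\<lambda>_. x)) \<le> B k * (\<Prod>i<k. norm x)"
        using AB(1)[OF k] unfolding bounded_multilinear_form_def by blast+
      then have "norm (A k (\<lambda>_. x)) \<le> B k * (\<Prod>i<k. norm x)" by simp
      also have "\<dots> \<le> B k * 1" using x B by (intro mult_left_mono prod_le_1) auto
      finally show ?thesis by simp
    qed
    then show "norm (P x) \<le> (\<Sum>k\<le>d. B k)"
      unfolding AB(2) by (intro sum_norm_le) auto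
  qed
qed

text \<open>
  The bound does not depend on the length \<open>N\<close> of the sequence, so some term of a long
  sequence changes \<open>P\<close> as little as desired.
\<close>

lemma polynomial_fluctuation:
  assumes "P \<in> polynomials smul" and \<Gamma>: "\<Gamma> \<ge> 0"
  shows "\<exists>c. \<forall>(N::nat) y y0. norm y0 \<le> 1 \<longrightarrow>
    (\<forall>s\<in>{..<N} \<rightarrow>\<^sub>E {1, -1 :: real}. norm (\<Sum>j<N. s j *\<^sub>R (y j - y0)) \<le> \<Gamma>) \<longrightarrow>
    (\<Sum>n<N. norm (P (y n) - P y0)) \<le> c"
proof -
  obtain d A B where AB: "\<And>k. k \<le> d \<Longrightarrow> bounded_multilinear_form k (A k) (B k)"
    "\<And>x. P x = (\<Sum>k\<le>d. A k (\<lambda>_. x))"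
    using polynomial_sum_of_bounded_forms[OF assms(1)] by blast
  have "(\<Sum>n<N. norm (P (y n) - P y0)) \<le> (\<Sum>k\<le>d. B k * (2 * ((\<Gamma> + 1) ^ k - 1)))"
    if y0: "norm y0 \<le> 1"
      and signs: "\<forall>s\<in>{..<N} \<rightarrow>\<^sub>E {1, -1 :: real}. norm (\<Sum>j<N. s j *\<^sub>R (y j - y0)) \<le> \<Gamma>"
    for N :: nat and y y0
  proof -
    have "(\<Sum>n<N. norm (P (y n) - P y0)) \<le> (\<Sum>n<N. \<Sum>k\<le>d. norm (A k (\<lambda>_. y n) - A k (\<lambda>_. y0)))"
      unfolding AB(2) sum_subtractf[symmetric] by (intro sum_mono norm_sum)
    also have "\<dots> = (\<Sum>k\<le>d. \<Sum>n<N. norm (A k (\<lambda>_. y n) - A k (\<lambda>_. y0)))" by (rule sum.swap)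
    also have "\<dots> \<le> (\<Sum>k\<le>d. B k * (2 * ((\<Gamma> + 1) ^ k - 1)))"
    proof (rule sum_mono)
      fix k assume "k \<in> {..d}"
      then have "bounded_multilinear_form k (A k) (B k)" using AB(1) by simp
      then show "(\<Sum>n<N. norm (A k (\<lambda>_. y n) - A k (\<lambda>_. y0))) \<le> B k * (2 * ((\<Gamma> + 1) ^ k - 1))"
        by (rule multilinear_form_fluctuation[OF _ y0 \<Gamma>]) (use signs in auto)
    qed
    finally show ?thesis .
  qed
  then show ?thesis by blast
qed

end

section \<open>Perturbations and finite-rank operators\<close>

context banach_space_over
begin

text \<open>
  At a basis functional that belongs to the cell of \<open>g d n\<close>, the vector \<open>y n\<close> should take a
  prescribed unimodular value and all other \<open>y j\<close> should agree with \<open>y0\<close>. Then at each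
  point at most one of the differences \<open>y j - y0\<close> is nonzero, and it is at most 2, which bounds all
  signed sums. The constraints of \<open>pointwise_system_solvable\<close> are \<open>Inl n\<close>, for the norm of \<open>y n\<close>, and
  \<open>Inr s\<close>, for the sum with signs \<open>s\<close>; the bound 5 leaves room for the errors and for the
  normalization that puts \<open>y n\<close> into the unit ball.
\<close>

lemma spread_out_perturbations:
  fixes D :: "'d set" and u :: "'d \<Rightarrow> 'a" and \<theta> :: "'d \<Rightarrow> 'k"
  assumes pre: "L1_predual TYPE('m) smul" and dp: "daugavet_property smul"
    and D: "finite D" and \<theta>: "\<And>d. d \<in> D \<Longrightarrow> norm (\<theta> d) = 1"
    and y0: "norm y0 \<le> 1" and \<epsilon>: "\<epsilon> > 0" and nontrivial: "\<exists>x::'a. x \<noteq> 0"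
  shows "\<exists>(y :: nat \<Rightarrow> 'a) (g :: 'd \<Rightarrow> nat \<Rightarrow> 'a \<Rightarrow> 'k).
    (\<forall>n<N. norm (y n) \<le> 1) \<and>
    (\<forall>s\<in>{..<N} \<rightarrow>\<^sub>E {1, -1 :: real}. norm (\<Sum>j<N. s j *\<^sub>R (y j - y0)) \<le> 5) \<and>
    (\<forall>d\<in>D. \<forall>n<N. g d n \<in> dual smul \<and> onorm (g d n) = 1 \<and>
      (1 - \<epsilon>) * norm (u d) \<le> Re_K (g d n (u d)) \<and> norm (g d n (y n) - \<theta> d) \<le> \<epsilon>)"
proof -
  obtain w0 :: 'a where w0: "w0 \<noteq> 0" using nontrivial by blast
  \<comment> \<open>A slice is given by a unit vector; where \<open>u d = 0\<close> any direction will do.\<close>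
  define unit where "unit x = (if x = 0 then (1 / norm w0) *\<^sub>R w0 else (1 / norm x) *\<^sub>R x)" for x
  have unit: "norm (unit x) = 1" for x using w0 by (simp add: unit_def)
  define Q where "Q = D \<times> {..<N}"
  have Q: "finite Q" using D by (simp add: Q_def)
  define \<delta> where "\<delta> = \<epsilon> / (16 * (1 + real (card Q)))"
  have \<delta>: "\<delta> > 0" "4 * real (card Q) * \<delta> \<le> \<epsilon> / 4" "\<delta> \<le> \<epsilon>"
    using \<epsilon> by (auto simp: \<delta>_def field_simps)
  obtain G where G: "\<And>q. q \<in> Q \<Longrightarrow> G q \<in> dual smul" "\<And>q. q \<in> Q \<Longrightarrow> onorm (G q) = 1"
    "\<And>q. q \<in> Q \<Longrightarrow> Re_K (G q (unit (u (fst q)))) > 1 - \<delta>"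
    "\<And>p q. p \<in> Q \<Longrightarrow> q \<in> Q \<Longrightarrow> p \<noteq> q \<Longrightarrow> onorm (\<lambda>x. G p x + G q x) \<ge> 2 - \<delta> \<and> onorm (\<lambda>x. G p x - G q x) \<ge> 2 - \<delta>"
    using almost_disjoint_functionals[OF dp Q, of "\<lambda>q. unit (u (fst q))", OF unit \<delta>(1)] by blast
  define S where "S = {..<N} \<rightarrow>\<^sub>E {1, -1 :: real}"
  have finS: "finite S" unfolding S_def by (intro finite_PiE) auto
  define K where "K = {..<N} <+> S"
  define a where "a \<kappa> = (case \<kappa> of Inl n \<Rightarrow> 0 | Inr s \<Rightarrow> (\<Sum>j<N. s j *\<^sub>R y0))" for \<kappa> :: "nat + (nat \<Rightarrow> real)"
  define m where "m \<kappa> j = (case \<kappa> of Inl n \<Rightarrow> (if j = n then 1 else 0) | Inr s \<Rightarrow> (of_real (s j) :: 'k))"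
    for \<kappa> :: "nat + (nat \<Rightarrow> real)" and j
  define r where "r \<kappa> = (case \<kappa> of Inl n \<Rightarrow> 1 | Inr s \<Rightarrow> (2 :: real))" for \<kappa> :: "nat + (nat \<Rightarrow> real)"
  define \<eta> where "\<eta> = min (min 1 (\<epsilon> / 4)) (1 / (1 + real N))"
  have \<eta>: "\<eta> > 0" "\<eta> \<le> 1" "\<eta> \<le> \<epsilon> / 4" "\<eta> \<le> 1 / (1 + real N)" using \<epsilon> by (auto simp: \<eta>_def)
  have "real N * \<eta> \<le> real N * (1 / (1 + real N))" using \<eta>(4) by (intro mult_left_mono) auto
  also have "\<dots> \<le> 1" by simp
  finally have N\<eta>: "real N * \<eta> \<le> 1" .
  have "\<exists>e. (\<forall>\<kappa>\<in>K. norm (a \<kappa> - (\<Sum>j<N. smul (m \<kappa> j) (e j))) \<le> (1 + \<eta>) * r \<kappa>) \<and>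
      (\<forall>q\<in>Q. norm (G q (e (snd q)) - \<theta> (fst q)) \<le> (1 + \<eta>) * (\<epsilon> / 4))"
  proof (rule pointwise_system_solvable[where K = K and J = "{..<N}" and Q = Q and r = r and g = G
        and v = snd and \<theta> = "\<lambda>q. \<theta> (fst q)" and \<delta> = \<delta> and \<epsilon> = "\<epsilon> / 4" and a = a and m = m and \<eta> = \<eta>, OF pre])
    show "finite K" using finS by (simp add: K_def)
    show "finite {..<N}" "finite Q" by (simp_all add: Q)
    show "0 < r \<kappa>" if "\<kappa> \<in> K" for \<kappa> by (simp add: r_def split: sum.split)
    show "G q \<in> dual smul" "onorm (G q) = 1" if "q \<in> Q" for q using G that by auto
    show "snd q \<in> {..<N}" "norm (\<theta> (fst q)) = 1" if "q \<in> Q" for q using that \<theta> by (auto simp: Q_def)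
    show "2 - \<delta> \<le> onorm (\<lambda>x. G p x + G q x) \<and> 2 - \<delta> \<le> onorm (\<lambda>x. G p x - G q x)"
      if "p \<in> Q" "q \<in> Q" "p \<noteq> q" for p q by (rule G(4)[OF that])
    show "0 \<le> \<delta>" "4 * real (card Q) * \<delta> \<le> \<epsilon> / 4" "0 < \<epsilon> / 4" "0 < \<eta>" using \<delta> \<epsilon> \<eta> by auto
  next
    fix b :: "'a \<Rightarrow> 'k" and \<omega> :: 'k and z :: "nat + (nat \<Rightarrow> real) \<Rightarrow> 'k" and Q'
    assume b: "b \<in> dual smul" "onorm b \<le> 1" and \<omega>: "norm \<omega> = 1" and Q': "Q' \<subseteq> Q" "card Q' \<le> 1"
    have by0: "norm (b y0) \<le> 1" using dual_norm_le_unit[OF b y0] .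
    have "finite Q'" using Q Q'(1) finite_subset by blast
    then consider "Q' = {}" | q where "Q' = {q}"
      using Q'(2) by (metis One_nat_def card_0_eq card_1_singletonE le_Suc_eq le_zero_eq)
    then obtain n0 t where t: "norm t \<le> 1" "\<forall>q\<in>Q'. snd q = n0 \<and> \<theta> (fst q) * \<omega> = t"
    proof cases
      case 1 then show ?thesis using that[of 0] by simp
    next
      case (2 q)
      then have "norm (\<theta> (fst q) * \<omega>) = 1" using Q'(1) \<theta> \<omega> by (auto simp: Q_def norm_mult)
      then have "norm (\<theta> (fst q) * \<omega>) \<le> 1" by (rule eq_refl)
      moreover have "\<forall>p\<in>Q'. snd p = snd q \<and> \<theta> (fst p) * \<omega> = \<theta> (fst q) * \<omega>" using 2 by blast
      ultimately show ?thesis by (rule that)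
    qed
    define s where "s j = (if j = n0 then t else b y0)" for j
    have s: "norm (s j) \<le> 1" for j using t(1) by0 by (simp add: s_def)
    have close: "norm (b (a \<kappa>) - (\<Sum>j<N. m \<kappa> j * s j)) \<le> r \<kappa>" if k: "\<kappa> \<in> K" for \<kappa>
    proof (cases \<kappa>)
      case (Inl n)
      then have "n < N" using k by (auto simp: K_def)
      have "(\<Sum>j<N. m \<kappa> j * s j) = (\<Sum>j<N. if j = n then s j else 0)"
        by (intro sum.cong) (simp_all add: m_def Inl)
      also have "\<dots> = s n" using \<open>n < N\<close> by simp
      finally show ?thesis using s[of n] by (simp add: a_def r_def Inl dualD(4)[OF b(1)])
    next
      case (Inr \<sigma>)
      then have "\<sigma> \<in> S" using k by (auto simp: K_def)
      have \<sigma>: "\<bar>\<sigma> j\<bar> = 1" if "j < N" for j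
      proof -
        have "\<sigma> j \<in> {1, -1}"
          using PiE_mem[of \<sigma> "{..<N}" "\<lambda>_. {1, -1}" j] that \<open>\<sigma> \<in> S\<close> by (simp add: S_def)
        then show ?thesis by auto
      qed
      have "b (a \<kappa>) - (\<Sum>j<N. m \<kappa> j * s j) = (\<Sum>j<N. \<sigma> j *\<^sub>R b y0 - of_real (\<sigma> j) * s j)"
        by (simp add: a_def m_def Inr dualD[OF b(1)] sum_subtractf)
      also have "\<dots> = (\<Sum>j<N. if j = n0 then \<sigma> j *\<^sub>R (b y0 - t) else 0)"
        by (intro sum.cong) (auto simp: s_def scaleR_conv_of_real algebra_simps)
      also have "norm \<dots> \<le> norm (b y0 - t)" using \<sigma> by simp
      also have "\<dots> \<le> 2" using norm_triangle_ineq4[of "b y0" t] by0 t(1) by simp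
      finally show ?thesis by (simp add: r_def Inr)
    qed
    have "Re_K (\<Sum>\<kappa>\<in>K. z \<kappa> * b (a \<kappa>)) - Re_K (\<Sum>\<kappa>\<in>K. z \<kappa> * (\<Sum>j<N. m \<kappa> j * s j)) =
        (\<Sum>\<kappa>\<in>K. Re_K (z \<kappa> * (b (a \<kappa>) - (\<Sum>j<N. m \<kappa> j * s j))))"
      by (simp add: Re_K_sum Re_K_simps right_diff_distrib sum_subtractf)
    also have "\<dots> \<le> (\<Sum>\<kappa>\<in>K. r \<kappa> * norm (z \<kappa>))"
    proof (intro sum_mono order.trans[OF Re_K_le_norm])
      fix \<kappa> assume "\<kappa> \<in> K"
      then show "norm (z \<kappa> * (b (a \<kappa>) - (\<Sum>j<N. m \<kappa> j * s j))) \<le> r \<kappa> * norm (z \<kappa>)"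
        using mult_left_mono[OF close, of \<kappa> "norm (z \<kappa>)"] by (simp add: norm_mult mult.commute)
    qed
    finally show "\<exists>s. (\<forall>j\<in>{..<N}. norm (s j) \<le> 1) \<and> (\<forall>q\<in>Q'. s (snd q) = \<theta> (fst q) * \<omega>) \<and>
        Re_K (\<Sum>\<kappa>\<in>K. z \<kappa> * b (a \<kappa>)) \<le>
          Re_K (\<Sum>\<kappa>\<in>K. z \<kappa> * (\<Sum>j<N. m \<kappa> j * s j)) + (\<Sum>\<kappa>\<in>K. r \<kappa> * norm (z \<kappa>))"
      using s t(2) by (intro exI[of _ s]) (auto simp: s_def)
  qed blast
  then obtain e where e: "\<And>\<kappa>. \<kappa> \<in> K \<Longrightarrow> norm (a \<kappa> - (\<Sum>j<N. smul (m \<kappa> j) (e j))) \<le> (1 + \<eta>) * r \<kappa>"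
    "\<And>q. q \<in> Q \<Longrightarrow> norm (G q (e (snd q)) - \<theta> (fst q)) \<le> (1 + \<eta>) * (\<epsilon> / 4)" by blast
  have enorm: "norm (e n) \<le> 1 + \<eta>" if n: "n < N" for n
  proof -
    have "(\<Sum>j<N. smul (m (Inl n) j) (e j)) = (\<Sum>j<N. if j = n then e j else 0)"
      by (intro sum.cong) (simp_all add: m_def)
    also have "\<dots> = e n" using n by simp
    finally show ?thesis using e(1)[of "Inl n"] n by (auto simp: K_def a_def r_def)
  qed
  define y where "y n = (1 / (1 + \<eta>)) *\<^sub>R e n" for n
  have y: "norm (y n) \<le> 1" if "n < N" for n
    using enorm[OF that] \<eta>(1) by (simp add: y_def field_simps)
  have ye: "norm (y n - e n) \<le> \<eta>" if "n < N" for n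
  proof -
    have "e n = (1 + \<eta>) *\<^sub>R y n" using \<eta>(1) by (simp add: y_def)
    then have "y n - e n = (- \<eta>) *\<^sub>R y n" by (simp add: algebra_simps)
    then show ?thesis using y[OF that] \<eta>(1) by (simp add: mult_left_le)
  qed
  show ?thesis
  proof (intro exI[of _ y] exI[of _ "\<lambda>d n. G (d, n)"] conjI[of "\<forall>n<N. _ n"] conjI[of "\<forall>s\<in>_. _ s"] ballI allI impI)
    show "norm (y n) \<le> 1" if "n < N" for n by (rule y[OF that])
  next
    fix s assume s: "s \<in> {..<N} \<rightarrow>\<^sub>E {1, -1 :: real}"
    have abs_s: "\<bar>s j\<bar> = 1" if "j < N" for j
    proof -
      have "s j \<in> {1, -1}" using PiE_mem[OF s, of j] that by simp
      then show ?thesis by auto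
    qed
    have "Inr s \<in> K" using s by (auto simp: K_def S_def)
    then have "norm ((\<Sum>j<N. s j *\<^sub>R y0) - (\<Sum>j<N. s j *\<^sub>R e j)) \<le> (1 + \<eta>) * 2"
      using e(1)[of "Inr s"] by (simp add: a_def m_def r_def smul_of_real)
    then have 1: "norm (\<Sum>j<N. s j *\<^sub>R (e j - y0)) \<le> 4"
      using \<eta>(2) by (simp add: scaleR_diff_right sum_subtractf norm_minus_commute)
    have "norm (\<Sum>j<N. s j *\<^sub>R (y j - e j)) \<le> (\<Sum>j<N. \<eta>)"
      using ye abs_s by (intro sum_norm_le) simp
    then have 2: "norm (\<Sum>j<N. s j *\<^sub>R (y j - e j)) \<le> 1" using N\<eta> by simp
    have "(\<Sum>j<N. s j *\<^sub>R (y j - y0)) = (\<Sum>j<N. s j *\<^sub>R (e j - y0)) + (\<Sum>j<N. s j *\<^sub>R (y j - e j))"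
      by (simp add: sum.distrib[symmetric] scaleR_add_right[symmetric])
    then show "norm (\<Sum>j<N. s j *\<^sub>R (y j - y0)) \<le> 5" using norm_triangle_mono[OF 1 2] by simp
  next
    fix d n assume d: "d \<in> D" and n: "n < N"
    have q: "(d, n) \<in> Q" using d n by (simp add: Q_def)
    note Gq = G(1)[OF q]
    have "(1 - \<epsilon>) * norm (u d) \<le> Re_K (G (d, n) (u d))"
    proof (cases "u d = 0")
      case True then show ?thesis by (simp add: dualD(4)[OF Gq] Re_K_simps)
    next
      case False
      then have "u d = norm (u d) *\<^sub>R unit (u d)" by (simp add: unit_def)
      then have "Re_K (G (d, n) (u d)) = norm (u d) * Re_K (G (d, n) (unit (u d)))"
        using dualD(6)[OF Gq, of "norm (u d)" "unit (u d)"] by (simp add: Re_K_simps)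
      moreover have "norm (u d) * (1 - \<epsilon>) \<le> norm (u d) * Re_K (G (d, n) (unit (u d)))"
        using G(3)[OF q] \<delta>(3) by (intro mult_left_mono) auto
      ultimately show ?thesis by (simp add: mult.commute)
    qed
    moreover have "norm (G (d, n) (y n) - \<theta> d) \<le> \<epsilon>"
    proof -
      have "norm (G (d, n) (y n - e n)) \<le> \<eta>"
        using dual_norm_le[OF Gq, of 1 "y n - e n"] G(2)[OF q] ye[OF n] by simp
      moreover have "norm (G (d, n) (e n) - \<theta> d) \<le> (1 + \<eta>) * (\<epsilon> / 4)" using e(2)[OF q] by simp
      moreover have "(1 + \<eta>) * (\<epsilon> / 4) \<le> 2 * (\<epsilon> / 4)" using \<eta> \<epsilon> by (intro mult_right_mono) auto
      moreover have "norm (G (d, n) (y n) - \<theta> d) \<le> norm (G (d, n) (y n - e n)) + norm (G (d, n) (e n) - \<theta> d)"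
        using norm_triangle_ineq[of "G (d, n) (y n - e n)" "G (d, n) (e n) - \<theta> d"] by (simp add: dualD(5)[OF Gq])
      ultimately show ?thesis using \<eta>(3) \<epsilon> by linarith
    qed
    ultimately show "G (d, n) \<in> dual smul \<and> onorm (G (d, n)) = 1 \<and>
      (1 - \<epsilon>) * norm (u d) \<le> Re_K (G (d, n) (u d)) \<and> norm (G (d, n) (y n) - \<theta> d) \<le> \<epsilon>"
      using G(1,2)[OF q] by blast
  qed
qed

text \<open>
  Suppose that the points \<open>w d\<close> almost carry the support function of the set of all
  \<open>(b (x i))\<^sub>i\<close> with \<open>b\<close> in the dual ball, so that their convex hull almost contains this set.
  Pointwise, the coefficients of a convex combination form a partition of unity
  that represents the \<open>x i\<close>. Since the scalars in
  \<open>pointwise_system_solvable\<close> may depend on the multipliers, each such combination can be replaced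
  by the single vertex \<open>d\<close> that is almost extreme for these multipliers. The constraint \<open>Inl l\<close> bounds
  the combination with coefficients \<open>l\<close> from a finite net of the polydisc, and \<open>Inr i\<close> expresses that
  \<open>x i\<close> is represented.
\<close>

lemma approximate_barycentric_vectors:
  fixes D :: "'d set" and x :: "nat \<Rightarrow> 'a" and w :: "'d \<Rightarrow> nat \<Rightarrow> 'k"
  assumes pre: "L1_predual TYPE('m) smul" and D: "finite D" and R: "finite R" and \<epsilon>: "\<epsilon> > 0"
    and support: "\<And>z b. b \<in> dual smul \<Longrightarrow> onorm b \<le> 1 \<Longrightarrow>
      \<exists>d\<in>D. Re_K (\<Sum>i\<in>R. z i * b (x i)) \<le> Re_K (\<Sum>i\<in>R. z i * w d i) + \<epsilon> * (\<Sum>i\<in>R. norm (z i))"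
  obtains e where "\<And>l. (\<And>d. d \<in> D \<Longrightarrow> norm (l d) \<le> 1) \<Longrightarrow> norm (\<Sum>d\<in>D. smul (l d) (e d)) \<le> 1 + \<epsilon>"
    "\<And>i. i \<in> R \<Longrightarrow> norm (x i - (\<Sum>d\<in>D. smul (w d i) (e d))) \<le> 2 * \<epsilon>"
proof -
  define \<tau> where "\<tau> = \<epsilon> / (4 * (1 + real (card D)))"
  have \<tau>: "\<tau> > 0" "real (card D) * (\<tau> * 2) \<le> \<epsilon> / 2" using \<epsilon> by (auto simp: \<tau>_def field_simps)
  obtain Z :: "'k set" where Z: "finite Z" "\<And>z. z \<in> Z \<Longrightarrow> norm z \<le> 1" "0 \<in> Z" "1 \<in> Z"
    "\<And>x. norm x \<le> 1 \<Longrightarrow> \<exists>z\<in>Z. norm (x - z) \<le> \<tau>"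
    using finite_net_unit_ball[OF \<tau>(1)] by blast
  define \<Lambda> where "\<Lambda> = D \<rightarrow>\<^sub>E Z"
  have \<Lambda>: "finite \<Lambda>" unfolding \<Lambda>_def using D Z(1) by (intro finite_PiE) auto
  define K where "K = \<Lambda> <+> R"
  define a where "a \<kappa> = (case \<kappa> of Inl l \<Rightarrow> 0 | Inr i \<Rightarrow> x i)" for \<kappa> :: "('d \<Rightarrow> 'k) + nat"
  define m where "m \<kappa> d = (case \<kappa> of Inl l \<Rightarrow> l d | Inr i \<Rightarrow> w d i)" for \<kappa> :: "('d \<Rightarrow> 'k) + nat" and d
  define r where "r \<kappa> = (case \<kappa> of Inl l \<Rightarrow> 1 | Inr i \<Rightarrow> \<epsilon>)" for \<kappa> :: "('d \<Rightarrow> 'k) + nat"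
  define \<eta> where "\<eta> = min 1 (\<epsilon> / 2)"
  have \<eta>: "\<eta> > 0" "\<eta> \<le> 1" "\<eta> \<le> \<epsilon> / 2" using \<epsilon> by (auto simp: \<eta>_def)
  have "\<exists>e. \<forall>\<kappa>\<in>K. norm (a \<kappa> - (\<Sum>d\<in>D. smul (m \<kappa> d) (e d))) \<le> (1 + \<eta>) * r \<kappa>"
  proof (rule pointwise_system_solvable[where K = K and J = D and Q = "{} :: nat set" and r = r
        and g = undefined and v = undefined and \<theta> = undefined and \<delta> = 0 and \<epsilon> = 1 and a = a and m = m and \<eta> = \<eta>, OF pre])
    show "finite K" using \<Lambda> R by (simp add: K_def)
    show "0 < r \<kappa>" if "\<kappa> \<in> K" for \<kappa> using \<epsilon> by (simp add: r_def split: sum.split)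
    show "0 < \<eta>" by (rule \<eta>(1))
  next
    fix b :: "'a \<Rightarrow> 'k" and \<omega> :: 'k and z :: "('d \<Rightarrow> 'k) + nat \<Rightarrow> 'k" and Q'
    assume b: "b \<in> dual smul" "onorm b \<le> 1" and Q': "Q' \<subseteq> ({} :: nat set)"
    obtain d where d: "d \<in> D" "Re_K (\<Sum>i\<in>R. z (Inr i) * b (x i)) \<le>
        Re_K (\<Sum>i\<in>R. z (Inr i) * w d i) + \<epsilon> * (\<Sum>i\<in>R. norm (z (Inr i)))"
      using support[OF b, of "\<lambda>i. z (Inr i)"] by blast
    define s where "s j = (if j = d then 1 else 0 :: 'k)" for j
    have ms: "(\<Sum>j\<in>D. m \<kappa> j * s j) = m \<kappa> d" for \<kappa>
    proof -
      have "(\<Sum>j\<in>D. m \<kappa> j * s j) = (\<Sum>j\<in>D. if j = d then m \<kappa> j else 0)"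
        by (intro sum.cong) (simp_all add: s_def)
      then show ?thesis using D d(1) by simp
    qed
    have "- Re_K (\<Sum>l\<in>\<Lambda>. z (Inl l) * l d) \<le> (\<Sum>l\<in>\<Lambda>. norm (z (Inl l)))"
      unfolding Re_K_sum sum_negf[symmetric]
    proof (rule sum_mono)
      fix l assume "l \<in> \<Lambda>"
      then have "norm (l d) \<le> 1" using PiE_mem[of l D "\<lambda>_. Z" d] d(1) Z(2) by (auto simp: \<Lambda>_def)
      then have "norm (z (Inl l) * l d) \<le> norm (z (Inl l))" by (simp add: norm_mult mult_left_le)
      then show "- Re_K (z (Inl l) * l d) \<le> norm (z (Inl l))"
        using abs_Re_K_le_norm[of "z (Inl l) * l d"] by simp
    qed
    then have "Re_K (\<Sum>\<kappa>\<in>K. z \<kappa> * b (a \<kappa>)) \<le>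
          Re_K (\<Sum>\<kappa>\<in>K. z \<kappa> * (\<Sum>j\<in>D. m \<kappa> j * s j)) + (\<Sum>\<kappa>\<in>K. r \<kappa> * norm (z \<kappa>))"
      using d(2) \<Lambda> R unfolding ms
      by (simp add: K_def sum.Plus a_def m_def r_def dualD(4)[OF b(1)] Re_K_simps sum_distrib_left)
    then show "\<exists>s. (\<forall>j\<in>D. norm (s j) \<le> 1) \<and> (\<forall>q\<in>Q'. s (undefined q) = undefined q * \<omega>) \<and>
        Re_K (\<Sum>\<kappa>\<in>K. z \<kappa> * b (a \<kappa>)) \<le>
          Re_K (\<Sum>\<kappa>\<in>K. z \<kappa> * (\<Sum>j\<in>D. m \<kappa> j * s j)) + (\<Sum>\<kappa>\<in>K. r \<kappa> * norm (z \<kappa>))"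
      using Q' by (intro exI[of _ s]) (auto simp: s_def)
  qed (use D in auto)
  then obtain e where e: "\<And>\<kappa>. \<kappa> \<in> K \<Longrightarrow> norm (a \<kappa> - (\<Sum>d\<in>D. smul (m \<kappa> d) (e d))) \<le> (1 + \<eta>) * r \<kappa>"
    by blast
  have net: "norm (\<Sum>d\<in>D. smul (l d) (e d)) \<le> 1 + \<eta>" if "l \<in> \<Lambda>" for l
    using e[of "Inl l"] that by (auto simp: K_def a_def m_def r_def)
  have enorm: "norm (e d) \<le> 2" if d: "d \<in> D" for d
  proof -
    define l where "l = (\<lambda>j\<in>D. if j = d then 1 else 0 :: 'k)"
    have "l \<in> \<Lambda>" using Z(3,4) by (auto simp: \<Lambda>_def l_def)
    moreover have "(\<Sum>j\<in>D. smul (l j) (e j)) = (\<Sum>j\<in>D. if j = d then e j else 0)"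
      by (intro sum.cong) (auto simp: l_def)
    ultimately show ?thesis using net[of l] D d \<eta>(2) by simp
  qed
  show ?thesis
  proof (rule that[of e])
    fix l :: "'d \<Rightarrow> 'k" assume l: "\<And>d. d \<in> D \<Longrightarrow> norm (l d) \<le> 1"
    have "\<forall>d\<in>D. \<exists>z. z \<in> Z \<and> norm (l d - z) \<le> \<tau>" using Z(5) l by blast
    from bchoice[OF this] obtain l' where l': "\<And>d. d \<in> D \<Longrightarrow> l' d \<in> Z" "\<And>d. d \<in> D \<Longrightarrow> norm (l d - l' d) \<le> \<tau>"
      by blast
    have "restrict l' D \<in> \<Lambda>" using l'(1) by (auto simp: \<Lambda>_def)
    then have 1: "norm (\<Sum>d\<in>D. smul (l' d) (e d)) \<le> 1 + \<eta>" using net[of "restrict l' D"] by simp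
    have "norm (\<Sum>d\<in>D. smul (l d - l' d) (e d)) \<le> (\<Sum>d\<in>D. \<tau> * 2)"
      using l'(2) enorm \<tau>(1) by (intro sum_norm_le) (auto simp: norm_smul intro!: mult_mono)
    then have 2: "norm (\<Sum>d\<in>D. smul (l d - l' d) (e d)) \<le> \<epsilon> / 2" using \<tau>(2) by simp
    have "(\<Sum>d\<in>D. smul (l d) (e d)) = (\<Sum>d\<in>D. smul (l' d) (e d)) + (\<Sum>d\<in>D. smul (l d - l' d) (e d))"
      by (simp add: scale_left_diff_distrib sum_subtractf)
    then show "norm (\<Sum>d\<in>D. smul (l d) (e d)) \<le> 1 + \<epsilon>"
      using norm_triangle_mono[OF 1 2] \<eta>(3) by simp
  next
    fix i assume "i \<in> R"
    then have "norm (x i - (\<Sum>d\<in>D. smul (w d i) (e d))) \<le> (1 + \<eta>) * \<epsilon>"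
      using e[of "Inr i"] by (auto simp: K_def a_def m_def r_def)
    also have "\<dots> \<le> 2 * \<epsilon>" using \<eta>(2) \<epsilon> by (intro mult_right_mono) auto
    finally show "norm (x i - (\<Sum>d\<in>D. smul (w d i) (e d))) \<le> 2 * \<epsilon>" .
  qed
qed

lemma finite_rank_operator:
  assumes g: "\<And>d. d \<in> D \<Longrightarrow> g d \<in> dual smul" "\<And>d. d \<in> D \<Longrightarrow> onorm (g d) \<le> 1"
    and e: "\<And>l. (\<And>d. d \<in> D \<Longrightarrow> norm (l d) \<le> 1) \<Longrightarrow> norm (\<Sum>d\<in>D. smul (l d) (e d)) \<le> c"
    and c: "0 \<le> c"
  defines "T \<equiv> \<lambda>x. \<Sum>d\<in>D. smul (g d x) (e d)"
  shows "bounded_linear_over smul smul T" "onorm T \<le> c"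
proof -
  have "bounded_linear T"
    unfolding T_def using rank_one_operator[OF g(1)]
    by (intro bounded_linear_sum) (auto simp: bounded_linear_over_def)
  moreover have "Vector_Spaces.linear smul smul T"
    unfolding Vector_Spaces.linear_iff using vector_space_axioms
    by (simp add: T_def dualD[OF g(1)] scale_left_distrib sum.distrib scale_sum_right)
  ultimately show "bounded_linear_over smul smul T" by (simp add: bounded_linear_over_def)
  show "onorm T \<le> c"
  proof (rule onorm_bound[OF c])
    fix x
    show "norm (T x) \<le> c * norm x"
    proof (cases "x = 0")
      case True
      then have "T x = 0" by (simp add: T_def dualD(4)[OF g(1)])
      then show ?thesis using True by simp
    next
      case False
      have "norm (\<Sum>d\<in>D. smul (g d ((1 / norm x) *\<^sub>R x)) (e d)) \<le> c"
        by (intro e dual_norm_le_unit g) (use False in auto)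
      also have "(\<Sum>d\<in>D. smul (g d ((1 / norm x) *\<^sub>R x)) (e d)) = (1 / norm x) *\<^sub>R T x"
        by (simp add: T_def dualD(6)[OF g(1)] smul_scaleR scaleR_sum_right)
      finally show ?thesis using False by (simp add: field_simps)
    qed
  qed
qed

end

section \<open>The polynomial weak operator Daugavet property\<close>

context banach_space_over
begin

text \<open>
  For multipliers \<open>z\<close> with sum of moduli \<open>S\<close>, the relevant point is the one that belongs to a
  vector \<open>d\<close> of the net near \<open>z / S\<close>. Every \<open>b\<close> in the dual ball satisfies
  \<open>Re (b u + d n \<cdot> b (x n)) \<le> norm u + \<bar>d n\<bar>\<close>, where \<open>u\<close> is the combination of \<open>x i\<close> (\<open>i < n\<close>) with
  coefficients \<open>d i\<close>, and \<open>g d\<close>, evaluated at \<open>y\<close> instead of \<open>x n\<close>, almost attains the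
  right-hand side.
\<close>

lemma almost_orthogonal_functionals_support:
  fixes x :: "nat \<Rightarrow> 'a" and g :: "(nat \<Rightarrow> 'k) \<Rightarrow> 'a \<Rightarrow> 'k" and n :: nat
  assumes Z: "\<And>z. norm z \<le> 1 \<Longrightarrow> \<exists>c\<in>Z. norm (z - c) \<le> \<tau>" "\<And>z. z \<in> Z \<Longrightarrow> norm z \<le> 1"
    and x: "\<And>i. i \<le> n \<Longrightarrow> norm (x i) \<le> 1" and y: "norm y \<le> 1"
    and g: "\<And>d. d \<in> {..n} \<rightarrow>\<^sub>E Z \<Longrightarrow> g d \<in> dual smul \<and> onorm (g d) = 1"
    and slice: "\<And>d. d \<in> {..n} \<rightarrow>\<^sub>E Z \<Longrightarrow>
      (1 - \<tau>) * norm (\<Sum>i<n. smul (d i) (x i)) \<le> Re_K (g d (\<Sum>i<n. smul (d i) (x i)))"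
    and at_y: "\<And>d. d \<in> {..n} \<rightarrow>\<^sub>E Z \<Longrightarrow> norm (g d y - \<theta> d) \<le> \<tau> \<and> \<theta> d * d n = of_real (norm (d n))"
    and \<tau>: "0 \<le> \<tau>" and b: "b \<in> dual smul" "onorm b \<le> 1"
  shows "\<exists>d\<in>{..n} \<rightarrow>\<^sub>E Z. Re_K (\<Sum>i\<le>n. z i * b (x i)) \<le>
    Re_K (\<Sum>i\<le>n. z i * g d (if i < n then x i else y)) + 3 * (real n + 1) * \<tau> * (\<Sum>i\<le>n. norm (z i))"
proof -
  define S where "S = (\<Sum>i\<le>n. norm (z i))"
  have S: "0 \<le> S" by (simp add: S_def sum_nonneg)
  have "\<exists>c. c \<in> Z \<and> norm (z i - of_real S * c) \<le> S * \<tau>" if "i \<le> n" for i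
  proof (cases "S = 0")
    case True
    then have "z i = 0" using that by (simp add: S_def sum_nonneg_eq_0_iff)
    moreover obtain c where "c \<in> Z" using Z(1)[of 0] by auto
    ultimately show ?thesis using True by auto
  next
    case False
    have "norm (z i) \<le> S" unfolding S_def using that by (intro member_le_sum) auto
    then have "norm (z i / of_real S) \<le> 1" using False S by (simp add: norm_divide)
    then obtain c where c: "c \<in> Z" "norm (z i / of_real S - c) \<le> \<tau>" using Z(1) by blast
    have "z i - of_real S * c = of_real S * (z i / of_real S - c)" using False by (simp add: field_simps)
    then have "norm (z i - of_real S * c) \<le> S * \<tau>"
      using c(2) S by (simp only: norm_mult) (simp add: mult_left_mono)
    then show ?thesis using c(1) by blast
  qed
  then have "\<forall>i\<in>{..n}. \<exists>c. c \<in> Z \<and> norm (z i - of_real S * c) \<le> S * \<tau>" by simp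
  from bchoice[OF this] obtain d0 where d0: "\<And>i. i \<le> n \<Longrightarrow> d0 i \<in> Z"
    "\<And>i. i \<le> n \<Longrightarrow> norm (z i - of_real S * d0 i) \<le> S * \<tau>" by auto
  define d where "d = restrict d0 {..n}"
  have d: "d \<in> {..n} \<rightarrow>\<^sub>E Z" "\<And>i. i \<le> n \<Longrightarrow> norm (z i - of_real S * d i) \<le> S * \<tau>"
    "\<And>i. i \<le> n \<Longrightarrow> norm (d i) \<le> 1"
    using d0 Z(2) by (auto simp: d_def)
  have gd: "g d \<in> dual smul" "onorm (g d) \<le> 1" using g[OF d(1)] by auto
  have replace: "\<bar>Re_K (\<Sum>i\<le>n. z i * v i) - S * Re_K (\<Sum>i\<le>n. d i * v i)\<bar> \<le> (real n + 1) * (S * \<tau>)"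
    if v: "\<And>i. i \<le> n \<Longrightarrow> norm (v i) \<le> 1" for v
  proof -
    have "Re_K (\<Sum>i\<le>n. z i * v i) - S * Re_K (\<Sum>i\<le>n. d i * v i) = Re_K (\<Sum>i\<le>n. (z i - of_real S * d i) * v i)"
      by (simp add: Re_K_simps(2) left_diff_distrib sum_subtractf mult.assoc flip: sum_distrib_left Re_K_simps(5))
    also have "\<bar>\<dots>\<bar> \<le> norm (\<Sum>i\<le>n. (z i - of_real S * d i) * v i)" by (rule abs_Re_K_le_norm)
    also have "\<dots> \<le> (\<Sum>i\<le>n. S * \<tau>)"
    proof (rule sum_norm_le)
      fix i assume "i \<in> {..n}"
      then have "norm (z i - of_real S * d i) * norm (v i) \<le> (S * \<tau>) * 1"
        using d(2) v S \<tau> by (intro mult_mono) auto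
      then show "norm ((z i - of_real S * d i) * v i) \<le> S * \<tau>" by (simp add: norm_mult)
    qed
    finally show ?thesis by (simp add: algebra_simps)
  qed
  define u where "u = (\<Sum>i<n. smul (d i) (x i))"
  have "norm u \<le> (\<Sum>i<n. 1)"
    unfolding u_def
  proof (rule sum_norm_le)
    fix i assume "i \<in> {..<n}"
    then show "norm (smul (d i) (x i)) \<le> 1"
      using d(3)[of i] x[of i] by (simp add: norm_smul mult_le_one)
  qed
  then have unorm: "norm u \<le> real n" by simp
  have split: "(\<Sum>i\<le>n. d i * f (if i < n then x i else v)) = f u + d n * f v" if "f \<in> dual smul" for f v
    by (simp add: u_def dualD[OF that] flip: lessThan_Suc_atMost)
  have b_le: "Re_K (\<Sum>i\<le>n. d i * b (x i)) \<le> norm u + norm (d n)"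
  proof -
    have "(\<Sum>i\<le>n. d i * b (x i)) = b u + d n * b (x n)"
      by (simp add: u_def dualD[OF b(1)] flip: lessThan_Suc_atMost)
    moreover have "norm (b u) \<le> norm u" using dual_norm_le[OF b, of u] by simp
    moreover have "norm (d n * b (x n)) \<le> norm (d n)"
      using dual_norm_le_unit[OF b x[of n]] by (simp add: norm_mult mult_left_le)
    ultimately show ?thesis
      using Re_K_le_norm[of "b u"] Re_K_le_norm[of "d n * b (x n)"] by (simp add: Re_K_simps)
  qed
  have "norm u + norm (d n) - (real n + 1) * \<tau> \<le> Re_K (\<Sum>i\<le>n. d i * g d (if i < n then x i else y))"
  proof -
    have "norm u - real n * \<tau> \<le> (1 - \<tau>) * norm u"
      using mult_right_mono[OF unorm \<tau>] by (simp add: algebra_simps)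
    also have "\<dots> \<le> Re_K (g d u)" using slice[OF d(1)] by (simp add: u_def)
    finally have 1: "norm u - real n * \<tau> \<le> Re_K (g d u)" .
    have "d n * g d y = of_real (norm (d n)) + d n * (g d y - \<theta> d)"
      using at_y[OF d(1)] by (simp add: algebra_simps)
    moreover have "norm (d n * (g d y - \<theta> d)) \<le> 1 * \<tau>"
      unfolding norm_mult using at_y[OF d(1)] d(3)[of n] by (intro mult_mono) auto
    ultimately have 2: "norm (d n) - \<tau> \<le> Re_K (d n * g d y)"
      using abs_Re_K_le_norm[of "d n * (g d y - \<theta> d)"] by (simp add: Re_K_simps)
    show ?thesis using 1 2 by (simp add: split[OF gd(1)] Re_K_simps algebra_simps)
  qed
  then have "S * Re_K (\<Sum>i\<le>n. d i * b (x i)) \<le>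
      S * (Re_K (\<Sum>i\<le>n. d i * g d (if i < n then x i else y)) + (real n + 1) * \<tau>)"
    using b_le S by (intro mult_left_mono) linarith+
  moreover have "\<bar>Re_K (\<Sum>i\<le>n. z i * b (x i)) - S * Re_K (\<Sum>i\<le>n. d i * b (x i))\<bar> \<le> (real n + 1) * (S * \<tau>)"
    by (intro replace dual_norm_le_unit b x)
  moreover have "\<bar>Re_K (\<Sum>i\<le>n. z i * g d (if i < n then x i else y)) -
      S * Re_K (\<Sum>i\<le>n. d i * g d (if i < n then x i else y))\<bar> \<le> (real n + 1) * (S * \<tau>)"
    using x y by (intro replace dual_norm_le_unit gd) auto
  ultimately have "Re_K (\<Sum>i\<le>n. z i * b (x i)) \<le>
      Re_K (\<Sum>i\<le>n. z i * g d (if i < n then x i else y)) + 3 * (real n + 1) * \<tau> * S"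
    by (simp add: algebra_simps)
  then show ?thesis using d(1) unfolding S_def by blast
qed

text \<open>
  Every point \<open>y0\<close> of the unit ball can be moved into the operator set with almost no change of
  the value of \<open>P\<close>. The index \<open>n\<close> of the family \<open>x\<close>, one past the list, stands for \<open>x'\<close> on the target
  side and for \<open>y\<close> on the side of the functionals.
\<close>

lemma OF_set_near_every_point:
  assumes pre: "L1_predual TYPE('m) smul" and dp: "daugavet_property smul"
    and P: "P \<in> polynomials smul" and xs: "set xs \<subseteq> cball 0 1" and x': "norm x' \<le> 1"
    and \<epsilon>: "\<epsilon> > 0" and \<gamma>: "\<gamma> > 0" and y0: "norm y0 \<le> 1"
  shows "\<exists>y\<in>OF_set smul xs x' \<epsilon>. norm (P y - P y0) < \<gamma>"
proof (cases "\<exists>x::'a. x \<noteq> 0")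
  case False
  have "bounded_linear_over smul smul (\<lambda>x. 0)"
    using rank_one_operator[OF dual_zero, of 0] by simp
  moreover have "norm x < \<epsilon>" for x :: 'a
  proof -
    have "x = 0" using False by blast
    then show ?thesis using \<epsilon> by simp
  qed
  ultimately have "y0 \<in> OF_set smul xs x' \<epsilon>"
    using \<epsilon> y0 unfolding OF_set_def by (auto intro!: exI[of _ "\<lambda>x. 0"] simp: onorm_zero)
  then show ?thesis using \<gamma> by (intro bexI[of _ y0]) auto
next
  case True
  define n where "n = length xs"
  define \<epsilon>1 where "\<epsilon>1 = \<epsilon> / 4"
  define \<tau> where "\<tau> = \<epsilon>1 / (3 * (real n + 1))"
  have \<epsilon>1: "\<epsilon>1 > 0" using \<epsilon> by (simp add: \<epsilon>1_def)
  have \<tau>: "\<tau> > 0" "3 * (real n + 1) * \<tau> = \<epsilon>1" using \<epsilon>1 by (auto simp: \<tau>_def)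
  define x where "x i = (if i < n then xs ! i else x')" for i
  have x: "norm (x i) \<le> 1" for i
  proof (cases "i < n")
    case True
    then have "xs ! i \<in> set xs" by (simp add: n_def)
    then have "xs ! i \<in> cball 0 1" using xs by (rule rev_subsetD)
    then show ?thesis using True by (simp add: x_def)
  qed (simp add: x_def x')
  obtain c where c: "\<And>N y y0. norm y0 \<le> 1 \<Longrightarrow>
      (\<forall>s\<in>{..<N} \<rightarrow>\<^sub>E {1, -1 :: real}. norm (\<Sum>j<N. s j *\<^sub>R (y j - y0)) \<le> 5) \<Longrightarrow>
      (\<Sum>n<(N::nat). norm (P (y n) - P y0)) \<le> c"
    using polynomial_fluctuation[OF P, of 5] by auto
  obtain N :: nat where "c / \<gamma> < real N" using reals_Archimedean2 by blast
  then have N: "c < real N * \<gamma>" using \<gamma> by (simp add: field_simps)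
  obtain Z :: "'k set" where Z: "finite Z" "\<And>z. z \<in> Z \<Longrightarrow> norm z \<le> 1" "0 \<in> Z" "1 \<in> Z"
    "\<And>x. norm x \<le> 1 \<Longrightarrow> \<exists>z\<in>Z. norm (x - z) \<le> \<tau>"
    using finite_net_unit_ball[OF \<tau>(1)] by blast
  define D where "D = {..n} \<rightarrow>\<^sub>E Z"
  have D: "finite D" unfolding D_def using Z(1) by (intro finite_PiE) auto
  have "\<exists>t. norm t = 1 \<and> t * d n = of_real (norm (d n))" for d :: "nat \<Rightarrow> 'k"
    using unimodular_to_norm by metis
  then obtain \<theta> where \<theta>: "\<And>d :: nat \<Rightarrow> 'k. norm (\<theta> d) = 1" "\<And>d :: nat \<Rightarrow> 'k. \<theta> d * d n = of_real (norm (d n))"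
    by metis
  define u where "u d = (\<Sum>i<n. smul (d i) (x i))" for d
  have \<theta>D: "\<And>d. d \<in> D \<Longrightarrow> norm (\<theta> d) = 1" by (rule \<theta>(1))
  have "\<exists>(y :: nat \<Rightarrow> 'a) (g :: (nat \<Rightarrow> 'k) \<Rightarrow> nat \<Rightarrow> 'a \<Rightarrow> 'k). (\<forall>k<N. norm (y k) \<le> 1) \<and>
      (\<forall>s\<in>{..<N} \<rightarrow>\<^sub>E {1, -1 :: real}. norm (\<Sum>j<N. s j *\<^sub>R (y j - y0)) \<le> 5) \<and>
      (\<forall>d\<in>D. \<forall>k<N. g d k \<in> dual smul \<and> onorm (g d k) = 1 \<and>
        (1 - \<tau>) * norm (u d) \<le> Re_K (g d k (u d)) \<and> norm (g d k (y k) - \<theta> d) \<le> \<tau>)"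
    by (rule spread_out_perturbations[OF pre dp D \<theta>(1) y0 \<tau>(1) True])
  then obtain y g where y: "\<forall>k<N. norm (y k) \<le> 1"
    and signs: "\<forall>s\<in>{..<N} \<rightarrow>\<^sub>E {1, -1 :: real}. norm (\<Sum>j<N. s j *\<^sub>R (y j - y0)) \<le> 5"
    and g: "\<forall>d\<in>D. \<forall>k<N. g d k \<in> dual smul \<and> onorm (g d k) = 1 \<and>
      (1 - \<tau>) * norm (u d) \<le> Re_K (g d k (u d)) \<and> norm (g d k (y k) - \<theta> d) \<le> \<tau>"
    by (elim exE conjE)
  have "\<exists>k<N. norm (P (y k) - P y0) < \<gamma>"
  proof (rule ccontr)
    assume "\<not> ?thesis"
    then have "(\<Sum>k<N. \<gamma>) \<le> (\<Sum>k<N. norm (P (y k) - P y0))" by (intro sum_mono) auto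
    moreover have "(\<Sum>k<N. norm (P (y k) - P y0)) \<le> c" by (intro c y0 signs)
    ultimately show False using N by simp
  qed
  then obtain k where k: "k < N" "norm (P (y k) - P y0) < \<gamma>" by blast
  have yk: "norm (y k) \<le> 1" using y k(1) by blast
  have gk': "g d k \<in> dual smul" "onorm (g d k) = 1" "(1 - \<tau>) * norm (u d) \<le> Re_K (g d k (u d))"
    "norm (g d k (y k) - \<theta> d) \<le> \<tau>" if "d \<in> D" for d
    using g that k(1) by blast+
  define w where "w d i = g d k (if i < n then x i else y k)" for d i
  have gk: "g d k \<in> dual smul" "onorm (g d k) \<le> 1" if "d \<in> D" for d using gk'[OF that] by auto
  have support: "\<exists>d\<in>D. Re_K (\<Sum>i\<in>{..n}. z i * b (x i)) \<le>
      Re_K (\<Sum>i\<in>{..n}. z i * w d i) + \<epsilon>1 * (\<Sum>i\<in>{..n}. norm (z i))"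
    if "b \<in> dual smul" "onorm b \<le> 1" for z b
    unfolding \<tau>(2)[symmetric] w_def D_def
    by (rule almost_orthogonal_functionals_support[where \<theta> = \<theta> and g = "\<lambda>d. g d k"])
       (use Z x yk gk' \<theta> \<tau>(1) that in \<open>auto simp: D_def u_def\<close>)
  obtain e where e: "\<And>l. (\<And>d. d \<in> D \<Longrightarrow> norm (l d) \<le> 1) \<Longrightarrow> norm (\<Sum>d\<in>D. smul (l d) (e d)) \<le> 1 + \<epsilon>1"
    "\<And>i. i \<in> {..n} \<Longrightarrow> norm (x i - (\<Sum>d\<in>D. smul (w d i) (e d))) \<le> 2 * \<epsilon>1"
    by (rule approximate_barycentric_vectors[where w = w and x = x, OF pre D finite_atMost \<epsilon>1 support]) blast+
  define T where "T v = (\<Sum>d\<in>D. smul (g d k v) (e d))" for v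
  have T: "bounded_linear_over smul smul T" "onorm T \<le> 1 + \<epsilon>1"
    unfolding T_def using finite_rank_operator[OF gk e(1)] \<epsilon>1 by auto
  have "y k \<in> OF_set smul xs x' \<epsilon>"
    unfolding OF_set_def
  proof (intro CollectI conjI exI[of _ T] ballI)
    show "y k \<in> cball 0 1" using yk by simp
    show "onorm T \<le> 1 + \<epsilon>" using T(2) \<epsilon> by (simp add: \<epsilon>1_def)
    show "norm (T (y k) - x') < \<epsilon>"
      using e(2)[of n] \<epsilon> by (simp add: T_def w_def x_def \<epsilon>1_def norm_minus_commute)
    fix v assume "v \<in> set xs"
    then obtain i where i: "i < n" "v = xs ! i" by (auto simp: in_set_conv_nth n_def)
    then show "norm (T v - v) < \<epsilon>"
      using e(2)[of i] \<epsilon> by (simp add: T_def w_def x_def \<epsilon>1_def norm_minus_commute)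
  qed (rule T(1))
  then show ?thesis using k(2) by blast
qed

end

theorem proposition5p9:
  fixes smul :: "'k::rc_field \<Rightarrow> 'a::banach \<Rightarrow> 'a"
  assumes "banach_space_over smul"
    and "L1_predual TYPE('m) smul"
    and "daugavet_property smul"
  shows "polynomial_WODP smul"
proof -
  interpret banach_space_over smul by fact
  show ?thesis
    unfolding polynomial_WODP_def
  proof (intro allI impI, elim conjE)
    fix P :: "'a \<Rightarrow> 'k" and xs :: "'a list" and x' :: 'a and \<alpha> \<epsilon> :: real
    assume P: "P \<in> polynomials smul" "poly_norm P = 1" and xs: "set xs \<subseteq> sphere 0 1"
      and x': "x' \<in> cball 0 1" and \<alpha>: "0 < \<alpha>" and \<epsilon>: "0 < \<epsilon>"
    have "bdd_above ((\<lambda>x. norm (P x)) ` cball 0 1)"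
      by (rule polynomial_bdd_above_on_ball[OF P(1)])
    moreover have "1 - \<alpha> / 2 < (SUP x\<in>cball 0 1. norm (P x))"
      using P(2) \<alpha> by (simp add: poly_norm_def)
    ultimately obtain y0 where y0: "norm y0 \<le> 1" "1 - \<alpha> / 2 < norm (P y0)"
      by (subst (asm) less_cSUP_iff) auto
    have "set xs \<subseteq> cball 0 1" using xs by auto
    moreover have "norm x' \<le> 1" "\<alpha> / 2 > 0" using x' \<alpha> by auto
    ultimately obtain y where y: "y \<in> OF_set smul xs x' \<epsilon>" "norm (P y - P y0) < \<alpha> / 2"
      using OF_set_near_every_point[OF assms(2,3) P(1), of xs x' \<epsilon> "\<alpha> / 2" y0] \<epsilon> y0(1) by blast
    have "norm (P y) > 1 - \<alpha>"
      using y(2) y0(2) norm_triangle_ineq3[of "P y" "P y0"] by simp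
    moreover obtain \<omega> where "norm \<omega> = 1" "\<omega> * P y = of_real (norm (P y))"
      using unimodular_to_norm by blast
    ultimately show "\<exists>y\<in>OF_set smul xs x' \<epsilon>. \<exists>\<omega>. norm \<omega> = 1 \<and> Re_K (\<omega> * P y) > 1 - \<alpha>"
      using y(1) by (intro bexI[of _ y] exI[of _ \<omega>]) (simp_all add: Re_K_simps)
  qed
qed

end
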